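(* Let $G$ be a graph, let $X$ be a $G$-like continuum with metric $d$, and let $f:X\to X$ be a homeomorphism with positive topological entropy. Suppose that $x_1,\dots,x_m$ ($m\ge 2$) are distinct points of $X$ such that $(x_1,\dots,x_m)$ is an IE-tuple of $f$, and let $A_i$ be a neighborhood of $x_i$ for $i=1,\dots,m$. Then there are Cantor sets $Z_i\subset A_i$ ($i=1,\dots,m$) and an indecomposable subcontinuum $H$ of $X$ such that, with $Z=\bigcup_{i=1}^m Z_i$, the following hold: (1) the Cantor set $Z$ is vertically embedded to composants of $H$; i.e. $Z\subset H$ and if $x,y$ are distinct points of $Z$, then the only subcontinuum of $H$ containing both $x$ and $y$ is $H$ itself; (2) $Z$ has the freely tracing property by free chains: for every $k\in\mathbb N$, every order $w_1\to w_2\to\cdots\to w_k$ of $k$ distinct points $w_1,\dots,w_k$ of $Z$, and every $\epsilon>0$, there is an open cover $\mathcal U$ of $X$ such that the mesh of $\mathcal U$ is less than $\epsilon$, the nerve $N(\mathcal U)$ is (homeomorphic to) $G$, and there is a free chain in $\mathcal U$ which follows from the pattern $[w_1\to w_2\to\cdots\to w_k]$; (3) every finite tuple of points of $Z$ is an IE-tuple of $f$; (4) for all $k\in\mathbb N$, any $k$ distinct points $y_1,\dots,y_k\in Z$ and any points $z_1,\dots,z_k\in Z$, $$\liminf_{n\to\infty}\max\{d(f^n(y_i),z_i)\mid 1\le i\le k\}=0;$$ in particular, $Z$ is a $\delta$-scrambled set of $f$ for some $\delta>0$.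
   Context: All spaces are separable metric and all maps are continuous; $\mathbb N=\{1,2,\dots\}$. A continuum is a compact connected metric space; it is nondegenerate if it has more than one point, and indecomposable if it is nondegenerate and is not the union of two proper subcontinua. A graph is a connected 1-dimensional compact polyhedron. For a graph $G$, a continuum $X$ is $G$-like if for every $\epsilon>0$ there is a (continuous) map $g$ from $X$ onto $G$ with $\operatorname{diam} g^{-1}(y)<\epsilon$ for every $y\in G$. For a finite collection $\mathcal G$ of subsets of $X$, the nerve $N(\mathcal G)$ is the polyhedron whose vertices are the elements of $\mathcal G$, with a simplex $\langle g_1,\dots,g_k\rangle$ on distinct vertices whenever $\bigcap_i g_i\ne\emptyset$; "$N(\mathcal G)$ is $G$" means that $N(\mathcal G)$ is homeomorphic to $G$. The mesh of $\mathcal G$ is the largest diameter of its elements. A subcollection $\{C_1,\dots,C_n\}\subseteq\mathcal G$ is a chain if $C_i\cap C_{i+1}\neq\emptyset$ for $1\le i<n$ and $\overline{C_i}\cap\overline{C_j}\ne\emptyset$ implies $|i-j|\le1$. It is a free chain in $\mathcal G$ if moreover for all $1<i<n$, every $C\in\mathcal G$ with $\overline C\cap\overline{C_i}\neq\emptyset$ is one of $C_{i-1},C_i,C_{i+1}$. A chain $\{C_1,\dots,C_n\}$ follows from the pattern $[w_1\to\cdots\to w_k]$ (points $w_i\in X$; an order is identified with its reverse) if there exist $1\le j_1<j_2<\cdots<j_k\le n$ or $1\le j_k<j_{k-1}<\cdots<j_1\le n$ with $w_i\in C_{j_i}$ for each $i$. A set $I\subseteq\mathbb N$ has positive density if $\liminf_{n\to\infty}|I\cap\{1,\dots,n\}|/n>0$.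 A collection $\mathcal A$ of subsets of $X$ has an independence set with positive density (for $f$) if there is $I\subset\mathbb N$ with positive density such that for all finite $J\subseteq I$ and all $(Y_j)\in\prod_{j\in J}\mathcal A$ we have $\bigcap_{j\in J}f^{-j}(Y_j)\neq\emptyset$. A tuple $(x_1,\dots,x_n)$ of points of $X$ is an IE-tuple of $f$ if for all open sets $A_1,\dots,A_n$ containing $x_1,\dots,x_n$ respectively, the collection $\{A_1,\dots,A_n\}$ has an independence set with positive density. A set $S\subset X$ is a $\delta$-scrambled set of $f$ if $|S|\ge2$ and for all distinct $x,y\in S$, $\liminf_{n\to\infty}d(f^n(x),f^n(y))=0$ and $\limsup_{n\to\infty}d(f^n(x),f^n(y))\ge\delta$. *)

theory Defs
  imports "HOL-Analysis.Analysis"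
begin

text \<open>
  A space is a subset \<open>X\<close> of a type of class \<open>metric_space\<close>, with the induced metric \<open>dist\<close>.
  Finite sequences \<open>x\<^sub>1, \<dots>, x\<^sub>n\<close> are functions on \<^typ>\<open>nat\<close> of which only the values on
  \<open>{1..n}\<close> matter, and \<open>f ^^ n\<close> is the \<open>n\<close>-fold iterate of \<open>f\<close>.
\<close>

section \<open>Continua and Cantor sets\<close>

definition continuum :: "'a::metric_space set \<Rightarrow> bool" where
  "continuum K \<longleftrightarrow> K \<noteq> {} \<and> compact K \<and> connected K"

definition subcontinuum :: "'a::metric_space set \<Rightarrow> 'a set \<Rightarrow> bool" where
  "subcontinuum K X \<longleftrightarrow> continuum K \<and> K \<subseteq> X"

definition nondegenerate :: "'a set \<Rightarrow> bool" where
  "nondegenerate K \<longleftrightarrow> (\<exists>x\<in>K. \<exists>y\<in>K. x \<noteq> y)"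

definition indecomposable :: "'a::metric_space set \<Rightarrow> bool" where
  "indecomposable H \<longleftrightarrow> nondegenerate H \<and>
     \<not> (\<exists>A B. subcontinuum A H \<and> A \<noteq> H \<and> subcontinuum B H \<and> B \<noteq> H \<and> H = A \<union> B)"

text \<open>The type \<^typ>\<open>nat \<Rightarrow> bool\<close> carries the product of the discrete topologies.\<close>

definition cantor_set :: "'a::topological_space set \<Rightarrow> bool" where
  "cantor_set C \<longleftrightarrow> C homeomorphic (UNIV :: (nat \<Rightarrow> bool) set)"

definition vertically_embedded :: "'a::metric_space set \<Rightarrow> 'a set \<Rightarrow> bool" where
  "vertically_embedded Z H \<longleftrightarrow> Z \<subseteq> H \<and>
     (\<forall>x\<in>Z. \<forall>y\<in>Z. x \<noteq> y \<longrightarrow> (\<forall>K. subcontinuum K H \<and> x \<in> K \<and> y \<in> K \<longrightarrow> K = H))"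

section \<open>Polyhedra, graphs, nerves\<close>

text \<open>
  The library's \<^const>\<open>simplicial_complex\<close> consists of simplices embedded in a fixed Euclidean
  space, whereas a nerve has no preferred embedding. So complexes are abstract here (sets of
  nonempty vertex sets), and the polyhedron of a complex is its realization in barycentric
  coordinates, a subspace of the product space \<open>'v \<Rightarrow> real\<close>.
\<close>

definition abstract_complex :: "'v set set \<Rightarrow> bool" where
  "abstract_complex K \<longleftrightarrow> finite K \<and>
     (\<forall>s\<in>K. finite s \<and> s \<noteq> {} \<and> (\<forall>t. t \<subseteq> s \<and> t \<noteq> {} \<longrightarrow> t \<in> K))"

definition polyhedron_of :: "'v set set \<Rightarrow> ('v \<Rightarrow> real) set" where
  "polyhedron_of K =
     {t. (\<forall>v. 0 \<le> t v) \<and> {v. t v \<noteq> 0} \<in> K \<and> (\<Sum>v | t v \<noteq> 0. t v) = 1}"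

text \<open>
  A one-dimensional complex has an edge and no simplex with more than two vertices. Vertices in
  \<^typ>\<open>nat\<close> suffice because the complex is finite.
\<close>

definition is_graph :: "'b::topological_space set \<Rightarrow> bool" where
  "is_graph G \<longleftrightarrow> connected G \<and>
     (\<exists>K :: nat set set. abstract_complex K \<and> (\<forall>s\<in>K. card s \<le> 2) \<and> (\<exists>s\<in>K. card s = 2) \<and>
        G homeomorphic polyhedron_of K)"

definition G_like :: "'b::metric_space set \<Rightarrow> 'a::metric_space set \<Rightarrow> bool" where
  "G_like G X \<longleftrightarrow>
     (\<forall>\<epsilon>>0. \<exists>g. continuous_on X g \<and> g ` X = G \<and> (\<forall>y\<in>G. diameter {x\<in>X. g x = y} < \<epsilon>))"

text \<open>
  Every element of \<open>\<G>\<close> is a vertex of the nerve; the singletons are listed separately so that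
  this includes the empty set, should it belong to \<open>\<G>\<close>.
\<close>

definition nerve :: "'a set set \<Rightarrow> 'a set set set" where
  "nerve \<G> = (\<lambda>U. {U}) ` \<G> \<union> {\<F>. \<F> \<subseteq> \<G> \<and> \<F> \<noteq> {} \<and> \<Inter>\<F> \<noteq> {}}"

lemma abstract_complex_nerve:
  assumes "finite \<G>"
  shows "abstract_complex (nerve \<G>)"
proof -
  have sub: "nerve \<G> \<subseteq> Pow \<G>"
    by (auto simp: nerve_def)
  have "finite (nerve \<G>)"
    by (rule finite_subset[OF sub]) (simp add: assms)
  moreover have "finite s" "s \<noteq> {}" if "s \<in> nerve \<G>" for s
    using that sub assms by (auto simp: nerve_def intro: finite_subset)
  moreover have "t \<in> nerve \<G>" if s: "s \<in> nerve \<G>" and t: "t \<subseteq> s" "t \<noteq> {}" for s t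
  proof (cases "\<Inter>s = {}")
    case True
    with s obtain U where U: "U \<in> \<G>" "s = {U}"
      by (auto simp: nerve_def)
    with t have "t = {U}"
      by (simp add: subset_singleton_iff)
    with U show ?thesis
      by (simp add: nerve_def)
  next
    case False
    have "\<Inter>s \<subseteq> \<Inter>t"
      using t(1) by (rule Inter_anti_mono)
    with False have "\<Inter>t \<noteq> {}"
      by (metis subset_empty)
    moreover have "t \<subseteq> \<G>"
      using s t(1) sub by (meson PowD subset_trans subsetD)
    ultimately show ?thesis
      using t(2) by (simp add: nerve_def)
  qed
  ultimately show ?thesis
    by (simp add: abstract_complex_def)
qed

section \<open>Open covers and chains\<close>

definition open_cover :: "'a::topological_space set \<Rightarrow> 'a set set \<Rightarrow> bool" where
  "open_cover X \<U> \<longleftrightarrow> (\<forall>U\<in>\<U>. openin (top_of_set X) U) \<and> \<Union>\<U> = X"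

definition mesh :: "'a::metric_space set set \<Rightarrow> real" where
  "mesh \<U> = Max (diameter ` \<U>)"

text \<open>
  Closures are taken in the ambient type; for subsets of a compact \<open>X\<close> they are the closures in
  \<open>X\<close>. The links of a chain \<open>{C\<^sub>1, \<dots>, C\<^sub>n}\<close> are pairwise distinct.
\<close>

definition chain_in :: "'a::topological_space set set \<Rightarrow> nat \<Rightarrow> (nat \<Rightarrow> 'a set) \<Rightarrow> bool" where
  "chain_in \<G> n C \<longleftrightarrow> C ` {1..n} \<subseteq> \<G> \<and> inj_on C {1..n} \<and>
     (\<forall>i. 1 \<le> i \<and> i < n \<longrightarrow> C i \<inter> C (i + 1) \<noteq> {}) \<and>
     (\<forall>i\<in>{1..n}. \<forall>j\<in>{1..n}. closure (C i) \<inter> closure (C j) \<noteq> {} \<longrightarrow> \<bar>int i - int j\<bar> \<le> 1)"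

definition free_chain_in :: "'a::topological_space set set \<Rightarrow> nat \<Rightarrow> (nat \<Rightarrow> 'a set) \<Rightarrow> bool" where
  "free_chain_in \<G> n C \<longleftrightarrow> chain_in \<G> n C \<and>
     (\<forall>i. 1 < i \<and> i < n \<longrightarrow>
        (\<forall>D\<in>\<G>. closure D \<inter> closure (C i) \<noteq> {} \<longrightarrow> D \<in> {C (i - 1), C i, C (i + 1)}))"

definition follows_from_pattern :: "nat \<Rightarrow> (nat \<Rightarrow> 'a set) \<Rightarrow> nat \<Rightarrow> (nat \<Rightarrow> 'a) \<Rightarrow> bool" where
  "follows_from_pattern n C k w \<longleftrightarrow>
     (\<exists>j. j ` {1..k} \<subseteq> {1..n} \<and> (strict_mono_on {1..k} j \<or> strict_antimono_on {1..k} j) \<and>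
        (\<forall>i\<in>{1..k}. w i \<in> C (j i)))"

definition freely_tracing_by_free_chains ::
    "'b::metric_space set \<Rightarrow> 'a::metric_space set \<Rightarrow> 'a set \<Rightarrow> bool" where
  "freely_tracing_by_free_chains G X Z \<longleftrightarrow>
     (\<forall>k\<ge>1. \<forall>w. w ` {1..k} \<subseteq> Z \<and> inj_on w {1..k} \<longrightarrow>
        (\<forall>\<epsilon>>0. \<exists>\<U>. finite \<U> \<and> open_cover X \<U> \<and> mesh \<U> < \<epsilon> \<and>
           polyhedron_of (nerve \<U>) homeomorphic G \<and>
           (\<exists>n C. free_chain_in \<U> n C \<and> follows_from_pattern n C k w)))"

section \<open>Topological entropy\<close>

text \<open>The definition by open covers of Adler, Konheim and McAndrew.\<close>

definition subcover_number :: "'a set \<Rightarrow> 'a set set \<Rightarrow> nat" where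
  "subcover_number X \<U> = (LEAST n. \<exists>\<V>\<subseteq>\<U>. finite \<V> \<and> card \<V> = n \<and> X \<subseteq> \<Union>\<V>)"

text \<open>The common refinement of the covers \<open>f\<^sup>-\<^sup>i(\<U>)\<close> for \<open>i < n\<close>.\<close>

definition iterated_join :: "'a set \<Rightarrow> ('a \<Rightarrow> 'a) \<Rightarrow> 'a set set \<Rightarrow> nat \<Rightarrow> 'a set set" where
  "iterated_join X f \<U> n =
     {{x\<in>X. \<forall>i<n. (f ^^ i) x \<in> U i} | U. \<forall>i<n. U i \<in> \<U>}"

text \<open>By subadditivity the upper limit is a limit.\<close>

definition cover_entropy :: "'a set \<Rightarrow> ('a \<Rightarrow> 'a) \<Rightarrow> 'a set set \<Rightarrow> ereal" where
  "cover_entropy X f \<U> =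
     limsup (\<lambda>n. ereal (ln (real (subcover_number X (iterated_join X f \<U> n))) / real n))"

definition topological_entropy :: "'a::topological_space set \<Rightarrow> ('a \<Rightarrow> 'a) \<Rightarrow> ereal" where
  "topological_entropy X f = (SUP \<U>\<in>{\<U>. open_cover X \<U>}. cover_entropy X f \<U>)"

section \<open>Independence and scrambled sets\<close>

definition positive_density :: "nat set \<Rightarrow> bool" where
  "positive_density I \<longleftrightarrow> liminf (\<lambda>n. ereal (real (card (I \<inter> {1..n})) / real n)) > 0"

definition has_positive_density_independence ::
    "'a set \<Rightarrow> ('a \<Rightarrow> 'a) \<Rightarrow> 'a set set \<Rightarrow> bool" where
  "has_positive_density_independence X f \<A> \<longleftrightarrow>
     (\<exists>I. I \<subseteq> {1..} \<and> positive_density I \<and>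
        (\<forall>J Y. finite J \<and> J \<subseteq> I \<and> (\<forall>j\<in>J. Y j \<in> \<A>) \<longrightarrow> (\<exists>x\<in>X. \<forall>j\<in>J. (f ^^ j) x \<in> Y j)))"

definition IE_tuple ::
    "'a::topological_space set \<Rightarrow> ('a \<Rightarrow> 'a) \<Rightarrow> nat \<Rightarrow> (nat \<Rightarrow> 'a) \<Rightarrow> bool" where
  "IE_tuple X f n x \<longleftrightarrow> x ` {1..n} \<subseteq> X \<and>
     (\<forall>A. (\<forall>i\<in>{1..n}. openin (top_of_set X) (A i) \<and> x i \<in> A i) \<longrightarrow>
        has_positive_density_independence X f (A ` {1..n}))"

definition delta_scrambled ::
    "real \<Rightarrow> 'a::metric_space set \<Rightarrow> ('a \<Rightarrow> 'a) \<Rightarrow> 'a set \<Rightarrow> bool" where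
  "delta_scrambled \<delta> X f S \<longleftrightarrow> S \<subseteq> X \<and> nondegenerate S \<and>
     (\<forall>x\<in>S. \<forall>y\<in>S. x \<noteq> y \<longrightarrow>
        liminf (\<lambda>n. ereal (dist ((f ^^ n) x) ((f ^^ n) y))) = 0 \<and>
        limsup (\<lambda>n. ereal (dist ((f ^^ n) x) ((f ^^ n) y))) \<ge> ereal \<delta>)"

end

theory Submission
  imports Defs
begin

text \<open>
  The proof is combinatorial. Call a finite family of sets \<^emph>\<open>densely independent\<close> if orbits can
  follow all words over the family along sets of times that contain a fixed proportion of
  \<open>{1..n}\<close>, for infinitely many \<open>n\<close>. Three operations preserve this property.

  \<^item> \<^emph>\<open>Splitting\<close> (\<open>densely_indep_cover\<close>): if every member of the family is covered by finitely many
    sets, each member can be replaced by its intersection with one of them. The reason is a weighted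
    Sauer--Shelah bound (\<open>sum_weights_le_shattered\<close>).

  \<^item> \<^emph>\<open>Blocks\<close> (\<open>densely_indep_block\<close>): for arbitrarily large finite sets \<open>F\<close> of times, the sets of
    points with prescribed itineraries on \<open>F\<close> form a densely independent family.

  \<^item> \<^emph>\<open>Iteration\<close> (\<open>densely_indep_transfer\<close>): the members can be replaced by their images under
    an iterate of \<open>f\<close>.

  The graph enters through a counting argument (\<open>exists_traced_subfamily\<close>). Let the family have
  \<open>N\<close> members. A map of \<open>X\<close> onto \<open>G\<close> with small fibres yields covers of arbitrarily small mesh
  whose nerve is a subdivision of \<open>G\<close>, and which consist of a bounded number of free chains, one for
  each simplex of a triangulation of \<open>G\<close>. Place the \<open>N^r\<close> itineraries of length \<open>r\<close> into
  elements of such a cover. One chain receives at least \<open>N^r / E\<close> of them, where \<open>E\<close> does not depend on \<open>r\<close>, and they are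
  ordered along this chain. If a given order of the \<open>N\<close> members did not occur at any of the \<open>r\<close>
  coordinates, the chain could be cut into at most \<open>r (N - 1) + 1\<close> intervals on which every
  coordinate misses a symbol, and it would contain at most \<open>(r (N - 1) + 1) (N - 1)^r\<close>
  itineraries (\<open>exists_ordered_pattern\<close>); for large \<open>r\<close> this is too few. So the given order occurs
  at a coordinate \<open>h\<close>, and the image of the cover under the \<open>h\<close>-th iterate of \<open>f\<close> has a free chain
  that runs through suitable subsets of the members in this order.

  This is repeated for all orders, and alternates with a doubling of the family: each member is
  replaced by two disjoint subsets, and for every map from the new indices to the old ones there is
  a late time at which each new set is inside the old set assigned to it
  (\<open>exists_branching_subfamily\<close>). So one obtains \<open>m\<close> binary trees of compact sets, the locale
  \<open>branching_scheme\<close>. The branches define the Cantor sets. Free tracing, the IE-tuples and the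
  simultaneous approximation of arbitrary points by orbits hold by construction.

  The vertical embedding is a consequence of free tracing. A continuum with two points \<open>x\<close>
  and \<open>y\<close> of \<open>Z\<close> must come close to every other point \<open>z\<close> of \<open>Z\<close>, as one sees from a free chain that passes \<open>z\<close>, \<open>x\<close>, a point
  of \<open>Z\<close> near \<open>z\<close>, and \<open>y\<close> in this order (\<open>subcontinuum_contains_freely_traced_set\<close>). Hence it
  contains \<open>Z\<close>, and a minimal continuum \<open>H\<close> around \<open>Z\<close> is as required.
\<close>

section \<open>Independence and shattering\<close>

text \<open>
  Independence is phrased for an indexed family rather than for a set of sets, so that the
  members can be shrunk one index at a time even when some of them coincide as sets.
\<close>

definition indep :: "'a set \<Rightarrow> ('a \<Rightarrow> 'a) \<Rightarrow> ('s \<Rightarrow> 'a set) \<Rightarrow> 's set \<Rightarrow> nat set \<Rightarrow> bool" where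
  "indep X f A S J \<longleftrightarrow>
     (\<forall>Y. (\<forall>j\<in>J. Y j \<in> S) \<longrightarrow> (\<exists>x\<in>X. \<forall>j\<in>J. (f ^^ j) x \<in> A (Y j)))"

text \<open>
  A finitary form of positive density: it speaks of finite sets of times only, and of
  infinitely many lengths \<open>n\<close> only, so that one of finitely many alternatives can be chosen for all
  lengths at once. By compactness it yields a single infinite set of times of positive lower
  density.
\<close>

definition densely_indep :: "'a set \<Rightarrow> ('a \<Rightarrow> 'a) \<Rightarrow> ('s \<Rightarrow> 'a set) \<Rightarrow> 's set \<Rightarrow> bool" where
  "densely_indep X f A S \<longleftrightarrow>
     (\<exists>d>0. \<exists>\<^sub>F n in sequentially. \<exists>J\<subseteq>{1..n}. d * real n \<le> real (card J) \<and> indep X f A S J)"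

text \<open>
  \<^term>\<open>None\<close> is the entry of a word at a time at which the word fails to show the prescribed
  symbol. Such an entry satisfies no demand.
\<close>

definition shattered :: "('j \<Rightarrow> 's option) set \<Rightarrow> 's set \<Rightarrow> 'j set \<Rightarrow> 'j set set" where
  "shattered T S J =
     {W. W \<subseteq> J \<and> (\<forall>Y. (\<forall>j\<in>W. Y j \<in> S) \<longrightarrow> (\<exists>t\<in>T. \<forall>j\<in>W. t j = Some (Y j)))}"

lemma shatteredI:
  assumes "W \<subseteq> J" "\<And>Y. (\<And>j. j \<in> W \<Longrightarrow> Y j \<in> S) \<Longrightarrow> \<exists>t\<in>T. \<forall>j\<in>W. t j = Some (Y j)"
  shows "W \<in> shattered T S J"
  using assms by (simp add: shattered_def)

lemma shatteredD:
  assumes "W \<in> shattered T S J" "\<And>j. j \<in> W \<Longrightarrow> Y j \<in> S"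
  shows "\<exists>t\<in>T. \<forall>j\<in>W. t j = Some (Y j)"
  using assms by (simp add: shattered_def)

lemma shattered_subset: "W \<in> shattered T S J \<Longrightarrow> W \<subseteq> J"
  by (simp add: shattered_def)

text \<open>
  A weighted form of the Sauer--Shelah bound of Karpovsky and Milman for words over \<open>N = card S\<close>
  symbols, where each unmatched entry costs a factor \<open>\<theta>\<close>. The induction removes one
  coordinate \<open>z\<close> and sorts the words by their entry there. A set shattered by one of the classes is
  shattered by all words, and a set shattered by the classes of all \<open>N\<close> genuine symbols stays
  shattered after \<open>z\<close> is adjoined to it. The weights match: if all \<open>N\<close> genuine classes shatter
  \<open>W\<close>, the classes count \<open>W\<close> with weight at most \<open>N + \<theta> = (N - 1 + \<theta>) + 1\<close>, which pays for
  \<open>W\<close> and \<open>insert z W\<close>; otherwise one genuine class does not count \<open>W\<close>, and \<open>N - 1 + \<theta>\<close>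
  suffices.
\<close>

lemma sum_weights_le_shattered:
  fixes T :: "('j \<Rightarrow> 's option) set" and \<theta> :: real
  assumes "finite J" and S: "finite S" "S \<noteq> {}" and \<theta>: "0 \<le> \<theta>"
  assumes "finite T" and "\<And>t j. t \<in> T \<Longrightarrow> j \<in> J \<Longrightarrow> t j \<in> insert None (Some ` S)"
    and "\<And>t t'. t \<in> T \<Longrightarrow> t' \<in> T \<Longrightarrow> (\<And>j. j \<in> J \<Longrightarrow> t j = t' j) \<Longrightarrow> t = t'"
  shows "(\<Sum>t\<in>T. \<theta> ^ card {j\<in>J. t j = None})
           \<le> (\<Sum>W\<in>shattered T S J. (real (card S) - 1 + \<theta>) ^ (card J - card W))"
  using assms(1,5-)
proof (induction J arbitrary: T rule: finite_induct)
  case empty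
  have "card T \<le> 1"
    using empty by (intro card_le_Suc0_iff_eq[THEN iffD2, simplified One_nat_def[symmetric]]) auto
  moreover have "shattered T S {} = (if T = {} then {} else {{}})"
    by (auto simp: shattered_def)
  ultimately show ?case by (auto simp: le_Suc_eq)
next
  case (insert z J)
  define q where "q = real (card S) - 1 + \<theta>"
  have "card S \<ge> 1" using S by (simp add: Suc_leI card_gt_0_iff)
  hence q0: "q \<ge> 0" using \<theta> unfolding q_def by linarith
  define O' where "O' = insert None (Some ` S)"
  define R where "R a = {t\<in>T. t z = a}" for a
  define D where "D a = shattered (R a) S J" for a
  define c where "c a = (if a = None then \<theta> else 1)" for a :: "'s option"
  define w where "w W = q ^ (card J - card W)" for W :: "'j set"
  define ind where "ind W a = (if W \<in> D a then 1 else 0 :: real)" for W a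
  have w0: "w W \<ge> 0" for W using q0 by (simp add: w_def)
  have finO: "finite O'" using S by (simp add: O'_def)
  have finJ: "finite (Pow J)" using insert.hyps by simp
  have Dsub: "D a \<subseteq> Pow J" for a by (auto simp: D_def shattered_def)
  have finD: "finite (D a)" for a using Dsub finJ by (rule finite_subset)
  have IH: "(\<Sum>t\<in>R a. \<theta> ^ card {j\<in>J. t j = None}) \<le> (\<Sum>W\<in>D a. w W)" if "a \<in> O'" for a
    unfolding D_def w_def q_def
  proof (rule insert.IH)
    show "finite (R a)" using insert.prems by (simp add: R_def)
    show "t j \<in> insert None (Some ` S)" if "t \<in> R a" "j \<in> J" for t j
      using insert.prems(2)[of t j] that by (simp add: R_def)
    show "t = t'" if "t \<in> R a" "t' \<in> R a" "\<And>j. j \<in> J \<Longrightarrow> t j = t' j" for t t'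
      by (rule insert.prems(3)) (use that in \<open>auto simp: R_def\<close>)
  qed
  have T: "T = (\<Union>a\<in>O'. R a)"
    using insert.prems(2)[of _ z] by (auto simp: R_def O'_def)
  have cnt: "\<theta> ^ card {j\<in>insert z J. t j = None} = c a * \<theta> ^ card {j\<in>J. t j = None}" if "t \<in> R a" for t a
  proof (cases "a = None")
    case True
    have "{j\<in>insert z J. t j = None} = insert z {j\<in>J. t j = None}"
      using that True by (auto simp: R_def)
    thus ?thesis using insert.hyps True by (simp add: c_def)
  next
    case False
    have "{j\<in>insert z J. t j = None} = {j\<in>J. t j = None}"
      using that False by (auto simp: R_def)
    thus ?thesis using False by (auto simp: c_def)
  qed
  have "(\<Sum>t\<in>T. \<theta> ^ card {j\<in>insert z J. t j = None})
      = (\<Sum>a\<in>O'. \<Sum>t\<in>R a. \<theta> ^ card {j\<in>insert z J. t j = None})"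
    unfolding T using finO insert.prems(1)
    by (intro sum.UNION_disjoint) (auto simp: R_def)
  also have "\<dots> = (\<Sum>a\<in>O'. c a * (\<Sum>t\<in>R a. \<theta> ^ card {j\<in>J. t j = None}))"
    using cnt by (simp add: sum_distrib_left)
  also have "\<dots> \<le> (\<Sum>a\<in>O'. c a * (\<Sum>W\<in>D a. w W))"
    using IH \<theta> by (intro sum_mono mult_left_mono) (auto simp: c_def)
  also have "\<dots> = (\<Sum>a\<in>O'. c a * (\<Sum>W\<in>Pow J. ind W a * w W))"
  proof -
    have "(\<Sum>W\<in>D a. w W) = (\<Sum>W\<in>Pow J. ind W a * w W)" for a
      using Dsub[of a] finJ by (intro sum.mono_neutral_cong_left) (auto simp: ind_def)
    thus ?thesis by simp
  qed
  also have "\<dots> = (\<Sum>W\<in>Pow J. (\<Sum>a\<in>O'. c a * ind W a) * w W)"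
    by (simp add: sum_distrib_left sum_distrib_right mult.assoc sum.swap[of _ O'])
  also have "\<dots> \<le> (\<Sum>W\<in>Pow J. (q * (if \<exists>a\<in>O'. W \<in> D a then 1 else 0)
                              + (if \<forall>s\<in>S. W \<in> D (Some s) then 1 else 0)) * w W)"
  proof (intro sum_mono mult_right_mono w0)
    fix W
    have eq: "(\<Sum>a\<in>O'. c a * ind W a) = \<theta> * ind W None + (\<Sum>s\<in>S. ind W (Some s))"
      unfolding O'_def using S by (subst sum.insert) (auto simp: c_def sum.reindex)
    have le: "\<theta> * ind W None \<le> \<theta>" using \<theta> by (simp add: ind_def)
    consider "\<not> (\<exists>a\<in>O'. W \<in> D a)" | "\<exists>a\<in>O'. W \<in> D a" "\<forall>s\<in>S. W \<in> D (Some s)"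
      | s where "\<exists>a\<in>O'. W \<in> D a" "s \<in> S" "W \<notin> D (Some s)" by blast
    thus "(\<Sum>a\<in>O'. c a * ind W a) \<le> q * (if \<exists>a\<in>O'. W \<in> D a then 1 else 0)
                              + (if \<forall>s\<in>S. W \<in> D (Some s) then 1 else 0)"
    proof cases
      case 1
      thus ?thesis by (auto simp: ind_def intro!: sum_nonpos)
    next
      case 2
      thus ?thesis unfolding eq using le by (simp add: ind_def q_def)
    next
      case 3
      have "(\<Sum>s\<in>S. ind W (Some s)) = (\<Sum>s\<in>S-{s}. ind W (Some s))"
        using 3 S by (subst sum.remove[of S s]) (auto simp: ind_def)
      also have "\<dots> \<le> (\<Sum>s\<in>S-{s}. 1)" by (intro sum_mono) (auto simp: ind_def)
      also have "\<dots> = real (card S) - 1"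
        using 3 S \<open>card S \<ge> 1\<close> by (simp add: of_nat_diff)
      finally show ?thesis unfolding eq using le 3 by (auto simp: q_def)
    qed
  qed
  also have "\<dots> = (\<Sum>W\<in>(\<Union>a\<in>O'. D a). q * w W) + (\<Sum>W\<in>(\<Inter>s\<in>S. D (Some s)). w W)"
  proof -
    have "(\<Sum>W\<in>(\<Union>a\<in>O'. D a). q * w W)
        = (\<Sum>W\<in>Pow J. q * (if \<exists>a\<in>O'. W \<in> D a then 1 else 0) * w W)"
      using Dsub finJ by (intro sum.mono_neutral_cong_left) auto
    moreover have "(\<Sum>W\<in>(\<Inter>s\<in>S. D (Some s)). w W)
        = (\<Sum>W\<in>Pow J. (if \<forall>s\<in>S. W \<in> D (Some s) then 1 else 0) * w W)"
    proof (rule sum.mono_neutral_cong_left[OF finJ])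
      show "(\<Inter>s\<in>S. D (Some s)) \<subseteq> Pow J" using Dsub S by fast
    qed auto
    ultimately show ?thesis by (simp only: distrib_right sum.distrib)
  qed
  also have "\<dots> = (\<Sum>W\<in>(\<Union>a\<in>O'. D a). q ^ (card (insert z J) - card W))
      + (\<Sum>W\<in>insert z ` (\<Inter>s\<in>S. D (Some s)). q ^ (card (insert z J) - card W))"
  proof -
    have "q * w W = q ^ (card (insert z J) - card W)" if "W \<in> (\<Union>a\<in>O'. D a)" for W
    proof -
      have "W \<subseteq> J" using that Dsub by auto
      hence "card W \<le> card J" using insert.hyps by (simp add: card_mono)
      thus ?thesis using insert.hyps by (simp add: w_def Suc_diff_le)
    qed
    moreover have "(\<Sum>W\<in>insert z ` (\<Inter>s\<in>S. D (Some s)). q ^ (card (insert z J) - card W))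
        = (\<Sum>W\<in>(\<Inter>s\<in>S. D (Some s)). w W)"
    proof (subst sum.reindex)
      have sub: "W \<subseteq> J" if "W \<in> (\<Inter>s\<in>S. D (Some s))" for W using that Dsub S by blast
      show "inj_on (insert z) (\<Inter>s\<in>S. D (Some s))"
      proof (rule inj_onI)
        fix V W assume "V \<in> (\<Inter>s\<in>S. D (Some s))" "W \<in> (\<Inter>s\<in>S. D (Some s))" "insert z V = insert z W"
        moreover from this have "z \<notin> V" "z \<notin> W" using sub[of V] sub[of W] insert.hyps(2) by blast+
        ultimately show "V = W" by (metis Diff_insert_absorb)
      qed
      have "card (insert z W) = Suc (card W)" if "W \<in> (\<Inter>s\<in>S. D (Some s))" for W
        using sub[OF that] insert.hyps finite_subset[of W J] by (subst card_insert_disjoint) auto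
      thus "sum ((\<lambda>W. q ^ (card (insert z J) - card W)) \<circ> insert z) (\<Inter>s\<in>S. D (Some s))
        = (\<Sum>W\<in>(\<Inter>s\<in>S. D (Some s)). w W)"
        using insert.hyps by (intro sum.cong) (auto simp: w_def)
    qed
    ultimately show ?thesis by simp
  qed
  also have "\<dots> = (\<Sum>W\<in>(\<Union>a\<in>O'. D a) \<union> insert z ` (\<Inter>s\<in>S. D (Some s)). q ^ (card (insert z J) - card W))"
  proof (rule sum.union_disjoint[symmetric])
    show "finite (\<Union>a\<in>O'. D a)" using finO finD by auto
    show "finite (insert z ` (\<Inter>s\<in>S. D (Some s)))" using finD S by (intro finite_imageI finite_INT) auto
    show "(\<Union>a\<in>O'. D a) \<inter> insert z ` (\<Inter>s\<in>S. D (Some s)) = {}"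
      using Dsub insert.hyps(2) by auto
  qed
  also have "\<dots> \<le> (\<Sum>W\<in>shattered T S (insert z J). q ^ (card (insert z J) - card W))"
  proof (rule sum_mono2)
    show "finite (shattered T S (insert z J))"
      by (rule finite_subset[of _ "Pow (insert z J)"]) (use insert.hyps in \<open>auto simp: shattered_def\<close>)
    have 1: "D a \<subseteq> shattered T S (insert z J)" for a
    proof
      fix W assume W: "W \<in> D a"
      show "W \<in> shattered T S (insert z J)"
      proof (rule shatteredI)
        show "W \<subseteq> insert z J" using W Dsub by blast
        fix Y assume Y: "\<And>j. j \<in> W \<Longrightarrow> Y j \<in> S"
        have "\<exists>t\<in>R a. \<forall>j\<in>W. t j = Some (Y j)"
          by (rule shatteredD[OF W[unfolded D_def]]) (rule Y)
        thus "\<exists>t\<in>T. \<forall>j\<in>W. t j = Some (Y j)" by (auto simp: R_def)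
      qed
    qed
    have 2: "insert z W \<in> shattered T S (insert z J)" if W: "W \<in> (\<Inter>s\<in>S. D (Some s))" for W
    proof (rule shatteredI)
      show "insert z W \<subseteq> insert z J" using W Dsub S by blast
      fix Y assume Y: "\<And>j. j \<in> insert z W \<Longrightarrow> Y j \<in> S"
      have "W \<in> shattered (R (Some (Y z))) S J" using W Y[of z] by (auto simp: D_def)
      from shatteredD[OF this, of Y] Y obtain t where "t \<in> R (Some (Y z))" "\<forall>j\<in>W. t j = Some (Y j)"
        by auto
      thus "\<exists>t\<in>T. \<forall>j\<in>insert z W. t j = Some (Y j)" by (auto simp: R_def)
    qed
    show "(\<Union>a\<in>O'. D a) \<union> insert z ` (\<Inter>s\<in>S. D (Some s)) \<subseteq> shattered T S (insert z J)"
    proof (rule Un_least)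
      show "(\<Union>a\<in>O'. D a) \<subseteq> shattered T S (insert z J)" by (rule UN_least) (rule 1)
      show "insert z ` (\<Inter>s\<in>S. D (Some s)) \<subseteq> shattered T S (insert z J)"
        by (rule image_subsetI) (rule 2)
    qed
    show "0 \<le> q ^ (card (insert z J) - card b)" for b :: "'j set" using q0 by simp
  qed
  finally show ?case unfolding q_def .
qed

section \<open>Splitting the members of an independent family\<close>

text \<open>
  With \<open>\<theta> = 1/4\<close> the right hand side of the weighted bound has base \<open>N - 3/4\<close>. If all
  shattered sets had at most \<open>k\<close> elements, then giving each element the additional weight \<open>1/8\<close>
  would cost at most \<open>8^k\<close> and turn the sum into the binomial expansion of \<open>(N - 5/8)^n\<close>. As
  \<open>N - 1/2 > N - 5/8\<close>, this forces \<open>k\<close> to be a fixed proportion of \<open>n\<close>.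
\<close>

lemma exists_large_shattered:
  fixes T :: "('j \<Rightarrow> 's option) set"
  assumes "finite J" and S: "finite S" "S \<noteq> {}" and "finite T"
    and "\<And>t j. t \<in> T \<Longrightarrow> j \<in> J \<Longrightarrow> t j \<in> insert None (Some ` S)"
    and "\<And>t t'. t \<in> T \<Longrightarrow> t' \<in> T \<Longrightarrow> (\<And>j. j \<in> J \<Longrightarrow> t j = t' j) \<Longrightarrow> t = t'"
    and big: "(real (card S) - 1/2) ^ card J \<le> (\<Sum>t\<in>T. (1/4) ^ card {j\<in>J. t j = None})"
  shows "\<exists>W\<in>shattered T S J.
    ln ((real (card S) - 1/2) / (real (card S) - 5/8)) / ln 8 * real (card J) \<le> real (card W)"
proof -
  define N where "N = real (card S)"
  have N: "N \<ge> 1" using S by (simp add: N_def Suc_leI card_gt_0_iff)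
  define q where "q = N - 3/4"
  have q: "q > 0" using N by (simp add: q_def)
  define n where "n = card J"
  have finSh: "finite (shattered T S J)"
    by (rule finite_subset[of _ "Pow J"]) (use assms(1) in \<open>auto simp: shattered_def\<close>)
  have le: "(N - 1/2) ^ n \<le> (\<Sum>W\<in>shattered T S J. q ^ (n - card W))"
  proof -
    have "(N - 1/2) ^ n \<le> (\<Sum>t\<in>T. (1/4) ^ card {j\<in>J. t j = None})"
      using big by (simp add: N_def n_def)
    also have "\<dots> \<le> (\<Sum>W\<in>shattered T S J. (real (card S) - 1 + 1/4) ^ (card J - card W))"
      using assms by (intro sum_weights_le_shattered) auto
    finally show ?thesis by (simp add: q_def N_def n_def)
  qed
  have "shattered T S J \<noteq> {}"
  proof
    assume "shattered T S J = {}"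
    with le have "(N - 1/2) ^ n \<le> 0" by simp
    moreover have "(N - 1/2) ^ n > 0" using N by simp
    ultimately show False by linarith
  qed
  define k where "k = Max (card ` shattered T S J)"
  have k: "card W \<le> k" if "W \<in> shattered T S J" for W
    unfolding k_def using that finSh by (intro Max_ge) auto
  have "k \<in> card ` shattered T S J"
    unfolding k_def using finSh \<open>shattered T S J \<noteq> {}\<close> by (intro Max_in) auto
  then obtain W0 where W0: "W0 \<in> shattered T S J" "card W0 = k" by auto
  have "(N - 1/2) ^ n \<le> (\<Sum>W\<in>shattered T S J. 8 ^ k * (q ^ (n - card W) * (1/8) ^ card W))"
  proof (rule order.trans[OF le], rule sum_mono)
    fix W assume "W \<in> shattered T S J"
    hence "(8::real) ^ card W \<le> 8 ^ k" using k by (intro power_increasing) auto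
    hence "1 \<le> 8 ^ k * (1/8 :: real) ^ card W" by (simp add: power_one_over field_simps)
    hence "q ^ (n - card W) * 1 \<le> q ^ (n - card W) * (8 ^ k * (1/8 :: real) ^ card W)"
      using q by (intro mult_left_mono) auto
    thus "q ^ (n - card W) \<le> 8 ^ k * (q ^ (n - card W) * (1/8) ^ card W)"
      by (simp add: mult_ac)
  qed
  also have "\<dots> \<le> (\<Sum>W\<in>Pow J. 8 ^ k * (q ^ (n - card W) * (1/8) ^ card W))"
    using assms(1) q by (intro sum_mono2) (auto simp: shattered_def)
  also have "\<dots> = 8 ^ k * (\<Sum>W\<in>Pow J. (\<Prod>j\<in>W. 1/8) * (\<Prod>j\<in>J-W. q))"
    unfolding sum_distrib_left using assms(1)
    by (intro sum.cong) (auto simp: n_def card_Diff_subset finite_subset)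
  also have "\<dots> = 8 ^ k * (N - 5/8) ^ n"
    using assms(1) by (subst prod_add[symmetric]) (simp_all add: q_def n_def)
  finally have ineq: "(N - 1/2) ^ n \<le> 8 ^ k * (N - 5/8) ^ n" .
  have "ln ((N - 1/2) ^ n) \<le> ln (8 ^ k * (N - 5/8) ^ n)"
    using ineq N by (subst ln_le_cancel_iff) auto
  hence "real n * ln (N - 1/2) \<le> real k * ln 8 + real n * ln (N - 5/8)"
    using N by (simp add: ln_mult ln_realpow)
  hence "real n * (ln (N - 1/2) - ln (N - 5/8)) \<le> real k * ln 8"
    by (simp add: algebra_simps)
  hence "real n * ln ((N - 1/2) / (N - 5/8)) \<le> real k * ln 8"
    using N by (simp add: ln_div)
  hence "ln ((N - 1/2) / (N - 5/8)) / ln 8 * real n \<le> real k"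
    by (simp add: field_simps)
  thus ?thesis using W0 by (auto simp: N_def n_def)
qed

lemma indep_subset:
  assumes "indep X f A S J" "J' \<subseteq> J" "S \<noteq> {}"
  shows "indep X f A S J'"
  unfolding indep_def
proof (intro allI impI)
  fix Y assume Y: "\<forall>j\<in>J'. Y j \<in> S"
  obtain s where "s \<in> S" using assms(3) by blast
  hence "\<forall>j\<in>J. (if j \<in> J' then Y j else s) \<in> S" using Y by simp
  then obtain x where x: "x \<in> X" "\<forall>j\<in>J. (f ^^ j) x \<in> A (if j \<in> J' then Y j else s)"
    using assms(1) unfolding indep_def by (elim allE[of _ "\<lambda>j. if j \<in> J' then Y j else s"]) auto
  have "\<forall>j\<in>J'. (f ^^ j) x \<in> A (Y j)"
  proof
    fix j assume "j \<in> J'"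
    with x(2) assms(2) have "(f ^^ j) x \<in> A (if j \<in> J' then Y j else s)" by blast
    with \<open>j \<in> J'\<close> show "(f ^^ j) x \<in> A (Y j)" by simp
  qed
  thus "\<exists>x\<in>X. \<forall>j\<in>J'. (f ^^ j) x \<in> A (Y j)" using x(1) by blast
qed

text \<open>
  For each word over \<open>S\<close> choose a point that follows it. At each occurrence of \<open>s0\<close> the orbit
  of this point is in \<open>U\<close> or in \<open>V\<close>. If a word has \<open>a\<close> occurrences outside \<open>U\<close> and \<open>b\<close>
  outside \<open>V\<close>, then \<open>a + b\<close> is at most its number of occurrences of \<open>s0\<close>, and
  \<open>(1/4)^a + (1/4)^b \<ge> 2 (1/2)^(a + b)\<close>. Summing over all words gives at least
  \<open>2 (N - 1/2)^n\<close>, so one of the two sides reaches the bound that produces a large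
  shattered set.
\<close>

lemma indep_split:
  assumes ind: "indep X f A S J" and J: "finite J" and S: "finite S" "s0 \<in> S"
    and UV: "A s0 \<subseteq> U \<union> V"
  defines "N \<equiv> real (card S)"
  shows "\<exists>W\<subseteq>J. ln ((N - 1/2) / (N - 5/8)) / ln 8 * real (card J) \<le> real (card W) \<and>
    (indep X f (A(s0 := A s0 \<inter> U)) S W \<or> indep X f (A(s0 := A s0 \<inter> V)) S W)"
proof -
  define \<Omega> where "\<Omega> = Pi\<^sub>E J (\<lambda>_. S)"
  have fin\<Omega>: "finite \<Omega>" using J S by (simp add: \<Omega>_def finite_PiE)
  have "\<exists>x\<in>X. \<forall>j\<in>J. (f ^^ j) x \<in> A (\<omega> j)" if "\<omega> \<in> \<Omega>" for \<omega>
    using ind that unfolding indep_def \<Omega>_def by blast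
  then obtain x where x: "\<And>\<omega>. \<omega> \<in> \<Omega> \<Longrightarrow> x \<omega> \<in> X"
      "\<And>\<omega> j. \<omega> \<in> \<Omega> \<Longrightarrow> j \<in> J \<Longrightarrow> (f ^^ j) (x \<omega>) \<in> A (\<omega> j)" by metis
  have key: ?thesis
    if Q: "Q = U \<or> Q = V" and \<tau>: "\<And>\<omega>. \<tau> \<omega> = (\<lambda>j. if \<omega> j = s0 \<and> (f ^^ j) (x \<omega>) \<notin> Q then None else Some (\<omega> j))"
      and big: "(N - 1/2) ^ card J \<le> (\<Sum>\<omega>\<in>\<Omega>. (1/4) ^ card {j\<in>J. \<tau> \<omega> j = None})" for Q \<tau>
  proof -
    have rec: "\<omega> j = (case \<tau> \<omega> j of None \<Rightarrow> s0 | Some s \<Rightarrow> s)" for \<omega> j by (simp add: \<tau>)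
    have ext: "\<omega> = \<omega>'" if "\<omega> \<in> \<Omega>" "\<omega>' \<in> \<Omega>" "\<And>j. j \<in> J \<Longrightarrow> \<tau> \<omega> j = \<tau> \<omega>' j" for \<omega> \<omega>'
    proof (rule PiE_ext[OF that(1,2)[unfolded \<Omega>_def]])
      fix j assume "j \<in> J"
      thus "\<omega> j = \<omega>' j" by (simp only: rec[of \<omega> j] rec[of \<omega>' j] that(3))
    qed
    have inj: "inj_on \<tau> \<Omega>" by (rule inj_onI) (use ext in auto)
    have "\<exists>W\<in>shattered (\<tau> ` \<Omega>) S J.
      ln ((real (card S) - 1/2) / (real (card S) - 5/8)) / ln 8 * real (card J) \<le> real (card W)"
    proof (rule exists_large_shattered[OF J S(1)])
      show "S \<noteq> {}" using S by blast
      show "finite (\<tau> ` \<Omega>)" using fin\<Omega> by simp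
      show "t j \<in> insert None (Some ` S)" if "t \<in> \<tau> ` \<Omega>" "j \<in> J" for t j
      proof -
        from that(1) obtain \<omega> where "t = \<tau> \<omega>" "\<omega> \<in> \<Omega>" by auto
        moreover have "\<omega> j \<in> S" using \<open>\<omega> \<in> \<Omega>\<close> that(2) by (auto simp: \<Omega>_def)
        ultimately show ?thesis by (simp add: \<tau>)
      qed
      show "t = t'" if "t \<in> \<tau> ` \<Omega>" "t' \<in> \<tau> ` \<Omega>" "\<And>j. j \<in> J \<Longrightarrow> t j = t' j" for t t'
      proof -
        from that(1,2) obtain \<omega> \<omega>' where "t = \<tau> \<omega>" "t' = \<tau> \<omega>'" "\<omega> \<in> \<Omega>" "\<omega>' \<in> \<Omega>" by auto
        with ext[of \<omega> \<omega>'] that(3) show ?thesis by simp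
      qed
      show "(real (card S) - 1/2) ^ card J \<le> (\<Sum>t\<in>\<tau> ` \<Omega>. (1/4) ^ card {j\<in>J. t j = None})"
        using big by (simp add: sum.reindex[OF inj] N_def)
    qed
    then obtain W where W: "W \<in> shattered (\<tau> ` \<Omega>) S J"
      "ln ((N - 1/2) / (N - 5/8)) / ln 8 * real (card J) \<le> real (card W)"
      unfolding N_def by blast
    have WJ: "W \<subseteq> J" using W(1) by (rule shattered_subset)
    have "indep X f (A(s0 := A s0 \<inter> Q)) S W"
      unfolding indep_def
    proof (intro allI impI)
      fix Y assume "\<forall>j\<in>W. Y j \<in> S"
      hence "\<exists>t\<in>\<tau> ` \<Omega>. \<forall>j\<in>W. t j = Some (Y j)" by (intro shatteredD[OF W(1)]) auto
      then obtain \<omega> where \<omega>: "\<omega> \<in> \<Omega>" "\<And>j. j \<in> W \<Longrightarrow> \<tau> \<omega> j = Some (Y j)" by auto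
      have "(f ^^ j) (x \<omega>) \<in> (A(s0 := A s0 \<inter> Q)) (Y j)" if j: "j \<in> W" for j
        using \<omega>(2)[OF j] x(2)[OF \<omega>(1), of j] j WJ by (auto simp: \<tau> split: if_splits)
      thus "\<exists>x\<in>X. \<forall>j\<in>W. (f ^^ j) x \<in> (A(s0 := A s0 \<inter> Q)) (Y j)" using x(1)[OF \<omega>(1)] by blast
    qed
    with Q W(2) WJ show ?thesis by blast
  qed
  define \<tau> where "\<tau> Q \<omega> = (\<lambda>j. if \<omega> j = s0 \<and> (f ^^ j) (x \<omega>) \<notin> Q then None else Some (\<omega> j))" for Q \<omega>
  define u where "u Q = (\<Sum>\<omega>\<in>\<Omega>. (1/4 :: real) ^ card {j\<in>J. \<tau> Q \<omega> j = None})" for Q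
  have "2 * (N - 1/2) ^ card J = 2 * (\<Sum>\<omega>\<in>\<Omega>. (1/2) ^ card {j\<in>J. \<omega> j = s0})"
  proof -
    have "N - 1/2 = (\<Sum>s\<in>S. if s = s0 then 1/2 else 1)"
    proof -
      have "1 \<le> card S" using S by (auto simp: Suc_le_eq card_gt_0_iff)
      thus ?thesis using S by (subst sum.remove[of S s0]) (auto simp: N_def of_nat_diff)
    qed
    hence "(N - 1/2) ^ card J = (\<Prod>j\<in>J. \<Sum>s\<in>S. if s = s0 then 1/2 else 1)" by simp
    also have "\<dots> = (\<Sum>\<omega>\<in>\<Omega>. \<Prod>j\<in>J. if \<omega> j = s0 then 1/2 else 1)"
      unfolding \<Omega>_def using J S by (intro prod_sum_PiE) auto
    also have "\<dots> = (\<Sum>\<omega>\<in>\<Omega>. (1/2) ^ card {j\<in>J. \<omega> j = s0})"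
      using J by (intro sum.cong) (auto simp: prod.If_cases Int_def)
    finally show ?thesis by simp
  qed
  also have "\<dots> \<le> u U + u V"
    unfolding u_def sum.distrib[symmetric] sum_distrib_left
  proof (rule sum_mono)
    fix \<omega> assume \<omega>: "\<omega> \<in> \<Omega>"
    define a where "a = card {j\<in>J. \<tau> U \<omega> j = None}"
    define b where "b = card {j\<in>J. \<tau> V \<omega> j = None}"
    have "a + b = card ({j\<in>J. \<tau> U \<omega> j = None} \<union> {j\<in>J. \<tau> V \<omega> j = None})"
      unfolding a_def b_def using J x(2)[OF \<omega>] UV
      by (intro card_Un_disjoint[symmetric]) (auto simp: \<tau>_def split: if_splits)
    also have "\<dots> \<le> card {j\<in>J. \<omega> j = s0}"
      using J by (intro card_mono) (auto simp: \<tau>_def split: if_splits)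
    finally have "(1/2 :: real) ^ card {j\<in>J. \<omega> j = s0} \<le> (1/2) ^ (a + b)"
      by (intro power_decreasing) auto
    moreover have "2 * ((1/2::real) ^ a * (1/2) ^ b) \<le> ((1/2) ^ a)\<^sup>2 + ((1/2) ^ b)\<^sup>2"
      using sum_squares_bound[of "(1/2::real) ^ a" "(1/2) ^ b"] by simp
    moreover have "((1/2::real) ^ c)\<^sup>2 = (1/4) ^ c" for c
      by (simp add: power2_eq_square flip: power_mult_distrib)
    ultimately show "2 * (1/2) ^ card {j\<in>J. \<omega> j = s0}
       \<le> (1/4 :: real) ^ card {j\<in>J. \<tau> U \<omega> j = None} + (1/4) ^ card {j\<in>J. \<tau> V \<omega> j = None}"
      unfolding a_def[symmetric] b_def[symmetric] by (simp add: power_add)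
  qed
  \<comment> \<open>One of the two pieces carries at least half of the total weight.\<close>
  finally have "(N - 1/2) ^ card J \<le> u U \<or> (N - 1/2) ^ card J \<le> u V" by linarith
  thus ?thesis
  proof
    assume "(N - 1/2) ^ card J \<le> u U"
    thus ?thesis by (intro key[of U "\<tau> U"]) (auto simp: \<tau>_def u_def)
  next
    assume "(N - 1/2) ^ card J \<le> u V"
    thus ?thesis by (intro key[of V "\<tau> V"]) (auto simp: \<tau>_def u_def)
  qed
qed

text \<open>
  The finite splitting bound loses only a constant factor of the times, and one of the two
  alternatives occurs for infinitely many lengths.
\<close>

lemma densely_indep_split:
  assumes "densely_indep X f A S" "finite S" "s0 \<in> S" "A s0 \<subseteq> U \<union> V"
  shows "densely_indep X f (A(s0 := A s0 \<inter> U)) S \<or> densely_indep X f (A(s0 := A s0 \<inter> V)) S"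
proof -
  define c where "c = ln ((real (card S) - 1/2) / (real (card S) - 5/8)) / ln 8"
  have N: "real (card S) \<ge> 1" using assms(2,3) by (auto simp: Suc_le_eq card_gt_0_iff)
  have c: "c > 0" unfolding c_def using N by (intro divide_pos_pos ln_gt_zero) auto
  obtain d where d: "d > 0" and fr: "\<exists>\<^sub>F n in sequentially. \<exists>J\<subseteq>{1..n}. d * real n \<le> real (card J) \<and> indep X f A S J"
    using assms(1) unfolding densely_indep_def by blast
  define P where "P Q n \<longleftrightarrow> (\<exists>J\<subseteq>{1..n}. (c * d) * real n \<le> real (card J) \<and> indep X f (A(s0 := A s0 \<inter> Q)) S J)"
    for Q n
  have "\<exists>\<^sub>F n in sequentially. P U n \<or> P V n"
    using fr
  proof (rule frequently_mono[rotated], intro allI impI)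
    fix n assume "\<exists>J\<subseteq>{1..n}. d * real n \<le> real (card J) \<and> indep X f A S J"
    then obtain J where J: "J \<subseteq> {1..n}" "d * real n \<le> real (card J)" "indep X f A S J" by blast
    from indep_split[OF J(3) finite_subset[OF J(1)] assms(2,3,4)]
    obtain W where W: "W \<subseteq> J" "c * real (card J) \<le> real (card W)"
      "indep X f (A(s0 := A s0 \<inter> U)) S W \<or> indep X f (A(s0 := A s0 \<inter> V)) S W"
      unfolding c_def by auto
    have "c * d * real n \<le> c * real (card J)" using J(2) c by (simp add: mult.assoc)
    with W J(1) show "P U n \<or> P V n" unfolding P_def by (meson order.trans)
  qed
  hence "(\<exists>\<^sub>F n in sequentially. P U n) \<or> (\<exists>\<^sub>F n in sequentially. P V n)"
    by (simp add: frequently_disj_iff)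
  moreover have "c * d > 0" using c d by simp
  ultimately show ?thesis unfolding densely_indep_def P_def by blast
qed

text \<open>
  The same times work for the image family: if \<open>x\<close> follows a word along \<open>A\<close>, then
  \<open>(f ^^ h) x\<close> follows the corresponding word along \<open>A'\<close>, since iterates commute.
\<close>

lemma densely_indep_transfer:
  assumes "densely_indep X f A S" "f ` X \<subseteq> X"
    and "\<And>s. s \<in> S' \<Longrightarrow> \<exists>r\<in>S. (f ^^ h) ` (X \<inter> A r) \<subseteq> A' s"
  shows "densely_indep X f A' S'"
proof -
  have X: "(f ^^ j) x \<in> X" if "x \<in> X" for x j
    using that assms(2) by (induction j) auto
  from assms(3) obtain \<rho> where \<rho>: "\<And>s. s \<in> S' \<Longrightarrow> \<rho> s \<in> S"
    "\<And>s. s \<in> S' \<Longrightarrow> (f ^^ h) ` (X \<inter> A (\<rho> s)) \<subseteq> A' s" by metis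
  have ind: "indep X f A' S' J" if J: "indep X f A S J" for J
    unfolding indep_def
  proof (intro allI impI)
    fix Y assume Y: "\<forall>j\<in>J. Y j \<in> S'"
    hence "\<forall>j\<in>J. \<rho> (Y j) \<in> S" using \<rho> by blast
    with J obtain x where x: "x \<in> X" "\<forall>j\<in>J. (f ^^ j) x \<in> A (\<rho> (Y j))"
      unfolding indep_def by (elim allE[of _ "\<lambda>j. \<rho> (Y j)"]) auto
    have "\<forall>j\<in>J. (f ^^ j) ((f ^^ h) x) \<in> A' (Y j)"
    proof
      fix j assume j: "j \<in> J"
      have "(f ^^ h) ((f ^^ j) x) \<in> A' (Y j)" using x j X[OF x(1), of j] \<rho>(2)[of "Y j"] Y by auto
      thus "(f ^^ j) ((f ^^ h) x) \<in> A' (Y j)"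
        by (metis add.commute comp_apply funpow_add)
    qed
    thus "\<exists>x\<in>X. \<forall>j\<in>J. (f ^^ j) x \<in> A' (Y j)" using X[OF x(1)] by blast
  qed
  from assms(1) obtain d where "d > 0"
    "\<exists>\<^sub>F n in sequentially. \<exists>J\<subseteq>{1..n}. d * real n \<le> real (card J) \<and> indep X f A S J"
    unfolding densely_indep_def by blast
  moreover from this(2) have "\<exists>\<^sub>F n in sequentially. \<exists>J\<subseteq>{1..n}. d * real n \<le> real (card J) \<and> indep X f A' S' J"
    by (rule frequently_mono[rotated]) (use ind in blast)
  ultimately show ?thesis unfolding densely_indep_def by blast
qed

lemma densely_indep_mono:
  assumes "densely_indep X f A S" "f ` X \<subseteq> X" "\<And>s. s \<in> S \<Longrightarrow> X \<inter> A s \<subseteq> A' s"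
  shows "densely_indep X f A' S"
  using assms(1,2) by (rule densely_indep_transfer[of _ _ _ _ _ 0]) (use assms(3) in auto)

lemma densely_indep_cover1:
  assumes "finite Q" "densely_indep X f A S" "finite S" "s0 \<in> S" "A s0 \<subseteq> (\<Union>q\<in>Q. W q)" "f ` X \<subseteq> X"
  shows "\<exists>q\<in>Q. densely_indep X f (A(s0 := A s0 \<inter> W q)) S"
  using assms(1,2,5)
proof (induction Q arbitrary: A rule: finite_induct)
  case empty
  then obtain n J where J: "J \<subseteq> {1..n}" "card J > 0" "indep X f A S J"
  proof -
    from empty(1) obtain d where d: "d > 0"
      "\<exists>\<^sub>F n in sequentially. \<exists>J\<subseteq>{1..n}. d * real n \<le> real (card J) \<and> indep X f A S J"
      unfolding densely_indep_def by blast
    from frequently_eventually_conj[OF d(2) eventually_gt_at_top[of 0]]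
    obtain n J where n: "n > 0" "J \<subseteq> {1..n}" "d * real n \<le> real (card J)" "indep X f A S J"
      by (auto dest!: frequently_ex)
    have "0 < d * real n" using d n by simp
    hence "card J > 0" using n(3) by (metis dual_order.strict_trans1 of_nat_0_less_iff)
    with that n show ?thesis by blast
  qed
  then obtain j where j: "j \<in> J" by fastforce
  from J(3) have "\<exists>x\<in>X. \<forall>j\<in>J. (f ^^ j) x \<in> A s0"
    unfolding indep_def using assms(4) by (elim allE[of _ "\<lambda>_. s0"]) auto
  with j empty(2) show ?case by auto
next
  case (insert q Q)
  have "A s0 \<subseteq> W q \<union> (\<Union>q\<in>Q. W q)" using insert.prems by auto
  from densely_indep_split[OF insert.prems(1) assms(3,4) this]
  show ?case
  proof
    assume "densely_indep X f (A(s0 := A s0 \<inter> W q)) S"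
    thus ?thesis by blast
  next
    assume "densely_indep X f (A(s0 := A s0 \<inter> (\<Union>q\<in>Q. W q))) S"
    from insert.IH[OF this] obtain p where p: "p \<in> Q"
      "densely_indep X f ((A(s0 := A s0 \<inter> (\<Union>q\<in>Q. W q)))(s0 := (A(s0 := A s0 \<inter> (\<Union>q\<in>Q. W q))) s0 \<inter> W p)) S"
      by fastforce
    have "densely_indep X f (A(s0 := A s0 \<inter> W p)) S"
      by (rule densely_indep_mono[OF p(2) assms(6)]) auto
    with p show ?thesis by blast
  qed
qed

text \<open>
  The form in which splitting is used: every member of the family can be cut down to one piece of
  a finite cover, simultaneously for all indices.
\<close>

lemma densely_indep_cover:
  assumes "densely_indep X f A S" "finite S" "finite Q" "\<And>s. s \<in> S \<Longrightarrow> A s \<subseteq> (\<Union>q\<in>Q. W q)" "f ` X \<subseteq> X"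
  shows "\<exists>p. (\<forall>s\<in>S. p s \<in> Q) \<and> densely_indep X f (\<lambda>s. A s \<inter> W (p s)) S"
proof -
  have "\<exists>p. (\<forall>s\<in>R. p s \<in> Q) \<and> densely_indep X f (\<lambda>s. if s \<in> R then A s \<inter> W (p s) else A s) S"
    if "finite R" "R \<subseteq> S" for R
    using that
  proof (induction R rule: finite_induct)
    case empty
    thus ?case using assms(1) by simp
  next
    case (insert r R)
    then obtain p where p: "\<forall>s\<in>R. p s \<in> Q"
      "densely_indep X f (\<lambda>s. if s \<in> R then A s \<inter> W (p s) else A s) S" by auto
    have r: "r \<in> S" using insert by simp
    have "(if r \<in> R then A r \<inter> W (p r) else A r) \<subseteq> (\<Union>q\<in>Q. W q)"
      using assms(4)[OF r] by auto
    from densely_indep_cover1[OF assms(3) p(2) assms(2) r this assms(5)]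
    obtain q where q: "q \<in> Q"
      "densely_indep X f ((\<lambda>s. if s \<in> R then A s \<inter> W (p s) else A s)
         (r := (if r \<in> R then A r \<inter> W (p r) else A r) \<inter> W q)) S" by blast
    have "densely_indep X f (\<lambda>s. if s \<in> insert r R then A s \<inter> W ((p(r := q)) s) else A s) S"
      by (rule densely_indep_mono[OF q(2) assms(5)]) (use insert.hyps in auto)
    moreover have "\<forall>s\<in>insert r R. (p(r := q)) s \<in> Q" using p(1) q(1) by simp
    ultimately show ?case by blast
  qed
  from this[OF assms(2)] obtain p where p: "\<forall>s\<in>S. p s \<in> Q"
    "densely_indep X f (\<lambda>s. if s \<in> S then A s \<inter> W (p s) else A s) S" by blast
  have "densely_indep X f (\<lambda>s. A s \<inter> W (p s)) S"
    by (rule densely_indep_mono[OF p(2) assms(5)]) auto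
  with p(1) show ?thesis by blast
qed

section \<open>Independent itineraries on blocks\<close>

lemma funpow_closed:
  assumes "f ` X \<subseteq> X" "x \<in> X"
  shows "(f ^^ j) x \<in> X"
  using assms by (induction j) auto

text \<open>
  Cut \<open>{1..n}\<close> into consecutive blocks of length \<open>M\<close>. Blocks with fewer than \<open>L\<close> elements of
  \<open>J\<close> contain at most \<open>3/4 * d * n\<close> elements of \<open>J\<close> together, so a positive proportion of the
  blocks has at least \<open>L\<close>; there are at most \<open>2^M\<close> shapes, and one of them is therefore frequent.
\<close>

lemma pigeonhole_frequent_block:
  fixes J :: "nat set"
  assumes J: "J \<subseteq> {1..n}" "d * real n \<le> real (card J)" and d: "d > 0"
    and M: "M > 0" "2 * real L \<le> d * real M" and n: "n > 0" "4 * real L \<le> d * real n"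
  shows "\<exists>F\<subseteq>{..<M}. L \<le> card F \<and>
    d / (4 * real M * 2 ^ M) * real n \<le> real (card {k. {i. i < M \<and> k * M + 1 + i \<in> J} = F \<and> k < n div M + 1})"
proof -
  define B where "B k = {i. i < M \<and> k * M + 1 + i \<in> J}" for k
  define b where "b = n div M + 1"
  define K where "K = {k. k < b \<and> L \<le> card (B k)}"
  define \<F> where "\<F> = {F. F \<subseteq> {..<M} \<and> L \<le> card F}"
  have finB: "finite (B k)" for k by (simp add: B_def)
  have BM: "card (B k) \<le> M" for k
    using card_mono[of "{..<M}" "B k"] by (auto simp: B_def)
  have finK: "finite K" by (simp add: K_def)
  have "J \<subseteq> (\<Union>k<b. (\<lambda>i. k * M + 1 + i) ` B k)"
  proof
    fix j assume j: "j \<in> J"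
    hence j1: "1 \<le> j" "j \<le> n" using J by auto
    have "(j - 1) div M \<le> n div M" using j1 by (intro div_le_mono) auto
    hence "(j - 1) div M < b" by (simp add: b_def)
    moreover have eq: "j = (j - 1) div M * M + 1 + (j - 1) mod M"
      using j1 div_mult_mod_eq[of "j - 1" M] by linarith
    moreover have "(j - 1) mod M \<in> B ((j - 1) div M)"
      using j M eq by (simp add: B_def)
    ultimately show "j \<in> (\<Union>k<b. (\<lambda>i. k * M + 1 + i) ` B k)" by blast
  qed
  hence "card J \<le> card (\<Union>k<b. (\<lambda>i. k * M + 1 + i) ` B k)"
    using finB by (intro card_mono) auto
  also have "\<dots> \<le> (\<Sum>k<b. card ((\<lambda>i. k * M + 1 + i) ` B k))" by (rule card_UN_le) simp
  also have "\<dots> \<le> (\<Sum>k<b. L + (if k \<in> K then M else 0))"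
  proof (rule sum_mono)
    fix k assume "k \<in> {..<b}"
    have "card ((\<lambda>i. k * M + 1 + i) ` B k) \<le> card (B k)" using finB by (rule card_image_le)
    with BM[of k] \<open>k \<in> {..<b}\<close> show "card ((\<lambda>i. k * M + 1 + i) ` B k) \<le> L + (if k \<in> K then M else 0)"
      by (auto simp: K_def)
  qed
  also have "\<dots> = b * L + card K * M"
  proof -
    have "{..<b} \<inter> K = K" by (auto simp: K_def)
    thus ?thesis by (simp add: sum.distrib sum.If_cases)
  qed
  finally have "card J \<le> b * L + card K * M" .
  hence 1: "real (card J) \<le> real b * real L + real (card K) * real M"
    by (metis of_nat_add of_nat_le_iff of_nat_mult)
  have "real b * real L \<le> d * real n / 2 + real L"
  proof -
    have "real (n div M) \<le> real n / real M"
      using div_times_less_eq_dividend[of n M] M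
      by (simp add: field_simps flip: of_nat_mult)
    hence "real (n div M) * real L \<le> real n / real M * real L" by (intro mult_right_mono) auto
    also have "\<dots> = real n * (real L / real M)" by simp
    also have "\<dots> \<le> real n * (d / 2)"
      using M by (intro mult_left_mono) (auto simp: field_simps)
    finally show ?thesis by (simp add: b_def algebra_simps)
  qed
  with 1 J(2) n have "d * real n / 4 \<le> real (card K) * real M" by linarith
  hence K: "d / (4 * real M) * real n \<le> real (card K)" using M by (simp add: field_simps)
  define c where "c = d / (4 * real M * 2 ^ M) * real n"
  have c0: "c > 0" using d M n by (simp add: c_def)
  have "\<exists>F\<in>\<F>. c \<le> real (card {k\<in>K. B k = F})"
  proof (rule ccontr)
    assume "\<not> ?thesis"
    hence neg: "real (card {k\<in>K. B k = F}) < c" if "F \<in> \<F>" for F using that by auto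
    have fin\<F>: "finite \<F>" by (rule finite_subset[of _ "Pow {..<M}"]) (auto simp: \<F>_def)
    have "0 < d / (4 * real M) * real n" using d M n by simp
    with K have "K \<noteq> {}" by auto
    then obtain k0 where "k0 \<in> K" by blast
    hence ne: "\<F> \<noteq> {}" by (auto simp: \<F>_def K_def B_def intro!: exI[of _ "B k0"])
    have eqK: "(\<Union>F\<in>\<F>. {k\<in>K. B k = F}) = K" by (auto simp: \<F>_def K_def B_def)
    have "card K \<le> (\<Sum>F\<in>\<F>. card {k\<in>K. B k = F})"
      using card_UN_le[OF fin\<F>, of "\<lambda>F. {k\<in>K. B k = F}"] unfolding eqK .
    hence "real (card K) \<le> real (\<Sum>F\<in>\<F>. card {k\<in>K. B k = F})" by (rule of_nat_mono)
    also have "\<dots> = (\<Sum>F\<in>\<F>. real (card {k\<in>K. B k = F}))" by (rule of_nat_sum)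
    also have "\<dots> < real (card \<F>) * c"
      using sum_strict_mono[OF fin\<F> ne, of "\<lambda>F. real (card {k\<in>K. B k = F})" "\<lambda>_. c"] neg by simp
    also have "\<dots> \<le> 2 ^ M * c"
    proof -
      have "card \<F> \<le> card (Pow {..<M})" by (rule card_mono) (auto simp: \<F>_def)
      hence "card \<F> \<le> 2 ^ M" by (simp add: card_Pow)
      hence "real (card \<F>) \<le> 2 ^ M" by (metis of_nat_le_iff of_nat_numeral of_nat_power)
      thus ?thesis using c0 by (intro mult_right_mono) auto
    qed
    also have "\<dots> = d / (4 * real M) * real n" by (simp add: c_def)
    finally show False using K by linarith
  qed
  then obtain F where F: "F \<in> \<F>" "c \<le> real (card {k\<in>K. B k = F})" by blast
  have "card {k\<in>K. B k = F} \<le> card {k. B k = F \<and> k < b}"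
    by (rule card_mono) (auto simp: K_def)
  with F show ?thesis unfolding \<F>_def c_def B_def b_def by (intro exI[of _ F]) auto
qed

text \<open>
  Words of words: along the starting times of the blocks of one frequent shape \<open>F\<close>, the choices
  made inside different blocks are independent of each other, so the sets of points with a
  prescribed itinerary on \<open>F\<close> form a densely independent family again. This is what makes it
  possible to prescribe finitely many visits of a point at once and continue the construction.
\<close>

lemma densely_indep_block:
  assumes "densely_indep X f A S" "S \<noteq> {}" "f ` X \<subseteq> X"
  shows "\<exists>F. finite F \<and> L \<le> card F \<and>
    densely_indep X f (\<lambda>\<omega>. {x\<in>X. \<forall>h\<in>F. (f ^^ h) x \<in> A (\<omega> h)}) (Pi\<^sub>E F (\<lambda>_. S))"
proof -
  define L' where "L' = max L 1"
  obtain d where d: "d > 0"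
    and fr: "\<exists>\<^sub>F n in sequentially. \<exists>J\<subseteq>{1..n}. d * real n \<le> real (card J) \<and> indep X f A S J"
    using assms(1) unfolding densely_indep_def by blast
  obtain M :: nat where "real M > max 1 (2 * real L' / d)" using reals_Archimedean2 by blast
  hence M: "M > 0" "2 * real L' \<le> d * real M" using d by (auto simp: field_simps)
  define c where "c = d / (4 * real M * 2 ^ M)"
  have c: "c > 0" using d M by (simp add: c_def)
  define G where "G F = (\<lambda>\<omega>. {x\<in>X. \<forall>h\<in>F. (f ^^ h) x \<in> A (\<omega> h)})" for F
  define P where "P F n \<longleftrightarrow> (\<exists>J'\<subseteq>{1..n}. c * real n \<le> real (card J') \<and> indep X f (G F) (Pi\<^sub>E F (\<lambda>_. S)) J')"
    for F n
  define \<F> where "\<F> = {F. F \<subseteq> {..<M} \<and> L' \<le> card F}"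
  have fin\<F>: "finite \<F>" by (rule finite_subset[of _ "Pow {..<M}"]) (auto simp: \<F>_def)
  obtain n0 :: nat where n0: "real n0 > 4 * real L' / d" using reals_Archimedean2 by blast
  have "\<exists>\<^sub>F n in sequentially. \<exists>F\<in>\<F>. P F n"
    using frequently_eventually_conj[OF fr eventually_gt_at_top[of n0]]
  proof (rule frequently_mono[rotated], intro allI impI, elim conjE)
    fix n assume n: "n0 < n" and "\<exists>J\<subseteq>{1..n}. d * real n \<le> real (card J) \<and> indep X f A S J"
    then obtain J where J: "J \<subseteq> {1..n}" "d * real n \<le> real (card J)" "indep X f A S J" by blast
    have "4 * real L' / d \<le> real n" using n n0 by linarith
    hence n': "n > 0" "4 * real L' \<le> d * real n" using n d by (auto simp: field_simps)
    from pigeonhole_frequent_block[OF J(1,2) d M n'] obtain F where F: "F \<subseteq> {..<M}" "L' \<le> card F"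
      "c * real n \<le> real (card {k. {i. i < M \<and> k * M + 1 + i \<in> J} = F \<and> k < n div M + 1})"
      unfolding c_def by blast
    \<comment> \<open>The new times are the first times of the blocks of shape \<open>F\<close>.\<close>
    define J' where "J' = (\<lambda>k. k * M + 1) ` {k. {i. i < M \<and> k * M + 1 + i \<in> J} = F \<and> k < n div M + 1}"
    have inj: "inj_on (\<lambda>k. k * M + 1) U" for U using M by (auto simp: inj_on_def)
    have "card F > 0" using F(2) by (simp add: L'_def)
    then obtain i0 where i0: "i0 \<in> F" by fastforce
    have "J' \<subseteq> {1..n}"
    proof
      fix j assume "j \<in> J'"
      then obtain k where k: "j = k * M + 1" "{i. i < M \<and> k * M + 1 + i \<in> J} = F" by (auto simp: J'_def)
      with i0 have "j + i0 \<in> J" by auto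
      thus "j \<in> {1..n}" using J(1) k(1) by auto
    qed
    moreover have "c * real n \<le> real (card J')"
      using F(3) unfolding J'_def card_image[OF inj] .
    moreover have "indep X f (G F) (Pi\<^sub>E F (\<lambda>_. S)) J'"
      unfolding indep_def
    proof (intro allI impI)
      fix Y assume Y: "\<forall>j\<in>J'. Y j \<in> Pi\<^sub>E F (\<lambda>_. S)"
      obtain s where s: "s \<in> S" using assms(2) by blast
      \<comment> \<open>The demands of all blocks together are one demand on \<open>J\<close>; elsewhere on
        \<open>J\<close> any fixed symbol may be demanded.\<close>
      define Y' where "Y' j = (let j0 = (j - 1) div M * M + 1; h = (j - 1) mod M in
         if j0 \<in> J' \<and> h \<in> F then Y j0 h else s)" for j
      have "\<forall>j\<in>J. Y' j \<in> S" using Y s by (auto simp: Y'_def Let_def)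
      then obtain x where x: "x \<in> X" "\<And>j. j \<in> J \<Longrightarrow> (f ^^ j) x \<in> A (Y' j)"
        using J(3) unfolding indep_def by meson
      have "(f ^^ j) x \<in> G F (Y j)" if j: "j \<in> J'" for j
        unfolding G_def
      proof (rule CollectI, intro conjI ballI)
        show "(f ^^ j) x \<in> X" using assms(3) x(1) by (rule funpow_closed)
        fix h assume h: "h \<in> F"
        from j obtain k where k: "j = k * M + 1" "{i. i < M \<and> k * M + 1 + i \<in> J} = F"
          by (auto simp: J'_def)
        with h have hM: "h < M" "j + h \<in> J" by auto
        have "j + h - 1 = h + k * M" using k by simp
        hence "(j + h - 1) div M = k" "(j + h - 1) mod M = h" using hM M by simp_all
        hence "Y' (j + h) = Y j h" using j h k(1) by (simp add: Y'_def Let_def)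
        with x(2)[OF hM(2)] show "(f ^^ h) ((f ^^ j) x) \<in> A (Y j h)"
          by (metis add.commute comp_apply funpow_add)
      qed
      thus "\<exists>x\<in>X. \<forall>j\<in>J'. (f ^^ j) x \<in> G F (Y j)" using x(1) by blast
    qed
    ultimately have "P F n" unfolding P_def by blast
    moreover have "F \<in> \<F>" using F by (simp add: \<F>_def)
    ultimately show "\<exists>F\<in>\<F>. P F n" by blast
  qed
  hence "\<exists>F\<in>\<F>. \<exists>\<^sub>F n in sequentially. P F n"
    using fin\<F> by (simp add: frequently_bex_finite)
  then obtain F where F: "F \<in> \<F>" "\<exists>\<^sub>F n in sequentially. P F n" by blast
  have "densely_indep X f (G F) (Pi\<^sub>E F (\<lambda>_. S))"
    using F(2) c unfolding densely_indep_def P_def by blast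
  moreover have "finite F" "L \<le> card F" using F(1) by (auto simp: \<F>_def L'_def intro: finite_subset)
  ultimately show ?thesis unfolding G_def by blast
qed

section \<open>Sets of times of positive lower density\<close>

lemma indep_shift:
  assumes "indep X f A S J" "S \<noteq> {}" "f ` X \<subseteq> X"
  shows "indep X f A S {j. j + t \<in> J}"
  unfolding indep_def
proof (intro allI impI)
  fix Y assume Y: "\<forall>j\<in>{j. j + t \<in> J}. Y j \<in> S"
  define J1 where "J1 = {j\<in>J. t \<le> j}"
  have "indep X f A S J1" by (rule indep_subset[OF assms(1) _ assms(2)]) (auto simp: J1_def)
  moreover have "\<forall>j\<in>J1. Y (j - t) \<in> S" using Y by (auto simp: J1_def)
  ultimately have "\<exists>x\<in>X. \<forall>j\<in>J1. (f ^^ j) x \<in> A (Y (j - t))"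
    unfolding indep_def by (elim allE[of _ "\<lambda>j. Y (j - t)"]) simp
  then obtain x where x: "x \<in> X" "\<And>j. j \<in> J1 \<Longrightarrow> (f ^^ j) x \<in> A (Y (j - t))" by blast
  have "(f ^^ j) ((f ^^ t) x) \<in> A (Y j)" if "j + t \<in> J" for j
    using x(2)[of "j + t"] that by (simp add: J1_def funpow_add)
  thus "\<exists>x\<in>X. \<forall>j\<in>{j. j + t \<in> J}. (f ^^ j) x \<in> A (Y j)"
    using funpow_closed[OF assms(3) x(1), of t] by blast
qed

text \<open>
  If every starting point \<open>t\<close> had some window of length at most \<open>K\<close> in which \<open>J\<close> is sparse,
  these windows could be laid end to end from \<open>0\<close> to \<open>M\<close>, and \<open>J\<close> as a whole would have less
  than \<open>d * M\<close> elements.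
\<close>

lemma exists_uniformly_dense_window:
  fixes J :: "nat set"
  assumes J: "J \<subseteq> {1..M}" "d * real M \<le> real (card J)" and K: "2 * real K < d * real M" and d: "d > 0"
  shows "\<exists>t. \<forall>n\<le>K. d / 2 * real n \<le> real (card (J \<inter> {t+1..t+n}))"
proof (rule ccontr)
  assume "\<not> ?thesis"
  hence neg: "\<exists>n\<le>K. real (card (J \<inter> {t+1..t+n})) < d / 2 * real n" for t by (meson not_le)
  have "real (card (J \<inter> {t+1..M})) \<le> d / 2 * real (M - t) + real K" for t
  proof (induction "M - t" arbitrary: t rule: less_induct)
    case less
    obtain n where n: "n \<le> K" "real (card (J \<inter> {t+1..t+n})) < d / 2 * real n" using neg by blast
    hence "n > 0" by (cases n) auto
    show ?case
    proof (cases "t + n \<le> M")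
      case False
      have "card (J \<inter> {t+1..M}) \<le> card {t+1..M}" by (rule card_mono) auto
      also have "\<dots> \<le> K" using False n by auto
      finally have "real (card (J \<inter> {t+1..M})) \<le> real K" by simp
      thus ?thesis using d by (simp add: add_increasing)
    next
      case True
      have "J \<inter> {t+1..M} \<subseteq> (J \<inter> {t+1..t+n}) \<union> (J \<inter> {t+n+1..M})" by auto
      hence "card (J \<inter> {t+1..M}) \<le> card ((J \<inter> {t+1..t+n}) \<union> (J \<inter> {t+n+1..M}))"
        by (intro card_mono) auto
      also have "\<dots> \<le> card (J \<inter> {t+1..t+n}) + card (J \<inter> {t+n+1..M})" by (rule card_Un_le)
      finally have "real (card (J \<inter> {t+1..M})) \<le> real (card (J \<inter> {t+1..t+n})) + real (card (J \<inter> {t+n+1..M}))"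
        by (metis of_nat_add of_nat_le_iff)
      moreover have "real (card (J \<inter> {t+n+1..M})) \<le> d / 2 * real (M - (t + n)) + real K"
        using True \<open>n > 0\<close> by (intro less) auto
      moreover have "d / 2 * real n + d / 2 * real (M - (t + n)) = d / 2 * real (M - t)"
        using True by (simp add: of_nat_diff algebra_simps)
      ultimately show ?thesis using n(2) by linarith
    qed
  qed
  from this[of 0] have "real (card (J \<inter> {1..M})) \<le> d / 2 * real M + real K" by simp
  moreover have "J \<inter> {1..M} = J" using J by blast
  ultimately show False using J(2) K by simp
qed

text \<open>
  Koenig's lemma for the binary tree of initial segments: an initial segment is kept if
  infinitely many of the given finite sets extend it, and one of its two continuations is then
  kept as well.
\<close>

lemma exists_dense_set_from_initial_segments:
  assumes Q: "\<And>K::nat. \<exists>J\<subseteq>{1..K}. P J \<and> (\<forall>n\<le>K. e * real n \<le> real (card (J \<inter> {1..n})))"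
    and P: "\<And>J J'. P J \<Longrightarrow> J' \<subseteq> J \<Longrightarrow> P J'"
  shows "\<exists>I\<subseteq>{1..}. (\<forall>n. e * real n \<le> real (card (I \<inter> {1..n}))) \<and> (\<forall>J. finite J \<and> J \<subseteq> I \<longrightarrow> P J)"
proof -
  define R where "R K J \<longleftrightarrow> J \<subseteq> {1..K} \<and> P J \<and> (\<forall>n\<le>K. e * real n \<le> real (card (J \<inter> {1..n})))"
    for K :: nat and J
  define good where "good n \<sigma> \<longleftrightarrow> (\<exists>\<^sub>F K in sequentially. \<exists>J. R K J \<and> J \<inter> {1..n} = \<sigma>)" for n \<sigma>
  have "\<exists>\<sigma>. \<forall>n. good n (\<sigma> n) \<and> \<sigma> (Suc n) \<inter> {1..n} = \<sigma> n"
  proof (rule dependent_nat_choice)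
    have "\<exists>J. R K J \<and> J \<inter> {1..0} = {}" for K using Q[of K] unfolding R_def by auto
    hence "good 0 {}" unfolding good_def by simp
    thus "\<exists>x. good 0 x" ..
  next
    fix \<sigma> n assume g: "good n \<sigma>"
    have "\<exists>\<^sub>F K in sequentially. (\<exists>J. R K J \<and> J \<inter> {1..Suc n} = \<sigma>) \<or>
       (\<exists>J. R K J \<and> J \<inter> {1..Suc n} = insert (Suc n) \<sigma>)"
      using g unfolding good_def
    proof (rule frequently_mono[rotated], intro allI impI)
      fix K assume "\<exists>J. R K J \<and> J \<inter> {1..n} = \<sigma>"
      then obtain J where J: "R K J" "J \<inter> {1..n} = \<sigma>" by blast
      have "{1..Suc n} = insert (Suc n) {1..n}" by auto
      hence "J \<inter> {1..Suc n} = \<sigma> \<or> J \<inter> {1..Suc n} = insert (Suc n) \<sigma>" using J(2) by auto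
      with J(1) show "(\<exists>J. R K J \<and> J \<inter> {1..Suc n} = \<sigma>) \<or>
       (\<exists>J. R K J \<and> J \<inter> {1..Suc n} = insert (Suc n) \<sigma>)" by blast
    qed
    hence "good (Suc n) \<sigma> \<or> good (Suc n) (insert (Suc n) \<sigma>)"
      unfolding good_def by (simp add: frequently_disj_iff)
    moreover have "\<sigma> \<subseteq> {1..n}"
      using frequently_ex[OF g[unfolded good_def]] by blast
    hence "\<sigma> \<inter> {1..n} = \<sigma>" "insert (Suc n) \<sigma> \<inter> {1..n} = \<sigma>" by auto
    ultimately show "\<exists>y. good (Suc n) y \<and> y \<inter> {1..n} = \<sigma>" by blast
  qed
  then obtain \<sigma> where g: "\<And>n. good n (\<sigma> n)" and s: "\<And>n. \<sigma> (Suc n) \<inter> {1..n} = \<sigma> n" by blast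
  have sub: "\<sigma> n \<subseteq> {1..n}" for n using s by blast
  have init: "\<sigma> (n + k) \<inter> {1..n} = \<sigma> n" for n k
  proof (induction k)
    case 0
    show ?case using sub by auto
  next
    case (Suc k)
    have "\<sigma> (n + k) \<inter> {1..n} = \<sigma> (Suc (n + k)) \<inter> {1..n+k} \<inter> {1..n}" using s by simp
    also have "\<dots> = \<sigma> (n + Suc k) \<inter> {1..n}" by auto
    finally show ?case using Suc by simp
  qed
  define I where "I = (\<Union>n. \<sigma> n)"
  have In: "I \<inter> {1..n} = \<sigma> n" for n
  proof
    show "\<sigma> n \<subseteq> I \<inter> {1..n}" using sub by (auto simp: I_def)
    show "I \<inter> {1..n} \<subseteq> \<sigma> n"
    proof
      fix j assume j: "j \<in> I \<inter> {1..n}"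
      then obtain m where m: "j \<in> \<sigma> m" by (auto simp: I_def)
      have "j \<in> \<sigma> (m + n)" using init[of m n] m by blast
      hence "j \<in> \<sigma> (n + m) \<inter> {1..n}" using j by (simp add: add.commute)
      thus "j \<in> \<sigma> n" unfolding init .
    qed
  qed
  have gn: "\<exists>J. P J \<and> \<sigma> n \<subseteq> J \<and> e * real n \<le> real (card (\<sigma> n))" for n
  proof -
    from frequently_eventually_conj[OF g[of n, unfolded good_def] eventually_ge_at_top[of n]]
    obtain K J where KJ: "R K J" "J \<inter> {1..n} = \<sigma> n" "n \<le> K" by (auto dest!: frequently_ex)
    hence "P J" "\<sigma> n \<subseteq> J" "e * real n \<le> real (card (\<sigma> n))" unfolding R_def by auto
    thus ?thesis by blast
  qed
  show ?thesis
  proof (intro exI[of _ I] conjI allI impI)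
    show "I \<subseteq> {1..}" using sub by (force simp: I_def)
    show "e * real n \<le> real (card (I \<inter> {1..n}))" for n using gn[of n] unfolding In by blast
    fix J assume J: "finite J \<and> J \<subseteq> I"
    obtain n where "\<forall>j\<in>J. j \<le> n" using J finite_nat_set_iff_bounded_le by blast
    hence "J \<subseteq> I \<inter> {1..n}" using J \<open>I \<subseteq> {1..}\<close> by auto
    thus "P J" using In gn[of n] P by (metis order.trans)
  qed
qed

text \<open>
  Windows in which the lower density is already attained at every length can be shifted to start
  at time \<open>1\<close>, because independence is invariant under shifts of time; compactness then produces
  a single infinite set of times.
\<close>

lemma densely_indep_imp_positive_density:
  assumes di: "densely_indep X f A S" and "S \<noteq> {}" "f ` X \<subseteq> X"
    and \<A>: "\<And>B. B \<in> \<A> \<Longrightarrow> \<exists>s\<in>S. A s \<subseteq> B"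
  shows "has_positive_density_independence X f \<A>"
proof -
  obtain d where d: "d > 0"
    and fr: "\<exists>\<^sub>F n in sequentially. \<exists>J\<subseteq>{1..n}. d * real n \<le> real (card J) \<and> indep X f A S J"
    using di unfolding densely_indep_def by blast
  have "\<exists>J\<subseteq>{1..K}. indep X f A S J \<and> (\<forall>n\<le>K. d / 2 * real n \<le> real (card (J \<inter> {1..n})))" for K
  proof -
    obtain m :: nat where m: "2 * real K / d < real m" using reals_Archimedean2 by blast
    from frequently_eventually_conj[OF fr eventually_gt_at_top[of m]]
    obtain M J where M: "m < M" "J \<subseteq> {1..M}" "d * real M \<le> real (card J)" "indep X f A S J"
      by (auto dest!: frequently_ex)
    have "2 * real K / d < real M" using m M(1) by linarith
    hence "2 * real K < d * real M" using d by (simp add: field_simps)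
    from exists_uniformly_dense_window[OF M(2,3) this d] obtain t where
      t: "\<And>n. n \<le> K \<Longrightarrow> d / 2 * real n \<le> real (card (J \<inter> {t+1..t+n}))" by blast
    define J' where "J' = {j. j + t \<in> J} \<inter> {1..K}"
    have "indep X f A S J'"
      by (rule indep_subset[OF indep_shift[OF M(4) assms(2,3), of t]]) (use assms(2) in \<open>auto simp: J'_def\<close>)
    moreover have "d / 2 * real n \<le> real (card (J' \<inter> {1..n}))" if n: "n \<le> K" for n
    proof -
      have "J \<inter> {t+1..t+n} = (\<lambda>j. j + t) ` (J' \<inter> {1..n})"
      proof
        show "J \<inter> {t+1..t+n} \<subseteq> (\<lambda>j. j + t) ` (J' \<inter> {1..n})"
        proof
          fix j assume "j \<in> J \<inter> {t+1..t+n}"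
          thus "j \<in> (\<lambda>j. j + t) ` (J' \<inter> {1..n})"
            using n by (intro image_eqI[of _ _ "j - t"]) (auto simp: J'_def)
        qed
      qed (auto simp: J'_def)
      hence "card (J \<inter> {t+1..t+n}) = card (J' \<inter> {1..n})" by (simp add: card_image)
      with t[OF n] show ?thesis by simp
    qed
    moreover have "J' \<subseteq> {1..K}" by (simp add: J'_def)
    ultimately show ?thesis by blast
  qed
  hence "\<exists>I\<subseteq>{1..}. (\<forall>n. d / 2 * real n \<le> real (card (I \<inter> {1..n}))) \<and>
      (\<forall>J. finite J \<and> J \<subseteq> I \<longrightarrow> indep X f A S J)"
    by (rule exists_dense_set_from_initial_segments) (rule indep_subset[OF _ _ assms(2)])
  then obtain I where I: "I \<subseteq> {1..}" "\<And>n. d / 2 * real n \<le> real (card (I \<inter> {1..n}))"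
    "\<And>J. finite J \<Longrightarrow> J \<subseteq> I \<Longrightarrow> indep X f A S J" by (elim exE conjE) simp
  have "ereal (d / 2) \<le> liminf (\<lambda>n. ereal (real (card (I \<inter> {1..n})) / real n))"
  proof (rule Liminf_bounded)
    show "\<forall>\<^sub>F n in sequentially. ereal (d / 2) \<le> ereal (real (card (I \<inter> {1..n})) / real n)"
      using eventually_gt_at_top[of 0] by eventually_elim (use I(2) in \<open>simp add: field_simps\<close>)
  qed
  hence "positive_density I" using d unfolding positive_density_def
    by (metis ereal_less(2) half_gt_zero less_le_trans)
  moreover have "\<exists>x\<in>X. \<forall>j\<in>J. (f ^^ j) x \<in> Y j"
    if J: "finite J" "J \<subseteq> I" "\<forall>j\<in>J. Y j \<in> \<A>" for J Y
  proof -
    from J(3) \<A> have "\<forall>j\<in>J. \<exists>s\<in>S. A s \<subseteq> Y j" by blast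
    then obtain y where y: "\<forall>j\<in>J. y j \<in> S \<and> A (y j) \<subseteq> Y j" by metis
    then obtain x where "x \<in> X" "\<forall>j\<in>J. (f ^^ j) x \<in> A (y j)"
      using I(3)[OF J(1,2)] unfolding indep_def by meson
    with y show ?thesis by blast
  qed
  ultimately show ?thesis unfolding has_positive_density_independence_def using I(1) by blast
qed

lemma positive_density_imp_densely_indep:
  assumes "has_positive_density_independence X f (A ` S)"
  shows "densely_indep X f A S"
proof -
  from assms obtain I where I: "positive_density I"
    "\<forall>J Y. finite J \<and> J \<subseteq> I \<and> (\<forall>j\<in>J. Y j \<in> A ` S) \<longrightarrow> (\<exists>x\<in>X. \<forall>j\<in>J. (f ^^ j) x \<in> Y j)"
    unfolding has_positive_density_independence_def by (elim exE conjE)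
  obtain d where d: "0 < ereal d" "ereal d < liminf (\<lambda>n. ereal (real (card (I \<inter> {1..n})) / real n))"
    using I(1) ereal_dense2 unfolding positive_density_def by blast
  have ev: "\<forall>\<^sub>F n in sequentially. \<exists>J\<subseteq>{1..n}. d * real n \<le> real (card J) \<and> indep X f A S J"
    using less_LiminfD[OF d(2)] eventually_gt_at_top[of 0]
  proof eventually_elim
    case (elim n)
    have "indep X f A S (I \<inter> {1..n})"
      unfolding indep_def
    proof (intro allI impI)
      fix Y assume "\<forall>j\<in>I \<inter> {1..n}. Y j \<in> S"
      thus "\<exists>x\<in>X. \<forall>j\<in>I \<inter> {1..n}. (f ^^ j) x \<in> A (Y j)"
        using I(2)[rule_format, of "I \<inter> {1..n}" "\<lambda>j. A (Y j)"] by simp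
    qed
    moreover have "d * real n \<le> real (card (I \<inter> {1..n}))" using elim by (simp add: field_simps)
    ultimately show ?case by blast
  qed
  have "d > 0" using d(1) by simp
  with eventually_frequently[OF _ ev] show ?thesis unfolding densely_indep_def by auto
qed

section \<open>Patterns in linearly ordered sets of words\<close>

text \<open>
  Let \<open>Ch h i t\<close> say that there are words with entries \<open>xs ! 0, \<dots>, xs ! (i - 1)\<close> at \<open>h\<close>, in
  this order, at nondecreasing positions up to \<open>t\<close>, and let \<open>c h t\<close> be the maximal such \<open>i\<close>. If \<open>xs\<close> is
  never completed, then a word at position \<open>t\<close> cannot have the entry \<open>xs ! c h t\<close> at \<open>h\<close>, since
  it would prolong the sequence. So the words with a given vector \<open>(c h t)\<close> number at most
  \<open>(N - 1)^r\<close>, where \<open>r = card F\<close>. The vectors increase with \<open>t\<close>, hence form a chain in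
  \<open>{0..N - 1}^r\<close>, and there are at most \<open>r (N - 1) + 1\<close> of them.
\<close>

lemma exists_ordered_pattern:
  fixes T :: "('h \<Rightarrow> 's) set" and pos :: "('h \<Rightarrow> 's) \<Rightarrow> nat" and xs :: "'s list"
  assumes T: "T \<subseteq> Pi\<^sub>E F (\<lambda>_. set xs)" and F: "finite F" and xs: "distinct xs"
    and big: "(card F * (length xs - 1) + 1) * (length xs - 1) ^ card F < card T"
  shows "\<exists>h\<in>F. \<exists>w. (\<forall>i<length xs. w i \<in> T \<and> w i h = xs ! i) \<and>
    (\<forall>i j. i < j \<and> j < length xs \<longrightarrow> pos (w i) \<le> pos (w j))"
proof (rule ccontr)
  assume neg: "\<not> ?thesis"
  define N where "N = length xs"
  define Ch where "Ch h i t \<longleftrightarrow> (\<exists>w. (\<forall>l<i. w l \<in> T \<and> w l h = xs ! l \<and> pos (w l) \<le> t) \<and>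
    (\<forall>l l'. l < l' \<and> l' < i \<longrightarrow> pos (w l) \<le> pos (w l')))" for h i t
  have Ch0: "Ch h 0 t" for h t by (simp add: Ch_def)
  have Ch_mono: "Ch h i t'" if "Ch h i t" "t \<le> t'" for h i t t'
    using that unfolding Ch_def by (meson order.trans)
  have Ch_Suc: "Ch h (Suc i) (pos \<omega>)" if "Ch h i (pos \<omega>)" "\<omega> \<in> T" "\<omega> h = xs ! i" for h i \<omega>
  proof -
    from that(1) obtain w where w: "\<forall>l<i. w l \<in> T \<and> w l h = xs ! l \<and> pos (w l) \<le> pos \<omega>"
      "\<forall>l l'. l < l' \<and> l' < i \<longrightarrow> pos (w l) \<le> pos (w l')" unfolding Ch_def by blast
    show ?thesis unfolding Ch_def
      by (rule exI[of _ "w(i := \<omega>)"]) (use w that(2,3) in \<open>auto simp: less_Suc_eq\<close>)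
  qed
  have ChN: "\<not> Ch h N t" if "h \<in> F" for h t
    using neg that unfolding Ch_def N_def by blast
  define c where "c h t = Max {i. i \<le> N \<and> Ch h i t}" for h t
  have c: "c h t \<le> N" "Ch h (c h t) t" for h t
  proof -
    have "c h t \<in> {i. i \<le> N \<and> Ch h i t}" unfolding c_def
      by (rule Max_in) (use Ch0 in auto)
    thus "c h t \<le> N" "Ch h (c h t) t" by auto
  qed
  have cmax: "i \<le> c h t" if "i \<le> N" "Ch h i t" for i h t
    unfolding c_def using that by (intro Max_ge) auto
  have cless: "c h t < N" if "h \<in> F" for h t
    using c[where h=h and t=t] ChN[OF that, of t] by (metis le_neq_implies_less)
  have cmono: "c h t \<le> c h t'" if "t \<le> t'" for h t t'
    using c Ch_mono[OF _ that] by (intro cmax) auto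
  have miss: "\<omega> h \<noteq> xs ! c h (pos \<omega>)" if "\<omega> \<in> T" "h \<in> F" for \<omega> h
  proof
    assume "\<omega> h = xs ! c h (pos \<omega>)"
    hence "Ch h (Suc (c h (pos \<omega>))) (pos \<omega>)" using c that by (intro Ch_Suc) auto
    hence "Suc (c h (pos \<omega>)) \<le> c h (pos \<omega>)" using cless[OF that(2)] by (intro cmax) (auto simp: Suc_le_eq)
    thus False by simp
  qed
  have finT: "finite T" by (rule finite_subset[OF T]) (use F in \<open>auto intro: finite_PiE\<close>)
  define v where "v \<omega> = restrict (\<lambda>h. c h (pos \<omega>)) F" for \<omega>
  define V where "V = v ` T"
  have "inj_on (\<lambda>u. \<Sum>h\<in>F. u h) V"
  proof (rule inj_onI)
    have *: "v \<omega> = v \<omega>'" if "pos \<omega> \<le> pos \<omega>'" "(\<Sum>h\<in>F. v \<omega> h) = (\<Sum>h\<in>F. v \<omega>' h)" for \<omega> \<omega>'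
    proof
      fix h
      show "v \<omega> h = v \<omega>' h"
      proof (cases "h \<in> F")
        case True
        show ?thesis
          by (rule sum_mono_inv[OF that(2) _ True F]) (use cmono[OF that(1)] in \<open>simp add: v_def\<close>)
      qed (simp add: v_def)
    qed
    fix u u' assume "u \<in> V" "u' \<in> V" and eq: "(\<Sum>h\<in>F. u h) = (\<Sum>h\<in>F. u' h)"
    then obtain \<omega> \<omega>' where "u = v \<omega>" "u' = v \<omega>'" by (auto simp: V_def)
    with *[of \<omega> \<omega>'] *[of \<omega>' \<omega>] eq show "u = u'" by (metis nle_le)
  qed
  moreover have "(\<lambda>u. \<Sum>h\<in>F. u h) ` V \<subseteq> {..card F * (N - 1)}"
  proof clarsimp
    fix u assume "u \<in> V"
    then obtain \<omega> where u: "u = v \<omega>" by (auto simp: V_def)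
    have "(\<Sum>h\<in>F. u h) \<le> (\<Sum>h\<in>F. N - 1)"
    proof (rule sum_mono)
      fix h assume "h \<in> F"
      thus "u h \<le> N - 1" using cless[of h "pos \<omega>"] by (simp add: u v_def)
    qed
    thus "(\<Sum>h\<in>F. u h) \<le> card F * (N - Suc 0)" by simp
  qed
  ultimately have cV: "card V \<le> card F * (N - 1) + 1"
    using card_inj_on_le[of "\<lambda>u. \<Sum>h\<in>F. u h" V "{..card F * (N - 1)}"] by simp
  have "T \<subseteq> (\<Union>u\<in>V. Pi\<^sub>E F (\<lambda>h. set xs - {xs ! u h}))"
  proof
    fix \<omega> assume \<omega>: "\<omega> \<in> T"
    have "\<omega> \<in> Pi\<^sub>E F (\<lambda>h. set xs - {xs ! v \<omega> h})"
      using T \<omega> miss[OF \<omega>] by (auto simp: PiE_iff v_def extensional_def)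
    thus "\<omega> \<in> (\<Union>u\<in>V. Pi\<^sub>E F (\<lambda>h. set xs - {xs ! u h}))" using \<omega> by (auto simp: V_def)
  qed
  hence "card T \<le> card (\<Union>u\<in>V. Pi\<^sub>E F (\<lambda>h. set xs - {xs ! u h}))"
    using finT F by (intro card_mono) (auto simp: V_def intro!: finite_PiE)
  also have "\<dots> \<le> (\<Sum>u\<in>V. card (Pi\<^sub>E F (\<lambda>h. set xs - {xs ! u h})))"
    using finT by (intro card_UN_le) (simp add: V_def)
  also have "\<dots> \<le> (\<Sum>u\<in>V. (N - 1) ^ card F)"
  proof (rule sum_mono)
    fix u assume "u \<in> V"
    then obtain \<omega> where u: "u = v \<omega>" by (auto simp: V_def)
    have "card (Pi\<^sub>E F (\<lambda>h. set xs - {xs ! u h})) = (\<Prod>h\<in>F. card (set xs - {xs ! u h}))"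
      using F by (rule card_PiE)
    also have "\<dots> = (\<Prod>h\<in>F. N - 1)"
    proof (rule prod.cong[OF refl])
      fix h assume "h \<in> F"
      hence "xs ! u h \<in> set xs" using cless[of h "pos \<omega>"] by (simp add: u v_def N_def)
      thus "card (set xs - {xs ! u h}) = N - 1" using xs by (simp add: N_def distinct_card)
    qed
    finally show "card (Pi\<^sub>E F (\<lambda>h. set xs - {xs ! u h})) \<le> (N - 1) ^ card F" by simp
  qed
  also have "\<dots> = card V * (N - 1) ^ card F" by simp
  also have "\<dots> \<le> (card F * (N - 1) + 1) * (N - 1) ^ card F" using cV by (rule mult_right_mono) simp
  finally show False using big by (simp add: N_def)
qed

lemma eventually_polynomial_times_power_less:
  fixes E N :: nat
  shows "\<forall>\<^sub>F r in sequentially. E * ((r * N + 1) * N ^ r) < Suc N ^ r"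
proof -
  define q where "q = real N / real (Suc N)"
  have q: "norm q < 1" by (simp add: q_def)
  have "(\<lambda>r. real E * (real N * (real r * q ^ r) + q ^ r)) \<longlonglongrightarrow> real E * (real N * 0 + 0)"
    using q by (intro tendsto_intros powser_times_n_limit_0 LIMSEQ_power_zero) auto
  hence "\<forall>\<^sub>F r in sequentially. real E * (real N * (real r * q ^ r) + q ^ r) < 1"
    by (rule order_tendstoD) simp
  thus ?thesis
  proof eventually_elim
    case (elim r)
    have "real (E * ((r * N + 1) * N ^ r)) = real E * (real N * (real r * q ^ r) + q ^ r) * real (Suc N) ^ r"
      by (simp add: q_def power_divide field_simps del: of_nat_Suc)
    also have "\<dots> < 1 * real (Suc N) ^ r"
      using elim by (intro mult_strict_right_mono) auto
    finally show ?case by (metis mult_1 of_nat_less_iff of_nat_power)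
  qed
qed

section \<open>Subdivided graphs\<close>

text \<open>
  For \<open>u = v\<close> this is the vertex \<open>u\<close>, whatever \<open>a\<close> is, so that isolated vertices are covered by the
  same formula.
\<close>

definition edge_point :: "nat \<Rightarrow> nat \<Rightarrow> real \<Rightarrow> nat \<Rightarrow> real" where
  "edge_point u v a = (\<lambda>w. (1 - a) * of_bool (w = u) + a * of_bool (w = v))"

lemma edge_point_flip: "edge_point u v a = edge_point v u (1 - a)"
  by (auto simp: edge_point_def)

lemma edge_point_same: "edge_point u u a = (\<lambda>w. of_bool (w = u))"
  by (auto simp: edge_point_def algebra_simps)

lemma edge_point_at: "u \<noteq> v \<Longrightarrow> edge_point u v a v = a"
  by (simp add: edge_point_def)

lemma edge_point_inject: "u \<noteq> v \<Longrightarrow> edge_point u v a = edge_point u v b \<longleftrightarrow> a = b"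
  by (metis edge_point_at)

text \<open>
  The complex \<open>K\<close> with each edge divided into \<open>n\<close> parts. The vertices of the subdivision are
  not abstract: they are the points of the realization of \<open>K\<close> with coordinates in
  \<open>(1/n) \<int>\<close>. Nerves and barycentric coordinates can then be compared by means of distances.
\<close>

locale subdivided_graph =
  fixes K :: "nat set set" and n :: nat
  assumes complex: "abstract_complex K" and dim: "\<And>s. s \<in> K \<Longrightarrow> card s \<le> 2" and n_pos: "n > 0"
begin

text \<open>
  Half of the sum metric, so that points on one edge have their parameter difference as distance.
\<close>

definition gdist :: "(nat \<Rightarrow> real) \<Rightarrow> (nat \<Rightarrow> real) \<Rightarrow> real" where
  "gdist x y = (\<Sum>v\<in>\<Union>K. \<bar>x v - y v\<bar>) / 2"

definition grid :: "(nat \<Rightarrow> real) set" where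
  "grid = {edge_point u v (real i / real n) | u v i. {u, v} \<in> K \<and> i \<le> n}"

text \<open>
  The barycentric coordinate of \<open>x\<close> at \<open>p\<close> in the subdivision.
\<close>

definition tent :: "(nat \<Rightarrow> real) \<Rightarrow> (nat \<Rightarrow> real) \<Rightarrow> real" where
  "tent p x = max 0 (1 - real n * gdist x p)"

text \<open>
  Edges of the subdivision, with a degenerate edge at each vertex of \<open>K\<close>: an isolated vertex lies
  on no other.
\<close>

definition adj :: "(nat \<Rightarrow> real) \<Rightarrow> (nat \<Rightarrow> real) \<Rightarrow> bool" where
  "adj p q \<longleftrightarrow> (\<exists>u. {u} \<in> K \<and> p = edge_point u u 0 \<and> q = p) \<or>
     (\<exists>u v i. u \<noteq> v \<and> {u, v} \<in> K \<and> i < n \<and>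
        p = edge_point u v (real i / real n) \<and> q = edge_point u v (real (Suc i) / real n))"

lemma finite_complex: "finite K"
  using complex by (simp add: abstract_complex_def)

lemma finite_simplex: "s \<in> K \<Longrightarrow> finite s"
  using complex by (simp add: abstract_complex_def)

lemma simplex_nonempty: "s \<in> K \<Longrightarrow> s \<noteq> {}"
  using complex by (simp add: abstract_complex_def)

lemma face_in_complex: "s \<in> K \<Longrightarrow> t \<subseteq> s \<Longrightarrow> t \<noteq> {} \<Longrightarrow> t \<in> K"
  using complex unfolding abstract_complex_def by blast

lemma scaled_abs_diff: "real n * \<bar>a / real n - b / real n\<bar> = \<bar>a - b\<bar>"
proof -
  have "real n * \<bar>a / real n - b / real n\<bar> = \<bar>real n * (a / real n - b / real n)\<bar>"
    by (simp add: abs_mult)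
  also have "real n * (a / real n - b / real n) = a - b"
    using n_pos by (simp add: right_diff_distrib)
  finally show ?thesis .
qed

lemma finite_vertices: "finite (\<Union>K)"
  using finite_complex finite_simplex by auto

lemma simplex_pair:
  assumes "s \<in> K"
  obtains u v where "s = {u, v}"
proof -
  have "card s \<noteq> 0" using assms finite_simplex simplex_nonempty by auto
  with dim[OF assms] consider "card s = 1" | "card s = 2" by linarith
  thus thesis
  proof cases
    case 1
    then obtain u where "s = {u}" by (auto simp: card_1_singleton_iff)
    with that[of u u] show ?thesis by simp
  next
    case 2
    with that show ?thesis by (auto simp: card_2_iff)
  qed
qed

lemma sum_polyhedron:
  assumes "x \<in> polyhedron_of K" "finite V" "{v. x v \<noteq> 0} \<subseteq> V"
  shows "(\<Sum>v\<in>V. x v) = 1"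
proof -
  have "(\<Sum>v\<in>V. x v) = (\<Sum>v | x v \<noteq> 0. x v)"
    using assms(2,3) by (intro sum.mono_neutral_right) auto
  thus ?thesis using assms(1) by (simp add: polyhedron_of_def)
qed

lemma edge_point_in:
  assumes "{u, v} \<in> K" "0 \<le> a" "a \<le> 1"
  shows "edge_point u v a \<in> polyhedron_of K"
proof -
  let ?x = "edge_point u v a"
  have sub: "{w. ?x w \<noteq> 0} \<subseteq> {u, v}" by (auto simp: edge_point_def)
  have 1: "(\<Sum>w\<in>{u, v}. ?x w) = 1"
    by (cases "u = v") (auto simp: edge_point_def)
  have s: "(\<Sum>w | ?x w \<noteq> 0. ?x w) = 1"
    unfolding 1[symmetric] using sub by (intro sum.mono_neutral_left) auto
  hence "{w. ?x w \<noteq> 0} \<noteq> {}" by (metis sum.empty zero_neq_one)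
  hence "{w. ?x w \<noteq> 0} \<in> K" using face_in_complex[OF assms(1) sub] by blast
  moreover have "0 \<le> ?x w" for w using assms by (simp add: edge_point_def)
  ultimately show ?thesis using s by (simp add: polyhedron_of_def)
qed

lemma edge_point_rep:
  assumes "x \<in> polyhedron_of K" "{w. x w \<noteq> 0} \<subseteq> {u, v}"
  shows "u \<noteq> v \<Longrightarrow> x = edge_point u v (x v)" "u = v \<Longrightarrow> x = edge_point u u b"
proof -
  have s: "(\<Sum>w\<in>{u, v}. x w) = 1" using assms by (intro sum_polyhedron) auto
  have z: "x w = 0" if "w \<noteq> u" "w \<noteq> v" for w using assms(2) that by auto
  show "x = edge_point u v (x v)" if "u \<noteq> v"
  proof
    fix w
    show "x w = edge_point u v (x v) w"
      using s z[of w] that by (cases "w = u"; cases "w = v") (auto simp: edge_point_def)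
  qed
  show "x = edge_point u u b" if "u = v"
  proof
    fix w
    show "x w = edge_point u u b w"
      using s z[of w] that by (cases "w = u") (auto simp: edge_point_same)
  qed
qed

lemma polyhedron_bounds:
  assumes "x \<in> polyhedron_of K"
  shows "0 \<le> x w" "x w \<le> 1"
proof -
  show *: "0 \<le> x w" for w using assms by (simp add: polyhedron_of_def)
  have fin: "finite {v. x v \<noteq> 0}" using assms finite_simplex by (simp add: polyhedron_of_def)
  have "x w \<le> (\<Sum>v | x v \<noteq> 0. x v)"
  proof (cases "x w = 0")
    case True
    thus ?thesis using * by (simp add: sum_nonneg)
  next
    case False
    thus ?thesis using * fin by (intro member_le_sum) auto
  qed
  thus "x w \<le> 1" using assms by (simp add: polyhedron_of_def)
qed

lemma polyhedron_edge:
  assumes "x \<in> polyhedron_of K"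
  obtains u v a where "{u, v} \<in> K" "0 \<le> a" "a \<le> 1" "x = edge_point u v a" "{w. x w \<noteq> 0} = {u, v}"
proof -
  have s: "{w. x w \<noteq> 0} \<in> K" using assms by (simp add: polyhedron_of_def)
  obtain u v where uv: "{w. x w \<noteq> 0} = {u, v}" using simplex_pair[OF s] .
  show thesis
  proof (cases "u = v")
    case True
    have "x = edge_point u v 0" using edge_point_rep(2)[OF assms _ True] uv True by auto
    with that[of u v 0] s uv show ?thesis by auto
  next
    case False
    have "x = edge_point u v (x v)" using edge_point_rep(1)[OF assms _ False] uv by auto
    with that[of u v "x v"] s uv polyhedron_bounds[OF assms, of v] show ?thesis by auto
  qed
qed

lemma polyhedron_support: "x \<in> polyhedron_of K \<Longrightarrow> {w. x w \<noteq> 0} \<subseteq> \<Union>K"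
  by (auto simp: polyhedron_of_def)

lemma gdist_nonneg: "0 \<le> gdist x y"
  by (simp add: gdist_def sum_nonneg)

lemma gdist_commute: "gdist x y = gdist y x"
  by (simp add: gdist_def abs_minus_commute)

lemma gdist_triangle: "gdist x z \<le> gdist x y + gdist y z"
proof -
  have "(\<Sum>v\<in>\<Union>K. \<bar>x v - z v\<bar>) \<le> (\<Sum>v\<in>\<Union>K. \<bar>x v - y v\<bar> + \<bar>y v - z v\<bar>)"
    by (rule sum_mono) linarith
  thus ?thesis by (simp add: gdist_def sum.distrib add_divide_distrib[symmetric])
qed

lemma gdist_self: "gdist x x = 0"
  by (simp add: gdist_def)

lemma gdist_eq_0:
  assumes "x \<in> polyhedron_of K" "y \<in> polyhedron_of K" "gdist x y = 0"
  shows "x = y"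
proof
  fix w
  have "\<forall>v\<in>\<Union>K. \<bar>x v - y v\<bar> = 0"
    using assms(3) finite_vertices unfolding gdist_def
    by (subst (asm) divide_eq_0_iff) (auto simp: sum_nonneg_eq_0_iff)
  moreover have "x w = 0" "y w = 0" if "w \<notin> \<Union>K"
    using that polyhedron_support[OF assms(1)] polyhedron_support[OF assms(2)] by blast+
  ultimately show "x w = y w" by (cases "w \<in> \<Union>K") auto
qed

lemma gdist_edge:
  assumes "{u, v} \<in> K" "u \<noteq> v"
  shows "gdist (edge_point u v a) (edge_point u v b) = \<bar>a - b\<bar>"
proof -
  have "(\<Sum>w\<in>\<Union>K. \<bar>edge_point u v a w - edge_point u v b w\<bar>)
      = (\<Sum>w\<in>{u, v}. \<bar>edge_point u v a w - edge_point u v b w\<bar>)"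
    using assms(1) finite_vertices by (intro sum.mono_neutral_right) (auto simp: edge_point_def)
  also have "\<dots> = 2 * \<bar>a - b\<bar>" using assms(2) by (simp add: edge_point_def)
  finally show ?thesis by (simp add: gdist_def)
qed

text \<open>
  The coordinates of both points sum to one, so the change of one coordinate is compensated by the
  others and is counted twice in the sum metric.
\<close>

lemma coordinate_le_gdist:
  assumes "x \<in> polyhedron_of K" "y \<in> polyhedron_of K"
  shows "\<bar>x w - y w\<bar> \<le> gdist x y"
proof (cases "w \<in> \<Union>K")
  case False
  hence "x w = 0" "y w = 0" using assms polyhedron_support by blast+
  thus ?thesis using gdist_nonneg by simp
next
  case True
  note V = finite_vertices
  have "(\<Sum>v\<in>\<Union>K. x v - y v) = 0"
    using sum_polyhedron[OF assms(1) V polyhedron_support] sum_polyhedron[OF assms(2) V polyhedron_support]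
      assms by (simp add: sum_subtractf)
  hence "x w - y w = - (\<Sum>v\<in>\<Union>K - {w}. x v - y v)"
    using V True by (simp add: sum.remove[of "\<Union>K" w])
  hence "\<bar>x w - y w\<bar> \<le> (\<Sum>v\<in>\<Union>K - {w}. \<bar>x v - y v\<bar>)"
    by (simp add: sum_abs)
  moreover have "(\<Sum>v\<in>\<Union>K. \<bar>x v - y v\<bar>) = \<bar>x w - y w\<bar> + (\<Sum>v\<in>\<Union>K - {w}. \<bar>x v - y v\<bar>)"
    using V True by (rule sum.remove)
  ultimately show ?thesis by (simp add: gdist_def)
qed

lemma ratio_bounds: "i \<le> n \<Longrightarrow> 0 \<le> real i / real n \<and> real i / real n \<le> 1"
  using n_pos by simp

lemma grid_subset: "grid \<subseteq> polyhedron_of K"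
  using edge_point_in ratio_bounds by (auto simp: grid_def)

lemma finite_grid: "finite grid"
proof -
  have "grid \<subseteq> (\<lambda>(u, v, i). edge_point u v (real i / real n)) ` (\<Union>K \<times> \<Union>K \<times> {..n})"
    by (force simp: grid_def)
  thus ?thesis by (rule finite_subset) (use finite_vertices in auto)
qed

lemma grid_coordinate:
  assumes "p \<in> grid"
  shows "\<exists>i\<le>n. p w = real i / real n"
proof -
  obtain u v i where p: "p = edge_point u v (real i / real n)" "i \<le> n" using assms by (auto simp: grid_def)
  have 1: "1 - real i / real n = real (n - i) / real n"
    using p(2) n_pos by (simp add: of_nat_diff field_simps)
  show ?thesis
  proof (cases "w = u"; cases "w = v")
    assume "w = u" "w = v"
    thus ?thesis using p n_pos by (intro exI[of _ n]) (simp add: edge_point_def)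
  next
    assume "w = u" "w \<noteq> v"
    thus ?thesis using p 1 by (intro exI[of _ "n - i"]) (simp add: edge_point_def)
  next
    assume "w \<noteq> u" "w = v"
    thus ?thesis using p by (intro exI[of _ i]) (simp add: edge_point_def)
  next
    assume "w \<noteq> u" "w \<noteq> v"
    thus ?thesis using p by (intro exI[of _ 0]) (simp add: edge_point_def)
  qed
qed

text \<open>
  The nonzero coordinates of a grid point are at least \<open>1/n\<close>, so they cannot vanish within
  distance less than \<open>1/n\<close>. This keeps all considerations near a grid point on a single edge.
\<close>

lemma near_grid_support:
  assumes "p \<in> grid" "x \<in> polyhedron_of K" "gdist x p < 1 / real n"
  shows "{w. p w \<noteq> 0} \<subseteq> {w. x w \<noteq> 0}"
proof clarify
  fix w assume w: "p w \<noteq> 0" "x w = 0"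
  obtain i where i: "p w = real i / real n" using grid_coordinate[OF assms(1)] by blast
  with w have "i \<ge> 1" by (cases i) auto
  hence "1 / real n \<le> p w" using n_pos i by (simp add: divide_right_mono)
  moreover have "\<bar>x w - p w\<bar> \<le> gdist x p"
    using assms grid_subset by (intro coordinate_le_gdist) auto
  ultimately show False using w(2) assms(3) by linarith
qed

lemma near_grid_on_edge:
  assumes "{u, v} \<in> K" "0 \<le> a" "a \<le> 1" "p \<in> grid" "gdist (edge_point u v a) p < 1 / real n"
  shows "\<exists>i\<le>n. p = edge_point u v (real i / real n)"
proof -
  have "{w. p w \<noteq> 0} \<subseteq> {w. edge_point u v a w \<noteq> 0}"
    using assms by (intro near_grid_support edge_point_in)
  also have "\<dots> \<subseteq> {u, v}" by (auto simp: edge_point_def)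
  finally have sub: "{w. p w \<noteq> 0} \<subseteq> {u, v}" .
  have p: "p \<in> polyhedron_of K" using assms(4) grid_subset by blast
  show ?thesis
  proof (cases "u = v")
    case True
    have "p = edge_point u u (real 0 / real n)" using edge_point_rep(2)[OF p sub True] by blast
    thus ?thesis using True by blast
  next
    case False
    have "p = edge_point u v (p v)" using edge_point_rep(1)[OF p sub False] .
    thus ?thesis using grid_coordinate[OF assms(4), of v] by metis
  qed
qed

lemma grid_separated:
  assumes "p \<in> grid" "q \<in> grid" "gdist p q < 1 / real n"
  shows "p = q"
proof -
  obtain u v i where p: "{u, v} \<in> K" "i \<le> n" "p = edge_point u v (real i / real n)"
    using assms(1) by (auto simp: grid_def)
  obtain j where j: "q = edge_point u v (real j / real n)"
    using near_grid_on_edge[OF p(1) _ _ assms(2)] assms(3) p ratio_bounds by blast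
  show ?thesis
  proof (cases "u = v")
    case True
    thus ?thesis using p j by (simp add: edge_point_same)
  next
    case False
    have "\<bar>real i / real n - real j / real n\<bar> < 1 / real n"
      using assms(3) gdist_edge[OF p(1) False] p(3) j by simp
    hence "real n * \<bar>real i / real n - real j / real n\<bar> < real n * (1 / real n)"
      using n_pos by (intro mult_strict_left_mono) auto
    hence "\<bar>real i - real j\<bar> < 1" using n_pos unfolding scaled_abs_diff by simp
    hence "i = j" by linarith
    thus ?thesis using p j by simp
  qed
qed

lemma tent_on_edge:
  assumes uv: "{u, v} \<in> K" "u \<noteq> v" and "i < n" "0 \<le> \<theta>" "\<theta> \<le> 1" and r: "r \<in> grid"
  defines "p \<equiv> edge_point u v (real i / real n)" and "q \<equiv> edge_point u v (real (Suc i) / real n)"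
  shows "tent r (edge_point u v ((real i + \<theta>) / real n)) = (1 - \<theta>) * of_bool (r = p) + \<theta> * of_bool (r = q)"
proof -
  let ?x = "edge_point u v ((real i + \<theta>) / real n)"
  have d: "real n * gdist ?x (edge_point u v (real j / real n)) = \<bar>real i + \<theta> - real j\<bar>" for j
    unfolding gdist_edge[OF uv] by (rule scaled_abs_diff)
  have inj: "edge_point u v (real j / real n) = edge_point u v (real k / real n) \<longleftrightarrow> j = k" for j k
    using edge_point_inject[OF uv(2)] n_pos by simp
  have b: "0 \<le> (real i + \<theta>) / real n" "(real i + \<theta>) / real n \<le> 1"
    using assms(3-5) by (auto simp: field_simps)
  show ?thesis
  proof (cases "\<exists>j\<le>n. r = edge_point u v (real j / real n)")
    case True
    then obtain j where j: "r = edge_point u v (real j / real n)" by blast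
    have t: "tent r ?x = max 0 (1 - \<bar>real i + \<theta> - real j\<bar>)" unfolding tent_def j d ..
    have rp: "r = p \<longleftrightarrow> j = i" and rq: "r = q \<longleftrightarrow> j = Suc i" unfolding j p_def q_def by (rule inj)+
    consider "j = i" | "j = Suc i" | "j < i" | "j > Suc i" by linarith
    thus ?thesis
    proof cases
      case 1
      thus ?thesis using assms(4,5) by (simp add: t rp rq)
    next
      case 2
      thus ?thesis using assms(4,5) by (simp add: t rp rq)
    next
      case 3
      hence "real j + 1 \<le> real i" by linarith
      thus ?thesis using 3 assms(4) by (simp add: t rp rq)
    next
      case 4
      hence "real i + 2 \<le> real j" by linarith
      thus ?thesis using 4 assms(5) by (simp add: t rp rq)
    qed
  next
    case False
    hence "\<not> gdist ?x r < 1 / real n" using near_grid_on_edge[OF uv(1) b r] by blast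
    hence "tent r ?x = 0" using n_pos by (simp add: tent_def field_simps)
    moreover have "r \<noteq> p" "r \<noteq> q" using False assms(3) unfolding p_def q_def
      by (metis less_imp_le) (metis False Suc_leI assms(3) q_def)
    ultimately show ?thesis by simp
  qed
qed

lemma adj_grid: "adj p q \<Longrightarrow> p \<in> grid \<and> q \<in> grid"
proof -
  assume "adj p q"
  then consider u where "{u} \<in> K" "p = edge_point u u 0" "q = p"
    | u v i where "{u, v} \<in> K" "i < n"
      "p = edge_point u v (real i / real n)" "q = edge_point u v (real (Suc i) / real n)"
    unfolding adj_def by blast
  thus ?thesis
  proof cases
    case 1
    have "edge_point u u (real 0 / real n) \<in> grid" unfolding grid_def
      using 1(1) by (intro CollectI exI[of _ u] exI[of _ 0]) simp
    thus ?thesis using 1 by simp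
  next
    case 2
    thus ?thesis unfolding grid_def by (metis (mono_tags, lifting) Suc_leI less_imp_le mem_Collect_eq)
  qed
qed

text \<open>
  The tents are the inverse of the barycentric parametrization; both inverse laws of the
  homeomorphism between the nerve and the graph rest on this formula.
\<close>

lemma adj_combination:
  assumes "adj p q" "0 \<le> \<theta>" "\<theta> \<le> 1"
  defines "x \<equiv> (\<lambda>w. (1 - \<theta>) * p w + \<theta> * q w)"
  shows "x \<in> polyhedron_of K" "\<And>r. r \<in> grid \<Longrightarrow> tent r x = (1 - \<theta>) * of_bool (r = p) + \<theta> * of_bool (r = q)"
proof -
  from assms(1) consider u where "{u} \<in> K" "p = edge_point u u 0" "q = p"
    | u v i where "u \<noteq> v" "{u, v} \<in> K" "i < n"
      "p = edge_point u v (real i / real n)" "q = edge_point u v (real (Suc i) / real n)"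
    unfolding adj_def by blast
  hence "x \<in> polyhedron_of K \<and> (\<forall>r\<in>grid. tent r x = (1 - \<theta>) * of_bool (r = p) + \<theta> * of_bool (r = q))"
  proof cases
    case 1
    have x: "x = p" using 1 by (auto simp: x_def algebra_simps)
    have p: "p \<in> grid" using adj_grid[OF assms(1)] by blast
    have "tent r x = of_bool (r = p)" if "r \<in> grid" for r
    proof (cases "r = p")
      case False
      hence "\<not> gdist p r < 1 / real n" using grid_separated[OF p that] by blast
      thus ?thesis using False n_pos by (simp add: tent_def x field_simps)
    qed (simp add: tent_def x gdist_self)
    moreover have "x \<in> polyhedron_of K" using x p grid_subset by blast
    ultimately show ?thesis using 1 by (auto simp: algebra_simps)
  next
    case 2
    have x: "x = edge_point u v ((real i + \<theta>) / real n)"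
      unfolding x_def 2(4,5) edge_point_def using n_pos by (auto simp: field_simps)
    have "real i + 1 \<le> real n" using 2(3) by linarith
    hence "x \<in> polyhedron_of K"
      unfolding x using assms(2,3) n_pos 2(2,3) by (intro edge_point_in) (auto simp: field_simps)
    thus ?thesis using tent_on_edge[OF 2(2,1,3) assms(2,3)] unfolding x 2(4,5) by blast
  qed
  thus "x \<in> polyhedron_of K" "\<And>r. r \<in> grid \<Longrightarrow> tent r x = (1 - \<theta>) * of_bool (r = p) + \<theta> * of_bool (r = q)"
    by blast+
qed

lemma adj_near:
  assumes "adj p q"
  shows "\<exists>m\<in>polyhedron_of K. gdist m p < 2 / (3 * real n) \<and> gdist m q < 2 / (3 * real n)"
proof -
  define m where "m = (\<lambda>w. (1 - 1/2) * p w + 1/2 * q w)"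
  have m: "m \<in> polyhedron_of K"
    "\<And>r. r \<in> grid \<Longrightarrow> tent r m = (1 - 1/2) * of_bool (r = p) + 1/2 * of_bool (r = q)"
    unfolding m_def by (rule adj_combination[OF assms]; simp)+
  have pq: "p \<in> grid" "q \<in> grid" using adj_grid[OF assms] by auto
  have "gdist m r < 2 / (3 * real n)" if "tent r m \<ge> 1/2" for r
  proof -
    have "real n * gdist m r \<le> 1/2" using that by (auto simp: tent_def max_def split: if_splits)
    hence "gdist m r \<le> 1 / (2 * real n)" using n_pos by (simp add: field_simps)
    also have "\<dots> < 2 / (3 * real n)" using n_pos by (simp add: field_simps)
    finally show ?thesis .
  qed
  moreover have "tent p m \<ge> 1/2" "tent q m \<ge> 1/2" using m(2) pq by auto
  ultimately show ?thesis using m(1) by blast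
qed

lemma floor_step:
  assumes "0 \<le> a" "a \<le> 1"
  obtains i \<theta> where "i < n" "0 \<le> \<theta>" "\<theta> \<le> 1" "a = (real i + \<theta>) / real n"
proof (cases "a = 1")
  case True
  have "a = (real (n - 1) + 1) / real n" using n_pos True by (simp add: of_nat_diff)
  thus thesis using that[of "n - 1" 1] n_pos by simp
next
  case False
  define i where "i = nat \<lfloor>real n * a\<rfloor>"
  have i: "real i = of_int \<lfloor>real n * a\<rfloor>" using assms by (simp add: i_def)
  have "real n * a < real n" using False assms n_pos by simp
  hence "real i < real n" unfolding i by linarith
  hence "i < n" by simp
  moreover have "0 \<le> real n * a - real i" "real n * a - real i \<le> 1" unfolding i by linarith+
  moreover have "a = (real i + (real n * a - real i)) / real n" using n_pos by simp
  ultimately show thesis using that by blast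
qed

lemma polyhedron_adj:
  assumes "x \<in> polyhedron_of K"
  obtains p q \<theta> where "adj p q" "0 \<le> \<theta>" "\<theta> \<le> 1" "x = (\<lambda>w. (1 - \<theta>) * p w + \<theta> * q w)"
proof -
  obtain u v a where x: "{u, v} \<in> K" "0 \<le> a" "a \<le> 1" "x = edge_point u v a" "{w. x w \<noteq> 0} = {u, v}"
    using polyhedron_edge[OF assms] .
  show thesis
  proof (cases "u = v")
    case True
    have "adj (edge_point u u 0) (edge_point u u 0)" unfolding adj_def using x(1) True by auto
    moreover have "x = (\<lambda>w. (1 - 0) * edge_point u u 0 w + 0 * edge_point u u 0 w)"
      using x(4) True by (simp add: edge_point_same)
    ultimately show ?thesis using that[of _ _ 0] by simp
  next
    case False
    obtain i \<theta> where i: "i < n" "0 \<le> \<theta>" "\<theta> \<le> 1" "a = (real i + \<theta>) / real n"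
      using floor_step[OF x(2,3)] .
    have "adj (edge_point u v (real i / real n)) (edge_point u v (real (Suc i) / real n))"
      unfolding adj_def using False x(1) i(1) by blast
    moreover have "x = (\<lambda>w. (1 - \<theta>) * edge_point u v (real i / real n) w + \<theta> * edge_point u v (real (Suc i) / real n) w)"
      unfolding x(4) i(4) edge_point_def using n_pos by (auto simp: field_simps)
    ultimately show ?thesis using that i(2,3) by blast
  qed
qed

text \<open>
  Grid points whose links have a common point \<open>t\<close> are on the edge of \<open>t\<close>, and less than
  \<open>4/(3 n)\<close> apart; so they are at most two, and neighbours.
\<close>

lemma face_adj:
  assumes "F \<subseteq> grid" "t \<in> polyhedron_of K" "\<And>p. p \<in> F \<Longrightarrow> gdist t p < 2 / (3 * real n)"
  obtains p q where "adj p q" "F \<subseteq> {p, q}"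
proof -
  obtain u v a where t: "{u, v} \<in> K" "0 \<le> a" "a \<le> 1" "t = edge_point u v a" "{w. t w \<noteq> 0} = {u, v}"
    using polyhedron_edge[OF assms(2)] .
  have lt: "2 / (3 * real n) < 1 / real n" using n_pos by (simp add: field_simps)
  have F: "\<exists>j\<le>n. p = edge_point u v (real j / real n)" if "p \<in> F" for p
    using near_grid_on_edge[OF t(1-3), of p] assms(1) assms(3)[OF that] lt that t(4) by force
  show thesis
  proof (cases "u = v")
    case True
    have "adj (edge_point u u 0) (edge_point u u 0)" unfolding adj_def using t(1) True by auto
    moreover have "F \<subseteq> {edge_point u u 0}" using F True by (auto simp: edge_point_same)
    ultimately show ?thesis using that by blast
  next
    case False
    obtain i \<theta> where i: "i < n" "0 \<le> \<theta>" "\<theta> \<le> 1" "a = (real i + \<theta>) / real n"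
      using floor_step[OF t(2,3)] .
    have near: "\<bar>real i + \<theta> - real j\<bar> < 2 / 3" if "edge_point u v (real j / real n) \<in> F" for j
    proof -
      have "\<bar>a - real j / real n\<bar> < 2 / (3 * real n)"
        using assms(3)[OF that] gdist_edge[OF t(1) False] t(4) by simp
      hence "real n * \<bar>a - real j / real n\<bar> < real n * (2 / (3 * real n))"
        using n_pos by (intro mult_strict_left_mono) auto
      moreover have "real n * \<bar>a - real j / real n\<bar> = \<bar>real i + \<theta> - real j\<bar>"
        unfolding i(4) by (rule scaled_abs_diff)
      ultimately show ?thesis using n_pos by simp
    qed
    have lohi: "i \<le> j \<and> j \<le> Suc i" if "edge_point u v (real j / real n) \<in> F" for j
      using near[OF that] i(2,3) by linarith
    have "F \<subseteq> {edge_point u v (real i / real n), edge_point u v (real (Suc i) / real n)}"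
    proof
      fix p assume p: "p \<in> F"
      then obtain j where j: "p = edge_point u v (real j / real n)" using F by blast
      with p lohi have "j = i \<or> j = Suc i" by (simp add: le_Suc_eq) force
      thus "p \<in> {edge_point u v (real i / real n), edge_point u v (real (Suc i) / real n)}" using j by blast
    qed
    moreover have "adj (edge_point u v (real i / real n)) (edge_point u v (real (Suc i) / real n))"
      unfolding adj_def using False t(1) i(1) by blast
    ultimately show ?thesis using that by blast
  qed
qed

end

section \<open>Covers whose nerve is a subdivided graph\<close>

context subdivided_graph
begin

text \<open>
  The links are preimages of shrunken open stars of grid points. The radius \<open>2/(3 n)\<close> exceeds \<open>1/(2 n)\<close>, so links
  of neighbours overlap, and is less than \<open>1/n\<close>, so even the closures of links of grid points at
  distance \<open>2/n\<close> are disjoint, as a free chain requires. Open stars would have radius \<open>1/n\<close> and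
  fail the second property.
\<close>

definition link :: "'a::metric_space set \<Rightarrow> ('a \<Rightarrow> nat \<Rightarrow> real) \<Rightarrow> (nat \<Rightarrow> real) \<Rightarrow> 'a set" where
  "link X g p = {x\<in>X. gdist (g x) p < 2 / (3 * real n)}"

text \<open>
  Closed sets that still cover, used where compactness of the pieces must be preserved.
\<close>

definition core :: "'a::metric_space set \<Rightarrow> ('a \<Rightarrow> nat \<Rightarrow> real) \<Rightarrow> (nat \<Rightarrow> real) \<Rightarrow> 'a set" where
  "core X g p = {x\<in>X. gdist (g x) p \<le> 1 / (2 * real n)}"

lemma radius_less: "2 / (3 * real n) < 1 / real n" "1 / (2 * real n) < 2 / (3 * real n)" "0 < 2 / (3 * real n)"
  using n_pos by (simp_all add: field_simps)

lemma continuous_gdist: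
  assumes "continuous_on X g"
  shows "continuous_on X (\<lambda>x. gdist (g x) p)"
proof -
  have "continuous_on X (\<lambda>x. g x v)" for v
    using assms by (rule continuous_on_product_then_coordinatewise)
  thus ?thesis unfolding gdist_def by (intro continuous_intros) auto
qed

lemma core_subset_link: "core X g p \<subseteq> link X g p"
  unfolding core_def link_def using radius_less(2) by auto

lemma closedin_core:
  assumes "continuous_on X g"
  shows "closedin (top_of_set X) (core X g p)"
proof -
  have "core X g p = X \<inter> (\<lambda>x. gdist (g x) p) -` {..1 / (2 * real n)}" by (auto simp: core_def)
  thus ?thesis using continuous_gdist[OF assms] by (simp add: continuous_closedin_preimage)
qed

lemma openin_link:
  assumes "continuous_on X g"
  shows "openin (top_of_set X) (link X g p)"
proof -
  have "link X g p = X \<inter> (\<lambda>x. gdist (g x) p) -` {..<2 / (3 * real n)}" by (auto simp: link_def)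
  thus ?thesis using continuous_gdist[OF assms] by (simp add: continuous_openin_preimage_gen)
qed

lemma closure_link:
  assumes "continuous_on X g" "closed X"
  shows "closure (link X g p) \<subseteq> {x\<in>X. gdist (g x) p \<le> 2 / (3 * real n)}"
proof (rule closure_minimal)
  show "link X g p \<subseteq> {x \<in> X. gdist (g x) p \<le> 2 / (3 * real n)}" by (auto simp: link_def)
  have "{x\<in>X. gdist (g x) p \<le> 2 / (3 * real n)} = X \<inter> (\<lambda>x. gdist (g x) p) -` {..2 / (3 * real n)}" by auto
  thus "closed {x \<in> X. gdist (g x) p \<le> 2 / (3 * real n)}"
    using continuous_closedin_preimage[OF continuous_gdist[OF assms(1)], of "{..2 / (3 * real n)}"] assms(2)
    by (simp add: closedin_closed_eq)
qed

lemma core_cover: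
  assumes "g ` X \<subseteq> polyhedron_of K"
  shows "X \<subseteq> (\<Union>p\<in>grid. core X g p)"
proof
  fix x assume x: "x \<in> X"
  hence "g x \<in> polyhedron_of K" using assms by blast
  then obtain p q \<theta> where pq: "adj p q" "0 \<le> \<theta>" "\<theta> \<le> 1" "g x = (\<lambda>w. (1 - \<theta>) * p w + \<theta> * q w)"
    by (rule polyhedron_adj)
  have gr: "p \<in> grid" "q \<in> grid" using adj_grid[OF pq(1)] by auto
  have t: "tent r (g x) = (1 - \<theta>) * of_bool (r = p) + \<theta> * of_bool (r = q)" if "r \<in> grid" for r
    unfolding pq(4) by (rule adj_combination(2)[OF pq(1-3) that])
  have *: "x \<in> core X g r" if "tent r (g x) \<ge> 1/2" for r
  proof -
    have "real n * gdist (g x) r \<le> 1/2" using that by (auto simp: tent_def max_def split: if_splits)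
    thus ?thesis using x n_pos by (simp add: core_def field_simps)
  qed
  have "tent p (g x) \<ge> 1/2 \<or> tent q (g x) \<ge> 1/2" using t[OF gr(1)] t[OF gr(2)] pq(2,3) by auto
  thus "x \<in> (\<Union>p\<in>grid. core X g p)" using * gr by blast
qed

lemma link_nonempty:
  assumes "g ` X = polyhedron_of K" "p \<in> grid"
  shows "link X g p \<noteq> {}"
proof -
  have "p \<in> g ` X" using assms grid_subset by blast
  then obtain x where "x \<in> X" "g x = p" by blast
  thus ?thesis using radius_less(3) by (auto simp: link_def gdist_self)
qed

lemma inj_on_link:
  assumes "g ` X = polyhedron_of K"
  shows "inj_on (link X g) grid"
proof (rule inj_onI)
  fix p q assume pq: "p \<in> grid" "q \<in> grid" "link X g p = link X g q"
  have "p \<in> g ` X" using assms pq grid_subset by blast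
  then obtain x where x: "x \<in> X" "g x = p" by blast
  hence "x \<in> link X g p" using radius_less(3) by (auto simp: link_def gdist_self)
  hence "x \<in> link X g q" using pq(3) by simp
  hence "gdist p q < 2 / (3 * real n)" using x(2) by (simp add: link_def)
  thus "p = q" using grid_separated pq radius_less(1) by (meson less_trans)
qed

text \<open>
  A simplex of the nerve has a point of \<open>X\<close> common to its links, and its image in the graph
  confines the simplex to a single edge of the subdivision.
\<close>

lemma polyhedron_nerve_links:
  assumes \<tau>: "\<tau> \<in> polyhedron_of (nerve (link X g ` grid))" and g: "g ` X = polyhedron_of K"
  obtains p q \<theta> where "adj p q" "0 \<le> \<theta>" "\<theta> \<le> 1"
    "\<tau> = (\<lambda>U. (1 - \<theta>) * of_bool (U = link X g p) + \<theta> * of_bool (U = link X g q))"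
proof -
  let ?V = "link X g"
  define S where "S = {U. \<tau> U \<noteq> 0}"
  have S: "S \<in> nerve (?V ` grid)" and nn: "\<And>U. 0 \<le> \<tau> U" and sum: "(\<Sum>U\<in>S. \<tau> U) = 1"
    using \<tau> unfolding polyhedron_of_def S_def by auto
  have sub: "S \<subseteq> ?V ` grid" and "S \<noteq> {}" using S unfolding nerve_def by auto
  have "\<Inter>S \<noteq> {}" using S link_nonempty[OF g] unfolding nerve_def by auto
  then obtain y where y: "\<And>U. U \<in> S \<Longrightarrow> y \<in> U" by blast
  have "y \<in> X" using y \<open>S \<noteq> {}\<close> sub by (auto simp: link_def)
  define F where "F = {p\<in>grid. ?V p \<in> S}"
  have SF: "S = ?V ` F" using sub by (auto simp: F_def)
  have "F \<subseteq> grid" by (auto simp: F_def)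
  moreover have "g y \<in> polyhedron_of K" using g \<open>y \<in> X\<close> by blast
  moreover have "gdist (g y) p < 2 / (3 * real n)" if "p \<in> F" for p
    using y[of "?V p"] that by (simp add: F_def link_def)
  ultimately obtain p q where pq: "adj p q" "F \<subseteq> {p, q}" by (rule face_adj)
  have gr: "p \<in> grid" "q \<in> grid" using adj_grid[OF pq(1)] by auto
  have z: "\<tau> U = 0" if "U \<noteq> ?V p" "U \<noteq> ?V q" for U
    using that SF pq(2) by (auto simp: S_def)
  have S2: "S \<subseteq> {?V p, ?V q}" using SF pq(2) by auto
  have one: "(\<Sum>U\<in>{?V p, ?V q}. \<tau> U) = 1"
    unfolding sum[symmetric] using S2 by (intro sum.mono_neutral_right) (auto simp: S_def)
  show thesis
  proof (cases "?V p = ?V q")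
    case True
    hence "\<tau> (?V p) = 1" using one by simp
    hence "\<tau> = (\<lambda>U. (1 - 0) * of_bool (U = ?V p) + 0 * of_bool (U = ?V q))"
      using z True by (auto simp: fun_eq_iff)
    with that[OF pq(1), of 0] show thesis by simp
  next
    case False
    hence 1: "\<tau> (?V p) = 1 - \<tau> (?V q)" using one by simp
    hence "\<tau> = (\<lambda>U. (1 - \<tau> (?V q)) * of_bool (U = ?V p) + \<tau> (?V q) * of_bool (U = ?V q))"
      using z False by (auto simp: fun_eq_iff)
    moreover have "\<tau> (?V q) \<le> 1" using 1 nn[of "?V p"] by simp
    ultimately show thesis using that[OF pq(1) nn] by blast
  qed
qed

text \<open>
  In one direction a point of the nerve is mapped to the barycentre of the grid points with its
  coordinates as weights; in the other, a point of the graph is mapped to its tent values. On every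
  edge of the subdivision these maps are inverse to each other.
\<close>

lemma nerve_links_homeomorphic:
  assumes "continuous_on X g" and g: "g ` X = polyhedron_of K"
  shows "polyhedron_of (nerve (link X g ` grid)) homeomorphic polyhedron_of K"
proof -
  let ?V = "link X g"
  let ?N = "polyhedron_of (nerve (?V ` grid))"
  define h where "h \<tau> = (\<lambda>w. \<Sum>p\<in>grid. \<tau> (?V p) * p w)" for \<tau> :: "'a set \<Rightarrow> real"
  define k where "k x = (\<lambda>U. \<Sum>p\<in>grid. of_bool (U = ?V p) * tent p x)" for x
  define \<zeta> where "\<zeta> p q \<theta> = (\<lambda>U. (1 - \<theta>) * of_bool (U = ?V p) + \<theta> * of_bool (U = ?V q))"
    for p q and \<theta> :: real
  define \<xi> where "\<xi> p q \<theta> = (\<lambda>w. (1 - \<theta>) * p w + \<theta> * q w)"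
    for p q :: "nat \<Rightarrow> real" and \<theta> :: real
  have V_eq: "?V p = ?V r \<longleftrightarrow> p = r" if "p \<in> grid" "r \<in> grid" for p r
    using inj_on_link[OF g] that by (auto simp: inj_on_def)
  have sel: "(\<Sum>r\<in>grid. c * of_bool (r = p) * b r) = c * b p" if "p \<in> grid"
    for p and c :: real and b :: "_ \<Rightarrow> real"
  proof -
    have "(\<Sum>r\<in>grid. c * of_bool (r = p) * b r) = (\<Sum>r\<in>{p}. c * of_bool (r = p) * b r)"
      using that finite_grid by (intro sum.mono_neutral_right) auto
    thus ?thesis by simp
  qed
  have h\<zeta>: "h (\<zeta> p q \<theta>) = \<xi> p q \<theta>" if "adj p q" for p q \<theta>
  proof
    fix w
    have gr: "p \<in> grid" "q \<in> grid" using adj_grid[OF that] by auto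
    have "h (\<zeta> p q \<theta>) w = (\<Sum>r\<in>grid. (1 - \<theta>) * of_bool (r = p) * r w + \<theta> * of_bool (r = q) * r w)"
      unfolding h_def \<zeta>_def using gr V_eq by (intro sum.cong) (auto simp: distrib_right)
    also have "\<dots> = \<xi> p q \<theta> w" unfolding sum.distrib sel[OF gr(1)] sel[OF gr(2)] \<xi>_def ..
    finally show "h (\<zeta> p q \<theta>) w = \<xi> p q \<theta> w" .
  qed
  have k\<xi>: "k (\<xi> p q \<theta>) = \<zeta> p q \<theta>" if "adj p q" "0 \<le> \<theta>" "\<theta> \<le> 1" for p q \<theta>
  proof
    fix U
    have gr: "p \<in> grid" "q \<in> grid" using adj_grid[OF that(1)] by auto
    have "k (\<xi> p q \<theta>) U = (\<Sum>r\<in>grid. (1 - \<theta>) * of_bool (r = p) * of_bool (U = ?V r)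
        + \<theta> * of_bool (r = q) * of_bool (U = ?V r))"
      unfolding k_def \<xi>_def using adj_combination(2)[OF that] by (intro sum.cong) (auto simp: algebra_simps)
    also have "\<dots> = \<zeta> p q \<theta> U" unfolding sum.distrib sel[OF gr(1)] sel[OF gr(2)] \<zeta>_def ..
    finally show "k (\<xi> p q \<theta>) U = \<zeta> p q \<theta> U" .
  qed
  have \<xi>_in: "\<xi> p q \<theta> \<in> polyhedron_of K" if "adj p q" "0 \<le> \<theta>" "\<theta> \<le> 1" for p q \<theta>
    unfolding \<xi>_def by (rule adj_combination(1)[OF that])
  have \<zeta>_in: "\<zeta> p q \<theta> \<in> ?N" if "adj p q" "0 \<le> \<theta>" "\<theta> \<le> 1" for p q \<theta>
  proof -
    have gr: "p \<in> grid" "q \<in> grid" using adj_grid[OF that(1)] by auto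
    from adj_near[OF that(1)]
    obtain m where "m \<in> polyhedron_of K" "gdist m p < 2 / (3 * real n)" "gdist m q < 2 / (3 * real n)"
      by blast
    moreover from this g obtain y where "y \<in> X" "g y = m" by (metis imageE)
    ultimately have y: "y \<in> ?V p" "y \<in> ?V q" by (auto simp: link_def)
    have sub: "{U. \<zeta> p q \<theta> U \<noteq> 0} \<subseteq> {?V p, ?V q}" by (auto simp: \<zeta>_def)
    have one: "(\<Sum>U\<in>{?V p, ?V q}. \<zeta> p q \<theta> U) = 1"
      by (cases "?V p = ?V q") (auto simp: \<zeta>_def)
    have s: "(\<Sum>U | \<zeta> p q \<theta> U \<noteq> 0. \<zeta> p q \<theta> U) = 1"
      unfolding one[symmetric] using sub by (intro sum.mono_neutral_left) auto
    hence "{U. \<zeta> p q \<theta> U \<noteq> 0} \<noteq> {}" by (metis sum.empty zero_neq_one)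
    moreover have "y \<in> \<Inter>{U. \<zeta> p q \<theta> U \<noteq> 0}" using sub y by blast
    moreover have "{U. \<zeta> p q \<theta> U \<noteq> 0} \<subseteq> ?V ` grid" using sub gr by blast
    ultimately have "{U. \<zeta> p q \<theta> U \<noteq> 0} \<in> nerve (?V ` grid)" unfolding nerve_def by blast
    moreover have "0 \<le> \<zeta> p q \<theta> U" for U using that by (simp add: \<zeta>_def)
    ultimately show ?thesis using s unfolding polyhedron_of_def by blast
  qed
  have "homeomorphism ?N (polyhedron_of K) h k"
  proof (rule homeomorphismI)
    show "continuous_on ?N h"
      unfolding h_def
      by (intro continuous_on_coordinatewise_then_product continuous_on_sum continuous_on_mult_right)
         (rule continuous_on_product_then_coordinatewise, rule continuous_on_id)
    show "continuous_on (polyhedron_of K) k"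
      unfolding k_def tent_def
      by (intro continuous_on_coordinatewise_then_product continuous_on_sum continuous_on_mult_left
           continuous_on_max continuous_on_const continuous_on_diff continuous_gdist[where g="\<lambda>x. x"] continuous_on_id)
    show "h ` ?N \<subseteq> polyhedron_of K"
    proof (rule image_subsetI)
      fix \<tau> assume "\<tau> \<in> ?N"
      then obtain p q \<theta> where "adj p q" "0 \<le> \<theta>" "\<theta> \<le> 1" "\<tau> = \<zeta> p q \<theta>"
        unfolding \<zeta>_def by (rule polyhedron_nerve_links[OF _ g])
      thus "h \<tau> \<in> polyhedron_of K" using h\<zeta> \<xi>_in by simp
    qed
    show "k ` polyhedron_of K \<subseteq> ?N"
    proof (rule image_subsetI)
      fix x assume "x \<in> polyhedron_of K"
      then obtain p q \<theta> where "adj p q" "0 \<le> \<theta>" "\<theta> \<le> 1" "x = \<xi> p q \<theta>"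
        unfolding \<xi>_def by (rule polyhedron_adj)
      thus "k x \<in> ?N" using k\<xi> \<zeta>_in by simp
    qed
    show "k (h \<tau>) = \<tau>" if "\<tau> \<in> ?N" for \<tau>
    proof -
      from that obtain p q \<theta> where "adj p q" "0 \<le> \<theta>" "\<theta> \<le> 1" "\<tau> = \<zeta> p q \<theta>"
        unfolding \<zeta>_def by (rule polyhedron_nerve_links[OF _ g])
      thus ?thesis using h\<zeta> k\<xi> by simp
    qed
    show "h (k x) = x" if "x \<in> polyhedron_of K" for x
    proof -
      from that obtain p q \<theta> where "adj p q" "0 \<le> \<theta>" "\<theta> \<le> 1" "x = \<xi> p q \<theta>"
        unfolding \<xi>_def by (rule polyhedron_adj)
      thus ?thesis using h\<zeta> k\<xi> by simp
    qed
  qed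
  thus ?thesis unfolding homeomorphic_def by blast
qed

section \<open>The free chains of a subdivided graph\<close>

text \<open>
  The chain of an edge has its \<open>n + 1\<close> grid points, the chain of a vertex only one. The nodes are
  numbered from \<open>1\<close>, as the links of a chain are.
\<close>

definition chain_length :: "nat set \<Rightarrow> nat" where
  "chain_length s = (if Min s = Max s then 1 else n + 1)"

definition node :: "nat set \<Rightarrow> nat \<Rightarrow> nat \<Rightarrow> real" where
  "node s i = edge_point (Min s) (Max s) (real (i - 1) / real n)"

lemma simplex_Min_Max:
  assumes "s \<in> K"
  shows "s = {Min s, Max s}"
proof -
  obtain u v where "s = {u, v}" using simplex_pair[OF assms] .
  thus ?thesis by (auto simp: min_def max_def)
qed

lemma node_in_grid:
  assumes "s \<in> K" "i \<le> chain_length s"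
  shows "node s i \<in> grid"
proof -
  have "i - 1 \<le> n" using assms(2) by (simp add: chain_length_def split: if_splits)
  moreover have "{Min s, Max s} \<in> K" using assms(1) simplex_Min_Max by metis
  ultimately show ?thesis unfolding grid_def node_def by blast
qed

lemma grid_on_chain:
  assumes "p \<in> grid"
  shows "\<exists>s\<in>K. \<exists>i\<in>{1..chain_length s}. p = node s i"
proof -
  obtain u v i where p: "{u, v} \<in> K" "i \<le> n" "p = edge_point u v (real i / real n)"
    using assms by (auto simp: grid_def)
  define s where "s = {u, v}"
  have fl: "1 - real i / real n = real (n - i) / real n"
    using p(2) n_pos by (simp add: of_nat_diff field_simps)
  consider "u = v" | "u < v" | "v < u" by linarith
  hence "\<exists>j\<in>{1..chain_length s}. p = node s j"
  proof cases
    case 1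
    thus ?thesis using p by (intro bexI[of _ 1]) (simp_all add: s_def node_def edge_point_same chain_length_def)
  next
    case 2
    thus ?thesis using p by (intro bexI[of _ "Suc i"]) (simp_all add: s_def node_def chain_length_def)
  next
    case 3
    have "p = edge_point v u (real (n - i) / real n)" unfolding p(3) edge_point_flip[of u v] fl ..
    thus ?thesis using 3 p by (intro bexI[of _ "Suc (n - i)"]) (simp_all add: s_def node_def chain_length_def)
  qed
  thus ?thesis using p(1) by (auto simp: s_def)
qed

lemma common_point_indices:
  assumes "{u, v} \<in> K" "u \<noteq> v"
    and "gdist t (edge_point u v (real i / real n)) \<le> 2 / (3 * real n)"
    and "gdist t (edge_point u v (real j / real n)) \<le> 2 / (3 * real n)"
  shows "\<bar>int i - int j\<bar> \<le> 1"
proof -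
  have "\<bar>real i / real n - real j / real n\<bar> \<le> 2 / (3 * real n) + 2 / (3 * real n)"
    using gdist_triangle[of "edge_point u v (real i / real n)" "edge_point u v (real j / real n)" t]
      assms(3,4) gdist_edge[OF assms(1,2)] by (simp add: gdist_commute)
  hence "real n * \<bar>real i / real n - real j / real n\<bar> \<le> real n * (2 / (3 * real n) + 2 / (3 * real n))"
    using n_pos by (intro mult_left_mono) auto
  hence "\<bar>real i - real j\<bar> \<le> 4 / 3" using n_pos unfolding scaled_abs_diff by (simp add: distrib_left)
  thus ?thesis by linarith
qed

text \<open>
  An interior grid point of an edge has both end points in its support, so everything near it is
  on the same edge. This is the freeness of the chain of the edge, and the reason why it is
  required for interior links only.
\<close>

lemma near_interior_node:
  assumes "{u, v} \<in> K" "u \<noteq> v" "0 < i" "i < n" "t \<in> polyhedron_of K" "q \<in> grid"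
    and "gdist t (edge_point u v (real i / real n)) \<le> 2 / (3 * real n)" "gdist t q \<le> 2 / (3 * real n)"
  shows "\<exists>j\<le>n. \<bar>int i - int j\<bar> \<le> 1 \<and> q = edge_point u v (real j / real n)"
proof -
  let ?p = "edge_point u v (real i / real n)"
  have p: "?p \<in> grid" unfolding grid_def using assms(1,4) by (metis (mono_tags, lifting) less_imp_le mem_Collect_eq)
  have "{w. ?p w \<noteq> 0} \<subseteq> {w. t w \<noteq> 0}"
    using assms(5,7) p radius_less(1) by (intro near_grid_support) auto
  moreover have "{u, v} \<subseteq> {w. ?p w \<noteq> 0}" using assms(2-4) by (auto simp: edge_point_def)
  ultimately have sub: "{u, v} \<subseteq> {w. t w \<noteq> 0}" by blast
  have tK: "{w. t w \<noteq> 0} \<in> K" using assms(5) by (simp add: polyhedron_of_def)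
  have "{u, v} = {w. t w \<noteq> 0}"
    using dim[OF tK] assms(2) by (intro card_seteq sub finite_simplex[OF tK]) auto
  hence t: "t = edge_point u v (t v)" using edge_point_rep(1)[OF assms(5) _ assms(2)] by simp
  have "gdist (edge_point u v (t v)) q < 1 / real n" using assms(8) radius_less(1) t by simp
  then obtain j where j: "j \<le> n" "q = edge_point u v (real j / real n)"
    using near_grid_on_edge[OF assms(1) polyhedron_bounds[OF assms(5)] assms(6)] by blast
  have "\<bar>int i - int j\<bar> \<le> 1"
    using common_point_indices[OF assms(1,2,7)] assms(8) j(2) by simp
  with j show ?thesis by blast
qed

lemma free_chain_links:
  assumes cont: "continuous_on X g" and g: "g ` X = polyhedron_of K" and "closed X" and s: "s \<in> K"
  shows "free_chain_in (link X g ` grid) (chain_length s) (\<lambda>i. link X g (node s i))"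
proof -
  let ?V = "link X g"
  define u v where "u = Min s" and "v = Max s"
  have uv: "{u, v} \<in> K" using s simplex_Min_Max unfolding u_def v_def by metis
  have sub: "(\<lambda>i. ?V (node s i)) ` {1..chain_length s} \<subseteq> ?V ` grid"
    using node_in_grid[OF s] by auto
  have cl: "\<exists>t\<in>polyhedron_of K. gdist t p \<le> 2 / (3 * real n) \<and> gdist t q \<le> 2 / (3 * real n)"
    if "closure (?V p) \<inter> closure (?V q) \<noteq> {}" for p q
  proof -
    from that closure_link[OF cont assms(3)] obtain x where
      "x \<in> X" "gdist (g x) p \<le> 2 / (3 * real n)" "gdist (g x) q \<le> 2 / (3 * real n)" by blast
    thus ?thesis using g by blast
  qed
  show ?thesis
  proof (cases "u = v")
    case True
    hence "chain_length s = 1" by (simp add: chain_length_def u_def v_def)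
    thus ?thesis using sub by (auto simp: free_chain_in_def chain_in_def)
  next
    case False
    have len: "chain_length s = n + 1" using False by (simp add: chain_length_def u_def v_def)
    have node: "node s i = edge_point u v (real (i - 1) / real n)" for i
      by (simp add: node_def u_def v_def)
    have inj: "inj_on (\<lambda>i. ?V (node s i)) {1..n+1}"
    proof (rule inj_onI)
      fix i j assume ij: "i \<in> {1..n+1}" "j \<in> {1..n+1}" "?V (node s i) = ?V (node s j)"
      hence "node s i = node s j" using inj_on_link[OF g] node_in_grid[OF s] len by (auto simp: inj_on_def)
      hence "i - 1 = j - 1" using edge_point_inject[OF False] n_pos by (simp add: node)
      thus "i = j" using ij by auto
    qed
    have meet: "?V (node s i) \<inter> ?V (node s (i + 1)) \<noteq> {}" if i: "1 \<le> i" "i < n + 1" for i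
    proof -
      have "adj (node s i) (node s (i + 1))"
        unfolding adj_def node using False uv i
        by (intro disjI2 exI[of _ u] exI[of _ v] exI[of _ "i - 1"]) simp
      then obtain m where m: "m \<in> polyhedron_of K" "gdist m (node s i) < 2 / (3 * real n)"
        "gdist m (node s (i + 1)) < 2 / (3 * real n)" using adj_near by blast
      from m(1) g obtain y where "y \<in> X" "g y = m" by (metis imageE)
      with m show ?thesis by (auto simp: link_def)
    qed
    have close: "\<bar>int i - int j\<bar> \<le> 1"
      if "i \<in> {1..n+1}" "j \<in> {1..n+1}" "closure (?V (node s i)) \<inter> closure (?V (node s j)) \<noteq> {}" for i j
    proof -
      from cl[OF that(3)]
      obtain t where "gdist t (node s i) \<le> 2 / (3 * real n)" "gdist t (node s j) \<le> 2 / (3 * real n)"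
        by blast
      hence "\<bar>int (i - 1) - int (j - 1)\<bar> \<le> 1" using common_point_indices[OF uv False] by (simp add: node)
      thus ?thesis using that(1,2) by auto
    qed
    have free: "D \<in> {?V (node s (i - 1)), ?V (node s i), ?V (node s (i + 1))}"
      if i: "1 < i" "i < n + 1" and D: "D \<in> ?V ` grid" "closure D \<inter> closure (?V (node s i)) \<noteq> {}" for i D
    proof -
      obtain q where q: "q \<in> grid" "D = ?V q" using D(1) by blast
      obtain t where t: "t \<in> polyhedron_of K" "gdist t q \<le> 2 / (3 * real n)"
        "gdist t (node s i) \<le> 2 / (3 * real n)" using cl D(2) q(2) by blast
      have "0 < i - 1" "i - 1 < n" using i by auto
      from near_interior_node[OF uv False this t(1) q(1) t(3)[unfolded node] t(2)]
      obtain j where j: "\<bar>int (i - 1) - int j\<bar> \<le> 1" "q = edge_point u v (real j / real n)" by blast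
      have "q = node s (Suc j)" using j(2) by (simp add: node)
      moreover have "Suc j = i - 1 \<or> Suc j = i \<or> Suc j = i + 1" using j(1) i by linarith
      ultimately show ?thesis using q(2) by auto
    qed
    show ?thesis
      unfolding free_chain_in_def chain_in_def len
    proof (intro conjI allI impI ballI)
      show "(\<lambda>i. ?V (node s i)) ` {1..n+1} \<subseteq> ?V ` grid" using sub unfolding len .
    qed (use inj meet close free in auto)
  qed
qed

end

section \<open>Fine covers made of free chains\<close>

lemma diameter_le_bound:
  fixes S :: "'a::metric_space set"
  assumes "\<And>x y. x \<in> S \<Longrightarrow> y \<in> S \<Longrightarrow> dist x y \<le> d" "0 \<le> d"
  shows "diameter S \<le> d"
  unfolding diameter_def using assms by (auto intro!: cSUP_least)

lemma mesh_less:
  assumes "finite \<U>" "\<U> \<noteq> {}" "0 \<le> d" "d < e"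
    and "\<And>U x y. U \<in> \<U> \<Longrightarrow> x \<in> U \<Longrightarrow> y \<in> U \<Longrightarrow> dist x y \<le> d"
  shows "mesh \<U> < e"
proof -
  have "mesh \<U> \<in> diameter ` \<U>" unfolding mesh_def using assms(1,2) by (intro Max_in) auto
  then obtain U where "U \<in> \<U>" "mesh \<U> = diameter U" by blast
  thus ?thesis using diameter_le_bound[of U d] assms(3-5) by force
qed

lemma homeomorphism_funpow:
  assumes "homeomorphism X X f g"
  shows "homeomorphism X X (f ^^ n) (g ^^ n)"
proof (induction n)
  case 0
  show ?case by (simp add: homeomorphism_def)
next
  case (Suc n)
  have "homeomorphism X X (f \<circ> f ^^ n) (g ^^ n \<circ> g)" by (rule homeomorphism_compose[OF Suc assms])
  thus ?case by (simp add: funpow_Suc_right flip: funpow_swap1) (simp add: comp_def funpow_swap1)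
qed

text \<open>
  A cover \<open>U\<close> of mesh less than \<open>\<eta>\<close> that consists of the chains indexed by \<open>K\<close>, together with a
  closed shrinking \<open>W\<close>. The clause about \<open>\<phi>\<close> records that all images of the cover under
  homeomorphisms of \<open>X\<close> have the same combinatorics: the iterate by which the cover is moved is
  found only after the cover has been fixed.
\<close>

definition fine_chain_cover ::
    "'b::metric_space set \<Rightarrow> 'a::metric_space set \<Rightarrow> 'k set \<Rightarrow> real \<Rightarrow> 'p set \<Rightarrow> ('p \<Rightarrow> 'a set) \<Rightarrow>
     ('p \<Rightarrow> 'a set) \<Rightarrow> ('k \<Rightarrow> nat \<Rightarrow> 'p) \<Rightarrow> ('k \<Rightarrow> nat) \<Rightarrow> bool" where
  "fine_chain_cover G X K \<eta> P U W node len \<longleftrightarrow>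
    finite P \<and> X \<subseteq> (\<Union>p\<in>P. W p) \<and>
    (\<forall>p\<in>P. closedin (top_of_set X) (W p) \<and> W p \<subseteq> U p \<and> U p \<subseteq> X) \<and>
    (\<forall>p\<in>P. \<forall>x\<in>U p. \<forall>y\<in>U p. dist x y < \<eta>) \<and>
    (\<forall>p\<in>P. \<exists>s\<in>K. \<exists>i\<in>{1..len s}. p = node s i) \<and>
    (\<forall>\<phi> \<psi>. homeomorphism X X \<phi> \<psi> \<longrightarrow>
       open_cover X ((\<lambda>p. \<phi> ` U p) ` P) \<and>
       polyhedron_of (nerve ((\<lambda>p. \<phi> ` U p) ` P)) homeomorphic G \<and>
       (\<forall>s\<in>K. free_chain_in ((\<lambda>p. \<phi> ` U p) ` P) (len s) (\<lambda>i. \<phi> ` U (node s i))))"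

text \<open>
  The number of chains depends on the graph only, while the mesh is arbitrarily small: refining
  the subdivision lengthens the chains. That the links are small follows from a map onto the graph
  with small fibres, since by compactness such a map also has small preimages of small sets. The
  image of the cover under \<open>\<phi>\<close> is the cover defined by the map composed with the inverse of
  \<open>\<phi>\<close>, so its properties need no separate proof.
\<close>

lemma exists_fine_chain_cover:
  fixes G :: "'b::metric_space set" and X :: "'a::metric_space set"
  assumes "is_graph G" and X: "compact X" and "G_like G X"
  shows "\<exists>K :: nat set set. finite K \<and>
    (\<forall>\<eta>>0. \<exists>(P :: (nat \<Rightarrow> real) set) U W node len. fine_chain_cover G X K \<eta> P U W node len)"
proof -
  from assms(1) obtain K :: "nat set set" where K: "abstract_complex K" "\<And>s. s \<in> K \<Longrightarrow> card s \<le> 2"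
    and GK: "G homeomorphic polyhedron_of K" unfolding is_graph_def by blast
  obtain a b where ab: "homeomorphism G (polyhedron_of K) a b"
    using GK unfolding homeomorphic_def by blast
  interpret one: subdivided_graph K 1 by standard (use K in auto)
  let ?D = one.gdist
  show ?thesis
  proof (intro exI[of _ K] conjI allI impI)
    show "finite K" by (rule one.finite_complex)
    fix \<eta> :: real assume \<eta>: "\<eta> > 0"
    then obtain g0 where g0: "continuous_on X g0" "g0 ` X = G"
      "\<And>y. y \<in> G \<Longrightarrow> diameter {x\<in>X. g0 x = y} < \<eta>"
      using assms(3) unfolding G_like_def by blast
    define g where "g = a \<circ> g0"
    have gc: "continuous_on X g"
      unfolding g_def using g0(1,2) ab by (intro continuous_on_compose) (auto simp: homeomorphism_def)
    have gX: "g ` X = polyhedron_of K"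
      unfolding g_def image_comp[symmetric] g0(2) using ab by (simp add: homeomorphism_def)
    have fibre: "dist x y < \<eta>" if "x \<in> X" "y \<in> X" "g x = g y" for x y
    proof -
      have "g0 x = g0 y"
        using that g0(2) ab unfolding g_def homeomorphism_def by (metis comp_apply imageI)
      moreover have "bounded {z\<in>X. g0 z = g0 y}"
        using compact_imp_bounded[OF X] by (rule bounded_subset) auto
      ultimately have "dist x y \<le> diameter {z\<in>X. g0 z = g0 y}"
        using that by (intro diameter_bounded_bound) auto
      thus ?thesis using g0(3)[of "g0 y"] g0(2) that(2) by force
    qed
    have "\<exists>\<delta>>0. \<forall>x\<in>X. \<forall>y\<in>X. ?D (g x) (g y) < \<delta> \<longrightarrow> dist x y < \<eta>"
    proof -
      define S where "S = {z\<in>X \<times> X. \<eta> \<le> dist (fst z) (snd z)}"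
      have "S = (X \<times> X) \<inter> {z. \<eta> \<le> dist (fst z) (snd z)}" by (auto simp: S_def)
      moreover have "closed {z :: 'a \<times> 'a. \<eta> \<le> dist (fst z) (snd z)}"
        by (intro closed_Collect_le continuous_intros)
      ultimately have cS: "compact S" using X by (simp add: compact_Int_closed compact_Times)
      have gv: "continuous_on X (\<lambda>x. g x v)" for v
        using gc by (rule continuous_on_product_then_coordinatewise)
      have "continuous_on S (\<lambda>z. ?D (g (fst z)) (g (snd z)))"
        unfolding one.gdist_def
        by (intro continuous_intros continuous_on_compose2[OF gv]) (auto simp: S_def)
      show ?thesis
      proof (cases "S = {}")
        case True
        hence "\<forall>x\<in>X. \<forall>y\<in>X. dist x y < \<eta>" by (force simp: S_def not_le)
        thus ?thesis by (intro exI[of _ 1]) auto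
      next
        case False
        then obtain z where z: "z \<in> S" "\<And>z'. z' \<in> S \<Longrightarrow> ?D (g (fst z)) (g (snd z)) \<le> ?D (g (fst z')) (g (snd z'))"
          using continuous_attains_inf[OF cS False \<open>continuous_on S _\<close>] by blast
        define \<delta> where "\<delta> = ?D (g (fst z)) (g (snd z))"
        have "\<delta> \<noteq> 0"
        proof
          assume "\<delta> = 0"
          moreover have "fst z \<in> X" "snd z \<in> X" using z(1) by (auto simp: S_def)
          ultimately have "dist (fst z) (snd z) < \<eta>"
            using one.gdist_eq_0[of "g (fst z)" "g (snd z)"] gX by (intro fibre) (auto simp: \<delta>_def)
          thus False using z(1) by (simp add: S_def)
        qed
        hence "\<delta> > 0" using one.gdist_nonneg[of "g (fst z)" "g (snd z)"] by (simp add: \<delta>_def)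
        moreover have "dist x y < \<eta>" if "x \<in> X" "y \<in> X" "?D (g x) (g y) < \<delta>" for x y
          using z(2)[of "(x, y)"] that by (force simp: S_def \<delta>_def)
        ultimately show ?thesis by blast
      qed
    qed
    then obtain \<delta> where \<delta>: "\<delta> > 0" "\<And>x y. x \<in> X \<Longrightarrow> y \<in> X \<Longrightarrow> ?D (g x) (g y) < \<delta> \<Longrightarrow> dist x y < \<eta>"
      by blast
    obtain n :: nat where "real n > max 1 (4 / (3 * \<delta>))" using reals_Archimedean2 by blast
    hence n: "n > 0" "4 / (3 * real n) < \<delta>" using \<delta>(1) by (auto simp: field_simps)
    interpret subdivided_graph K n by standard (use K n in auto)
    have "fine_chain_cover G X K \<eta> grid (link X g) (core X g) node chain_length"
      unfolding fine_chain_cover_def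
    proof (intro conjI allI impI ballI)
      show "finite grid" by (rule finite_grid)
      show "closedin (top_of_set X) (core X g p)" for p by (rule closedin_core[OF gc])
      show "core X g p \<subseteq> link X g p" for p by (rule core_subset_link)
      show "link X g p \<subseteq> X" for p by (auto simp: link_def)
      show "dist x y < \<eta>" if "x \<in> link X g p" "y \<in> link X g p" for p x y
      proof -
        have "gdist (g x) (g y) \<le> gdist (g x) p + gdist (g y) p"
          using gdist_triangle[of "g x" "g y" p] by (simp add: gdist_commute)
        also have "\<dots> < 2 / (3 * real n) + 2 / (3 * real n)"
          using that by (intro add_strict_mono) (auto simp: link_def)
        also have "\<dots> = 4 / (3 * real n)" by simp
        finally show ?thesis using n(2) that by (intro \<delta>(2)) (auto simp: link_def)
      qed
      show "X \<subseteq> (\<Union>p\<in>grid. core X g p)" using gX by (intro core_cover) simp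
      show "\<exists>s\<in>K. \<exists>i\<in>{1..chain_length s}. p = node s i" if "p \<in> grid" for p
        by (rule grid_on_chain[OF that])
      fix \<phi> \<psi> assume \<phi>: "homeomorphism X X \<phi> \<psi>"
      define g' where "g' = g \<circ> \<psi>"
      have img: "\<phi> ` link X g p = link X g' p" for p
      proof
        show "\<phi> ` link X g p \<subseteq> link X g' p"
          using \<phi> unfolding homeomorphism_def link_def g'_def by fastforce
        show "link X g' p \<subseteq> \<phi> ` link X g p"
        proof
          fix y assume y: "y \<in> link X g' p"
          hence "\<psi> y \<in> link X g p" "\<phi> (\<psi> y) = y"
            using \<phi> unfolding homeomorphism_def link_def g'_def by auto
          thus "y \<in> \<phi> ` link X g p" by (metis imageI)
        qed
      qed
      have g'c: "continuous_on X g'"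
        unfolding g'_def using \<phi> gc by (intro continuous_on_compose) (auto simp: homeomorphism_def)
      have g'X: "g' ` X = polyhedron_of K"
        unfolding g'_def image_comp[symmetric] using \<phi> gX by (simp add: homeomorphism_def)
      have links: "(\<lambda>p. \<phi> ` link X g p) = link X g'" using img by blast
      have "X \<subseteq> (\<Union>p\<in>grid. core X g' p)" using g'X by (intro core_cover) simp
      moreover have "core X g' p \<subseteq> link X g' p" "link X g' p \<subseteq> X" for p
        by (rule core_subset_link) (auto simp: link_def)
      ultimately have "\<Union>(link X g' ` grid) = X" by blast
      thus "open_cover X ((\<lambda>p. \<phi> ` link X g p) ` grid)"
        unfolding links open_cover_def using openin_link[OF g'c] by blast
      show "polyhedron_of (nerve ((\<lambda>p. \<phi> ` link X g p) ` grid)) homeomorphic G"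
        unfolding links
        using homeomorphic_trans[OF nerve_links_homeomorphic[OF g'c g'X]] GK homeomorphic_sym by blast
      show "free_chain_in ((\<lambda>p. \<phi> ` link X g p) ` grid) (chain_length s) (\<lambda>i. \<phi> ` link X g (node s i))"
        if "s \<in> K" for s
        unfolding links img by (rule free_chain_links[OF g'c g'X compact_imp_closed[OF X] that])
    qed
    thus "\<exists>(P :: (nat \<Rightarrow> real) set) U W node len. fine_chain_cover G X K \<eta> P U W node len" by blast
  qed
qed

section \<open>Families traced by free chains\<close>

text \<open>
  The free chain is required to contain the whole sets \<open>A s\<close> in its links, not only points of them.
  The property then survives every later shrinking of the family.
\<close>

definition traced ::
    "'b::metric_space set \<Rightarrow> 'a::metric_space set \<Rightarrow> real \<Rightarrow> ('s \<Rightarrow> 'a set) \<Rightarrow> 's list \<Rightarrow> bool" where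
  "traced G X \<epsilon> A xs \<longleftrightarrow> (\<exists>\<U> n C j. finite \<U> \<and> open_cover X \<U> \<and> mesh \<U> < \<epsilon> \<and>
     polyhedron_of (nerve \<U>) homeomorphic G \<and> free_chain_in \<U> n C \<and>
     strict_mono_on {..<length xs} j \<and> (\<forall>i<length xs. j i \<in> {1..n} \<and> A (xs ! i) \<subseteq> C (j i)))"

lemma traced_mono:
  assumes "traced G X \<epsilon> A xs" "\<And>s. s \<in> set xs \<Longrightarrow> A' s \<subseteq> A s"
  shows "traced G X \<epsilon> A' xs"
  using assms unfolding traced_def by (meson nth_mem order.trans)

lemma densely_indep_nonempty:
  assumes "densely_indep X f A S" "finite S" "s \<in> S" "f ` X \<subseteq> X"
  shows "A s \<noteq> {}"
  using densely_indep_cover1[of "{}" X f A S s "\<lambda>_. {}"] assms by auto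

lemma compact_separated:
  fixes A B :: "'a::metric_space set"
  assumes "compact A" "compact B" "A \<inter> B = {}"
  shows "\<exists>d>0. \<forall>x\<in>A. \<forall>y\<in>B. d \<le> dist x y"
proof (cases "A \<times> B = {}")
  case True
  thus ?thesis by (intro exI[of _ 1]) auto
next
  case False
  have "continuous_on (A \<times> B) (\<lambda>z. dist (fst z) (snd z))" by (intro continuous_intros)
  from continuous_attains_inf[OF compact_Times[OF assms(1,2)] False this]
  obtain z where z: "z \<in> A \<times> B" "\<And>y. y \<in> A \<times> B \<Longrightarrow> dist (fst z) (snd z) \<le> dist (fst y) (snd y)" by blast
  have "0 < dist (fst z) (snd z)" using z(1) assms(3) by auto
  moreover have "\<forall>x\<in>A. \<forall>y\<in>B. dist (fst z) (snd z) \<le> dist x y" using z(2) by force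
  ultimately show ?thesis by blast
qed

lemma compact_family_separated:
  fixes A :: "'s \<Rightarrow> 'a::metric_space set"
  assumes "finite S" "\<And>s. s \<in> S \<Longrightarrow> compact (A s)"
    and "\<And>s t. s \<in> S \<Longrightarrow> t \<in> S \<Longrightarrow> s \<noteq> t \<Longrightarrow> A s \<inter> A t = {}"
  shows "\<exists>e>0. \<forall>s\<in>S. \<forall>t\<in>S. s \<noteq> t \<longrightarrow> (\<forall>x\<in>A s. \<forall>y\<in>A t. e \<le> dist x y)"
proof -
  have "\<forall>\<^sub>F e in at_right 0. \<forall>s\<in>S. \<forall>t\<in>S. s \<noteq> t \<longrightarrow> (\<forall>x\<in>A s. \<forall>y\<in>A t. e \<le> dist x y)"
  proof (intro eventually_ball_finite[OF assms(1)] ballI)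
    fix s t assume st: "s \<in> S" "t \<in> S"
    show "\<forall>\<^sub>F e in at_right 0. s \<noteq> t \<longrightarrow> (\<forall>x\<in>A s. \<forall>y\<in>A t. e \<le> dist x y)"
    proof (cases "s = t")
      case False
      then obtain d where d: "d > 0" "\<And>x y. x \<in> A s \<Longrightarrow> y \<in> A t \<Longrightarrow> d \<le> dist x y"
        using compact_separated[of "A s" "A t"] assms st by blast
      have "\<forall>\<^sub>F e in at_right (0::real). e < d" using d(1) by (rule order_tendstoD[OF tendsto_ident_at])
      thus ?thesis by eventually_elim (use d(2) in fastforce)
    qed simp
  qed
  from eventually_happens[OF eventually_conj[OF this eventually_at_right_less]]
  show ?thesis by (auto simp: trivial_limit_at_right_real)
qed

lemma iterates_equicontinuous:
  fixes X :: "'a::metric_space set"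
  assumes "compact X" "finite F" "\<And>h. h \<in> F \<Longrightarrow> continuous_on X (f ^^ h)" "\<epsilon> > 0"
  shows "\<exists>\<eta>>0. \<forall>h\<in>F. \<forall>x\<in>X. \<forall>y\<in>X. dist x y < \<eta> \<longrightarrow> dist ((f ^^ h) x) ((f ^^ h) y) < \<epsilon>"
proof -
  have "\<forall>\<^sub>F \<eta> in at_right 0. \<forall>h\<in>F. \<forall>x\<in>X. \<forall>y\<in>X. dist x y < \<eta> \<longrightarrow> dist ((f ^^ h) x) ((f ^^ h) y) < \<epsilon>"
  proof (intro eventually_ball_finite[OF assms(2)] ballI)
    fix h assume "h \<in> F"
    hence "uniformly_continuous_on X (f ^^ h)"
      using assms by (intro compact_uniformly_continuous) auto
    then obtain d where d: "d > 0" "\<And>x y. x \<in> X \<Longrightarrow> y \<in> X \<Longrightarrow> dist x y < d \<Longrightarrow> dist ((f ^^ h) x) ((f ^^ h) y) < \<epsilon>"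
      using assms(4) unfolding uniformly_continuous_on_def by metis
    have "\<forall>\<^sub>F e in at_right (0::real). e < d" using d(1) by (rule order_tendstoD[OF tendsto_ident_at])
    thus "\<forall>\<^sub>F \<eta> in at_right 0. \<forall>x\<in>X. \<forall>y\<in>X. dist x y < \<eta> \<longrightarrow> dist ((f ^^ h) x) ((f ^^ h) y) < \<epsilon>"
      by eventually_elim (use d(2) in fastforce)
  qed
  from eventually_happens[OF eventually_conj[OF this eventually_at_right_less]]
  show ?thesis by (auto simp: trivial_limit_at_right_real)
qed

lemma compact_visiting_set:
  fixes X :: "'a::metric_space set"
  assumes "compact X" "finite F" "\<And>h. h \<in> F \<Longrightarrow> continuous_on X (f ^^ h)" "\<And>h. h \<in> F \<Longrightarrow> closed (B h)"
  shows "compact {x\<in>X. \<forall>h\<in>F. (f ^^ h) x \<in> B h}"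
proof (cases "F = {}")
  case False
  have "closedin (top_of_set X) (X \<inter> (f ^^ h) -` B h)" if "h \<in> F" for h
    using assms(3,4)[OF that] by (rule continuous_closedin_preimage)
  hence "closedin (top_of_set X) (\<Inter>h\<in>F. X \<inter> (f ^^ h) -` B h)"
    using False by (intro closedin_INT) auto
  moreover have "(\<Inter>h\<in>F. X \<inter> (f ^^ h) -` B h) = {x\<in>X. \<forall>h\<in>F. (f ^^ h) x \<in> B h}" using False by auto
  ultimately show ?thesis using closedin_compact[OF assms(1)] by metis
qed (use assms(1) in simp)

text \<open>
  Pass to words over \<open>S\<close> of length \<open>r\<close> (block lemma) and take a cover so fine that its
  images under the iterates at the \<open>r\<close> times are still finer than the distances between the sets
  \<open>A s\<close>. Cut the set of each word down to one element of the cover (splitting). Since the number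
  of chains is independent of \<open>r\<close>, one chain meets so many of the \<open>N^r\<close> words that, in the order of its links, the pattern
  \<open>xs\<close> must occur as the sequence of entries at some time \<open>h\<close>. The image of the cover under the
  \<open>h\<close>-th iterate of \<open>f\<close> then traces the images of the selected pieces, which lie in the sets
  \<open>A s\<close>.
\<close>

lemma exists_traced_subfamily:
  fixes G :: "'b::metric_space set" and X :: "'a::metric_space set" and A :: "'s \<Rightarrow> 'a set"
  assumes G: "is_graph G" "G_like G X" and X: "compact X" "X \<noteq> {}" and f: "homeomorphism X X f f'"
    and A: "densely_indep X f A S" "\<And>s. s \<in> S \<Longrightarrow> compact (A s)"
      "\<And>s t. s \<in> S \<Longrightarrow> t \<in> S \<Longrightarrow> s \<noteq> t \<Longrightarrow> A s \<inter> A t = {}"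
    and \<epsilon>: "\<epsilon> > 0" and xs: "distinct xs" "set xs = S" "S \<noteq> {}"
  shows "\<exists>A'. (\<forall>s\<in>S. A' s \<subseteq> A s \<and> compact (A' s)) \<and> densely_indep X f A' S \<and> traced G X \<epsilon> A' xs"
proof -
  have finS: "finite S" using xs(2) by auto
  have fX: "f ` X \<subseteq> X" using f by (simp add: homeomorphism_def)
  have fh: "homeomorphism X X (f ^^ h) (f' ^^ h)" for h using f by (rule homeomorphism_funpow)
  have fc: "continuous_on X (f ^^ h)" for h using fh by (simp add: homeomorphism_def)
  obtain N where N: "length xs = Suc N" using xs(2,3) by (cases xs) auto
  have cardS: "card S = Suc N" using xs(1,2) N distinct_card by metis
  obtain \<delta> where \<delta>: "\<delta> > 0" "\<And>s t x y. s \<in> S \<Longrightarrow> t \<in> S \<Longrightarrow> s \<noteq> t \<Longrightarrow> x \<in> A s \<Longrightarrow> y \<in> A t \<Longrightarrow> \<delta> \<le> dist x y"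
    using compact_family_separated[of S A, OF finS A(2,3)] by blast
  \<comment> \<open>Below \<open>\<delta>\<close> no link meets two members of the family, so distinct members of the
    pattern are in distinct links.\<close>
  define \<epsilon>' where "\<epsilon>' = min (\<epsilon> / 2) \<delta>"
  have \<epsilon>': "\<epsilon>' > 0" "\<epsilon>' < \<epsilon>" "\<epsilon>' \<le> \<delta>" using \<epsilon> \<delta>(1) by (auto simp: \<epsilon>'_def)
  obtain K :: "nat set set" where finK: "finite K" and cover:
    "\<And>\<eta>. \<eta> > 0 \<Longrightarrow> \<exists>(P :: (nat \<Rightarrow> real) set) U W node len. fine_chain_cover G X K \<eta> P U W node len"
    using exists_fine_chain_cover[OF G(1) X(1) G(2)] by blast
  obtain L where L: "\<And>r. r \<ge> L \<Longrightarrow> card K * ((r * N + 1) * N ^ r) < Suc N ^ r"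
    using eventually_polynomial_times_power_less[of "card K" N] unfolding eventually_sequentially by blast
  define B where "B F \<omega> = {x\<in>X. \<forall>h\<in>F. (f ^^ h) x \<in> A (\<omega> h)}" for F \<omega>
  obtain F where F: "finite F" "L \<le> card F" "densely_indep X f (B F) (Pi\<^sub>E F (\<lambda>_. S))"
    using densely_indep_block[OF A(1) xs(3) fX, of L] unfolding B_def by blast
  define \<Omega> where "\<Omega> = Pi\<^sub>E F (\<lambda>_. S)"
  have fin\<Omega>: "finite \<Omega>" using F(1) finS by (simp add: \<Omega>_def finite_PiE)
  have card\<Omega>: "card \<Omega> = Suc N ^ card F" using F(1) cardS by (simp add: \<Omega>_def card_PiE)
  obtain \<eta> where \<eta>: "\<eta> > 0" "\<And>h x y. h \<in> F \<Longrightarrow> x \<in> X \<Longrightarrow> y \<in> X \<Longrightarrow> dist x y < \<eta> \<Longrightarrow>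
      dist ((f ^^ h) x) ((f ^^ h) y) < \<epsilon>'"
    using iterates_equicontinuous[OF X(1) F(1) fc \<epsilon>'(1)] by blast
  obtain P :: "(nat \<Rightarrow> real) set" and U W node len where
    fine: "fine_chain_cover G X K \<eta> P U W node len" using cover[OF \<eta>(1)] by blast
  have P: "finite P" and XW: "X \<subseteq> (\<Union>p\<in>P. W p)"
    and W: "\<And>p. p \<in> P \<Longrightarrow> closedin (top_of_set X) (W p)" "\<And>p. p \<in> P \<Longrightarrow> W p \<subseteq> U p"
    and U: "\<And>p. p \<in> P \<Longrightarrow> U p \<subseteq> X" "\<And>p x y. p \<in> P \<Longrightarrow> x \<in> U p \<Longrightarrow> y \<in> U p \<Longrightarrow> dist x y < \<eta>"
    and chains: "\<And>p. p \<in> P \<Longrightarrow> \<exists>s\<in>K. \<exists>i\<in>{1..len s}. p = node s i"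
    using fine unfolding fine_chain_cover_def by simp_all
  have hom: "\<And>\<phi> \<psi>. homeomorphism X X \<phi> \<psi> \<Longrightarrow>
       open_cover X ((\<lambda>p. \<phi> ` U p) ` P) \<and>
       polyhedron_of (nerve ((\<lambda>p. \<phi> ` U p) ` P)) homeomorphic G \<and>
       (\<forall>s\<in>K. free_chain_in ((\<lambda>p. \<phi> ` U p) ` P) (len s) (\<lambda>i. \<phi> ` U (node s i)))"
    using fine unfolding fine_chain_cover_def by blast
  have "\<exists>p. (\<forall>\<omega>\<in>\<Omega>. p \<omega> \<in> P) \<and> densely_indep X f (\<lambda>\<omega>. B F \<omega> \<inter> W (p \<omega>)) \<Omega>"
  proof (rule densely_indep_cover)
    show "densely_indep X f (B F) \<Omega>" unfolding \<Omega>_def by (rule F(3))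
    show "B F \<omega> \<subseteq> (\<Union>q\<in>P. W q)" for \<omega> using XW by (auto simp: B_def)
  qed (use fin\<Omega> P fX in auto)
  then obtain p where p: "\<And>\<omega>. \<omega> \<in> \<Omega> \<Longrightarrow> p \<omega> \<in> P"
    and di: "densely_indep X f (\<lambda>\<omega>. B F \<omega> \<inter> W (p \<omega>)) \<Omega>" by blast
  obtain \<sigma> pos where \<sigma>: "\<And>\<omega>. \<omega> \<in> \<Omega> \<Longrightarrow> \<sigma> \<omega> \<in> K"
    "\<And>\<omega>. \<omega> \<in> \<Omega> \<Longrightarrow> pos \<omega> \<in> {1..len (\<sigma> \<omega>)}"
    "\<And>\<omega>. \<omega> \<in> \<Omega> \<Longrightarrow> p \<omega> = node (\<sigma> \<omega>) (pos \<omega>)"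
  proof -
    have "\<forall>\<omega>\<in>\<Omega>. \<exists>t. fst t \<in> K \<and> snd t \<in> {1..len (fst t)} \<and> p \<omega> = node (fst t) (snd t)"
      using chains p by fastforce
    then obtain t where "\<forall>\<omega>\<in>\<Omega>. fst (t \<omega>) \<in> K \<and> snd (t \<omega>) \<in> {1..len (fst (t \<omega>))} \<and>
        p \<omega> = node (fst (t \<omega>)) (snd (t \<omega>))" by (rule bchoice[THEN exE])
    with that[of "\<lambda>\<omega>. fst (t \<omega>)" "\<lambda>\<omega>. snd (t \<omega>)"] show thesis by blast
  qed
  have "\<exists>s\<in>K. (card F * N + 1) * N ^ card F < card {\<omega>\<in>\<Omega>. \<sigma> \<omega> = s}"
  proof (rule ccontr)
    assume "\<not> ?thesis"
    hence le: "card {\<omega>\<in>\<Omega>. \<sigma> \<omega> = s} \<le> (card F * N + 1) * N ^ card F" if "s \<in> K" for s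
      using that by (meson not_le)
    have "\<Omega> = (\<Union>s\<in>K. {\<omega>\<in>\<Omega>. \<sigma> \<omega> = s})" using \<sigma>(1) by auto
    hence "card \<Omega> \<le> (\<Sum>s\<in>K. card {\<omega>\<in>\<Omega>. \<sigma> \<omega> = s})" using card_UN_le[OF finK, of "\<lambda>s. {\<omega>\<in>\<Omega>. \<sigma> \<omega> = s}"] by simp
    also have "\<dots> \<le> (\<Sum>s\<in>K. (card F * N + 1) * N ^ card F)" by (rule sum_mono) (rule le)
    also have "\<dots> = card K * ((card F * N + 1) * N ^ card F)" by simp
    also have "\<dots> < Suc N ^ card F" by (rule L[OF F(2)])
    finally show False using card\<Omega> by simp
  qed
  then obtain s0 where s0: "s0 \<in> K" "(card F * N + 1) * N ^ card F < card {\<omega>\<in>\<Omega>. \<sigma> \<omega> = s0}" by blast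
  define T where "T = {\<omega>\<in>\<Omega>. \<sigma> \<omega> = s0}"
  have "\<exists>h\<in>F. \<exists>w. (\<forall>i<length xs. w i \<in> T \<and> w i h = xs ! i) \<and>
    (\<forall>i j. i < j \<and> j < length xs \<longrightarrow> pos (w i) \<le> pos (w j))"
    by (rule exists_ordered_pattern) (use F(1) xs s0(2) N in \<open>auto simp: T_def \<Omega>_def\<close>)
  then obtain h w where h: "h \<in> F" and w: "\<And>i. i < length xs \<Longrightarrow> w i \<in> T"
    "\<And>i. i < length xs \<Longrightarrow> w i h = xs ! i"
    "\<And>i j. i < j \<Longrightarrow> j < length xs \<Longrightarrow> pos (w i) \<le> pos (w j)" by blast
  have w\<Omega>: "w i \<in> \<Omega>" "\<sigma> (w i) = s0" if "i < length xs" for i using w(1)[OF that] by (auto simp: T_def)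
  have "\<forall>s\<in>S. \<exists>i<length xs. xs ! i = s" using xs(2) by (auto simp: in_set_conv_nth)
  then obtain idx where idx: "\<And>s. s \<in> S \<Longrightarrow> idx s < length xs" "\<And>s. s \<in> S \<Longrightarrow> xs ! idx s = s" by metis
  have idx_nth: "idx (xs ! i) = i" if "i < length xs" for i
    using idx[of "xs ! i"] xs(1,2) that nth_eq_iff_index_eq by (metis nth_mem)
  define A' where "A' s = (f ^^ h) ` (B F (w (idx s)) \<inter> W (p (w (idx s))))" for s
  have sub: "A' s \<subseteq> A s" if s: "s \<in> S" for s
    using w(2)[OF idx(1)[OF s]] idx(2)[OF s] h by (auto simp: A'_def B_def)
  have cmp: "compact (A' s)" if s: "s \<in> S" for s
  proof -
    have \<omega>: "w (idx s) \<in> \<Omega>" using w\<Omega> idx(1)[OF s] by blast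
    hence "w (idx s) k \<in> S" if "k \<in> F" for k using that by (auto simp: \<Omega>_def)
    hence "compact (B F (w (idx s)))"
      unfolding B_def using X(1) F(1) fc A(2) by (intro compact_visiting_set compact_imp_closed) auto
    moreover have "compact (W (p (w (idx s))))"
      using closedin_compact[OF X(1) W(1)[OF p[OF \<omega>]]] .
    ultimately have "compact (B F (w (idx s)) \<inter> W (p (w (idx s))))" by (simp add: compact_Int)
    thus ?thesis unfolding A'_def
      by (intro compact_continuous_image continuous_on_subset[OF fc]) (auto simp: B_def)
  qed
  have di': "densely_indep X f A' S"
  proof (rule densely_indep_transfer[OF di fX])
    fix s assume s: "s \<in> S"
    show "\<exists>r\<in>\<Omega>. (f ^^ h) ` (X \<inter> (B F r \<inter> W (p r))) \<subseteq> A' s"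
      by (rule bexI[of _ "w (idx s)"]) (use w\<Omega> idx(1)[OF s] in \<open>auto simp: A'_def\<close>)
  qed
  define \<U> where "\<U> = (\<lambda>p. (f ^^ h) ` U p) ` P"
  define C where "C i = (f ^^ h) ` U (node s0 i)" for i
  define j where "j i = pos (w i)" for i
  have small: "dist x y < \<epsilon>'" if "V \<in> \<U>" "x \<in> V" "y \<in> V" for V x y
  proof -
    from that obtain q x' y' where q: "q \<in> P" "x' \<in> U q" "y' \<in> U q" "x = (f ^^ h) x'" "y = (f ^^ h) y'"
      by (auto simp: \<U>_def)
    thus ?thesis using \<eta>(2)[OF h, of x' y'] U by blast
  qed
  have AC: "A' (xs ! i) \<subseteq> C (j i)" if i: "i < length xs" for i
  proof -
    have "p (w i) = node s0 (j i)" using \<sigma>(3)[OF w\<Omega>(1)[OF i]] w\<Omega>(2)[OF i] by (simp add: j_def)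
    thus ?thesis using W(2)[OF p[OF w\<Omega>(1)[OF i]]] by (auto simp: A'_def C_def idx_nth[OF i])
  qed
  have CU: "C (j i) \<in> \<U>" if i: "i < length xs" for i
  proof -
    have "p (w i) = node s0 (j i)" using \<sigma>(3)[OF w\<Omega>(1)[OF i]] w\<Omega>(2)[OF i] by (simp add: j_def)
    thus ?thesis using p[OF w\<Omega>(1)[OF i]] unfolding C_def \<U>_def by (metis imageI)
  qed
  have "traced G X \<epsilon> A' xs"
    unfolding traced_def
  proof (intro exI[of _ \<U>] exI[of _ "len s0"] exI[of _ C] exI[of _ j] conjI allI impI)
    show "finite \<U>" using P by (simp add: \<U>_def)
    show "open_cover X \<U>" "polyhedron_of (nerve \<U>) homeomorphic G" "free_chain_in \<U> (len s0) C"
      using hom[OF fh[of h]] s0(1) unfolding \<U>_def C_def by blast+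
    show "mesh \<U> < \<epsilon>"
    proof (rule mesh_less[of _ \<epsilon>'])
      show "finite \<U>" using P by (simp add: \<U>_def)
      show "\<U> \<noteq> {}" using XW X(2) by (auto simp: \<U>_def)
      show "0 \<le> \<epsilon>'" "\<epsilon>' < \<epsilon>" using \<epsilon>' by auto
      show "dist x y \<le> \<epsilon>'" if "V \<in> \<U>" "x \<in> V" "y \<in> V" for V x y using small[OF that] by simp
    qed
    show "j i \<in> {1..len s0}" if "i < length xs" for i
      using \<sigma>(2)[OF w\<Omega>(1)[OF that]] w\<Omega>(2)[OF that] by (simp add: j_def)
    show "A' (xs ! i) \<subseteq> C (j i)" if "i < length xs" for i by (rule AC[OF that])
    show "strict_mono_on {..<length xs} j"
    proof (rule strict_mono_onI)
      fix i k assume ik: "i \<in> {..<length xs}" "k \<in> {..<length xs}" "i < k"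
      have ne: "A' (xs ! i) \<noteq> {}" if "i < length xs" for i
        using densely_indep_nonempty[OF di' finS _ fX] that xs(2) by auto
      obtain x y where x: "x \<in> A' (xs ! i)" "y \<in> A' (xs ! k)" using ne ik by fastforce
      have "j i \<noteq> j k"
      proof
        assume eq: "j i = j k"
        have "x \<in> C (j i)" "y \<in> C (j i)" using x AC[of i] AC[of k] ik eq by auto
        hence "dist x y < \<epsilon>'" using small CU[of i] ik by blast
        moreover have "\<delta> \<le> dist x y"
        proof (rule \<delta>(2))
          show "xs ! i \<in> S" "xs ! k \<in> S" using ik xs(2) by auto
          show "xs ! i \<noteq> xs ! k" using ik xs(1) by (simp add: nth_eq_iff_index_eq)
          show "x \<in> A (xs ! i)" "y \<in> A (xs ! k)" using x sub ik xs(2) by (auto simp: subset_iff)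
        qed
        ultimately show False using \<epsilon>'(3) by linarith
      qed
      moreover have "j i \<le> j k" using w(3)[of i k] ik by (simp add: j_def)
      ultimately show "j i < j k" by simp
    qed
  qed
  with sub cmp di' show ?thesis by blast
qed

lemma exists_all_traced_subfamily:
  fixes G :: "'b::metric_space set" and X :: "'a::metric_space set" and A :: "'s \<Rightarrow> 'a set"
  assumes G: "is_graph G" "G_like G X" and X: "compact X" "X \<noteq> {}" and f: "homeomorphism X X f f'"
    and A: "densely_indep X f A S" "\<And>s. s \<in> S \<Longrightarrow> compact (A s)"
      "\<And>s t. s \<in> S \<Longrightarrow> t \<in> S \<Longrightarrow> s \<noteq> t \<Longrightarrow> A s \<inter> A t = {}"
    and \<epsilon>: "\<epsilon> > 0" and S: "finite S" "S \<noteq> {}"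
  shows "\<exists>A'. (\<forall>s\<in>S. A' s \<subseteq> A s \<and> compact (A' s)) \<and> densely_indep X f A' S \<and>
    (\<forall>xs. distinct xs \<and> set xs = S \<longrightarrow> traced G X \<epsilon> A' xs)"
proof -
  have "\<exists>A'. (\<forall>s\<in>S. A' s \<subseteq> A s \<and> compact (A' s)) \<and> densely_indep X f A' S \<and>
    (\<forall>xs\<in>Q. traced G X \<epsilon> A' xs)" if "finite Q" "Q \<subseteq> {xs. distinct xs \<and> set xs = S}" for Q
    using that
  proof (induction Q rule: finite_induct)
    case empty
    thus ?case using A(1,2) by (intro exI[of _ A]) auto
  next
    case (insert ys Q)
    have "Q \<subseteq> {xs. distinct xs \<and> set xs = S}" using insert.prems by blast
    from insert.IH[OF this] obtain A1 where A1: "\<And>s. s \<in> S \<Longrightarrow> A1 s \<subseteq> A s" "\<And>s. s \<in> S \<Longrightarrow> compact (A1 s)"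
      "densely_indep X f A1 S" "\<And>xs. xs \<in> Q \<Longrightarrow> traced G X \<epsilon> A1 xs" by blast
    have ys: "distinct ys" "set ys = S" using insert.prems by auto
    have dj: "A1 s \<inter> A1 t = {}" if "s \<in> S" "t \<in> S" "s \<noteq> t" for s t
      using A1(1)[OF that(1)] A1(1)[OF that(2)] A(3)[OF that] by blast
    obtain A2 where A2: "\<And>s. s \<in> S \<Longrightarrow> A2 s \<subseteq> A1 s" "\<And>s. s \<in> S \<Longrightarrow> compact (A2 s)"
      "densely_indep X f A2 S" "traced G X \<epsilon> A2 ys"
      using exists_traced_subfamily[OF G X f A1(3,2) dj \<epsilon> ys S(2)] by blast
    have "traced G X \<epsilon> A2 xs" if "xs \<in> Q" for xs
      using A1(4)[OF that] by (rule traced_mono) (use A2(1) that insert.prems in auto)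
    with A1(1) A2 show ?case by (intro exI[of _ A2]) blast
  qed
  moreover have "finite {xs. distinct xs \<and> set xs = S}"
    by (rule finite_subset[OF _ finite_subset_distinct[OF S(1)]]) auto
  ultimately show ?thesis by (metis (mono_tags, lifting) mem_Collect_eq order_refl)
qed

text \<open>
  The set of an index \<open>c\<close> consists of points in \<open>A (par c)\<close> whose later itinerary is prescribed:
  each of the finitely many maps \<open>\<phi>\<close> is given its own time in \<open>F\<close>, and at this time the point is
  in \<open>A (\<phi> c)\<close>. Disjointness comes for free, since some \<open>\<phi>\<close> sends two given indices to different
  members of the old family.
\<close>

lemma exists_branching_subfamily:
  fixes X :: "'a::metric_space set" and A :: "'s \<Rightarrow> 'a set" and S' :: "'t set"
  assumes X: "compact X" and f: "homeomorphism X X f f'"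
    and A: "densely_indep X f A S" "\<And>s. s \<in> S \<Longrightarrow> compact (A s)"
      "\<And>s t. s \<in> S \<Longrightarrow> t \<in> S \<Longrightarrow> s \<noteq> t \<Longrightarrow> A s \<inter> A t = {}"
    and S: "finite S" "s1 \<in> S" "s2 \<in> S" "s1 \<noteq> s2" and S': "finite S'" and par: "\<And>c. c \<in> S' \<Longrightarrow> par c \<in> S"
  shows "\<exists>A'. (\<forall>c\<in>S'. A' c \<subseteq> A (par c) \<and> compact (A' c)) \<and>
    (\<forall>c\<in>S'. \<forall>c'\<in>S'. c \<noteq> c' \<longrightarrow> A' c \<inter> A' c' = {}) \<and> densely_indep X f A' S' \<and>
    (\<forall>\<phi>. \<phi> ` S' \<subseteq> S \<longrightarrow> (\<exists>h\<ge>n. \<forall>c\<in>S'. (f ^^ h) ` A' c \<subseteq> A (\<phi> c)))"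
proof -
  have fX: "f ` X \<subseteq> X" using f by (simp add: homeomorphism_def)
  have fc: "continuous_on X (f ^^ h)" for h using homeomorphism_funpow[OF f] by (simp add: homeomorphism_def)
  define \<Phi> where "\<Phi> = Pi\<^sub>E S' (\<lambda>_. S)"
  have fin\<Phi>: "finite \<Phi>" using S' S(1) by (simp add: \<Phi>_def finite_PiE)
  define B where "B F \<omega> = {x\<in>X. \<forall>h\<in>F. (f ^^ h) x \<in> A (\<omega> h)}" for F \<omega>
  obtain F where F: "finite F" "n + 1 + card \<Phi> \<le> card F" "densely_indep X f (B F) (Pi\<^sub>E F (\<lambda>_. S))"
    using densely_indep_block[OF A(1) _ fX, of "n + 1 + card \<Phi>"] S(2) unfolding B_def by blast
  have "F \<noteq> {}" using F(2) by auto
  define h0 where "h0 = Min F"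
  have h0: "h0 \<in> F" "\<And>h. h \<in> F \<Longrightarrow> h0 \<le> h" using F(1) \<open>F \<noteq> {}\<close> by (auto simp: h0_def)
  define F1 where "F1 = {h\<in>F. h0 + n \<le> h \<and> h \<noteq> h0}"
  have "F \<subseteq> F1 \<union> {h0..h0+n}" using h0(2) by (auto simp: F1_def)
  hence "card F \<le> card (F1 \<union> {h0..h0+n})" using F(1) by (intro card_mono) (auto simp: F1_def)
  also have "\<dots> \<le> card F1 + card {h0..h0+n}" by (rule card_Un_le)
  finally have "card \<Phi> \<le> card F1" using F(2) by simp
  moreover have "finite F1" using F(1) by (simp add: F1_def)
  ultimately obtain \<iota> where \<iota>: "\<iota> ` \<Phi> \<subseteq> F1" "inj_on \<iota> \<Phi>" using card_le_inj[OF fin\<Phi>] by blast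
  define \<omega> where "\<omega> c = restrict (\<lambda>h. if h \<in> \<iota> ` \<Phi> then inv_into \<Phi> \<iota> h c else par c) F" for c
  have \<omega>: "\<omega> c \<in> Pi\<^sub>E F (\<lambda>_. S)" if c: "c \<in> S'" for c
  proof -
    have "inv_into \<Phi> \<iota> h c \<in> S" if "h \<in> \<iota> ` \<Phi>" for h
      using inv_into_into[OF that] c by (auto simp: \<Phi>_def)
    thus ?thesis using par[OF c] by (auto simp: \<omega>_def)
  qed
  have h0\<iota>: "h0 \<notin> \<iota> ` \<Phi>" using \<iota>(1) by (auto simp: F1_def)
  define A' where "A' c = (f ^^ h0) ` B F (\<omega> c)" for c
  have sub: "A' c \<subseteq> A (par c)" for c
    using h0(1) h0\<iota> by (auto simp: A'_def B_def \<omega>_def)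
  have cmp: "compact (A' c)" if c: "c \<in> S'" for c
  proof -
    have "\<omega> c k \<in> S" if "k \<in> F" for k using \<omega>[OF c] that by auto
    hence "compact (B F (\<omega> c))"
      unfolding B_def using X F(1) fc A(2) by (intro compact_visiting_set compact_imp_closed) auto
    thus ?thesis unfolding A'_def
      by (intro compact_continuous_image continuous_on_subset[OF fc]) (auto simp: B_def)
  qed
  have visit: "\<exists>h\<ge>n. \<forall>c\<in>S'. (f ^^ h) ` A' c \<subseteq> A (\<phi> c)" if \<phi>: "\<phi> ` S' \<subseteq> S" for \<phi>
  proof -
    define \<phi>' where "\<phi>' = restrict \<phi> S'"
    have \<phi>': "\<phi>' \<in> \<Phi>" using \<phi> by (auto simp: \<phi>'_def \<Phi>_def)
    define h where "h = \<iota> \<phi>'"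
    have h: "h \<in> F" "h0 + n \<le> h" "h \<in> \<iota> ` \<Phi>" using \<phi>' \<iota>(1) by (auto simp: h_def F1_def)
    have "(f ^^ (h - h0)) ` A' c \<subseteq> A (\<phi> c)" if c: "c \<in> S'" for c
    proof -
      have "\<omega> c h = \<phi> c" using h c \<iota>(2) \<phi>' by (simp add: \<omega>_def h_def \<phi>'_def)
      moreover have "(f ^^ (h - h0)) ((f ^^ h0) x) = (f ^^ h) x" for x
        using h(2) by (simp flip: funpow_add[THEN fun_cong, unfolded comp_apply])
      ultimately show ?thesis using h(1) by (auto simp: A'_def B_def)
    qed
    thus ?thesis using h(2) by (intro exI[of _ "h - h0"]) auto
  qed
  have dj: "A' c \<inter> A' c' = {}" if c: "c \<in> S'" "c' \<in> S'" "c \<noteq> c'" for c c'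
  proof -
    have "(\<lambda>d. if d = c then s1 else s2) ` S' \<subseteq> S" using S(2,3) by auto
    from visit[OF this] obtain h where
      h: "\<And>d. d \<in> S' \<Longrightarrow> (f ^^ h) ` A' d \<subseteq> A (if d = c then s1 else s2)" by blast
    have "(f ^^ h) ` A' c \<subseteq> A s1" "(f ^^ h) ` A' c' \<subseteq> A s2" using h[OF c(1)] h[OF c(2)] c(3) by simp_all
    thus ?thesis using A(3)[OF S(2-4)] by blast
  qed
  have "densely_indep X f A' S'"
  proof (rule densely_indep_transfer[OF F(3) fX])
    fix c assume c: "c \<in> S'"
    show "\<exists>r\<in>Pi\<^sub>E F (\<lambda>_. S). (f ^^ h0) ` (X \<inter> B F r) \<subseteq> A' c"
      by (rule bexI[OF _ \<omega>[OF c]]) (auto simp: A'_def)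
  qed
  with sub cmp dj visit show ?thesis by (intro exI[of _ A']) blast
qed

section \<open>Irreducible continua\<close>

lemma finite_chain_Inter_mem:
  assumes "finite \<F>" "\<F> \<noteq> {}" "\<And>S T. S \<in> \<F> \<Longrightarrow> T \<in> \<F> \<Longrightarrow> S \<subseteq> T \<or> T \<subseteq> S"
  shows "\<Inter>\<F> \<in> \<F>"
  using assms
proof (induction \<F> rule: finite_ne_induct)
  case (insert S \<F>)
  have "\<Inter>\<F> \<in> \<F>" using insert.IH insert.prems by blast
  hence "S \<subseteq> \<Inter>\<F> \<or> \<Inter>\<F> \<subseteq> S" using insert.prems[of S "\<Inter>\<F>"] by blast
  thus ?case
  proof
    assume "S \<subseteq> \<Inter>\<F>"
    hence "\<Inter>(insert S \<F>) = S" by auto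
    thus ?case by simp
  next
    assume "\<Inter>\<F> \<subseteq> S"
    hence "\<Inter>(insert S \<F>) = \<Inter>\<F>" by auto
    thus ?case using \<open>\<Inter>\<F> \<in> \<F>\<close> by simp
  qed
qed simp

lemma compact_chain_Inter_nonempty:
  fixes \<F> :: "'a::t2_space set set"
  assumes "\<F> \<noteq> {}" "\<And>S. S \<in> \<F> \<Longrightarrow> compact S \<and> S \<noteq> {}"
    and lin: "\<And>S T. S \<in> \<F> \<Longrightarrow> T \<in> \<F> \<Longrightarrow> S \<subseteq> T \<or> T \<subseteq> S"
  shows "\<Inter>\<F> \<noteq> {}"
proof -
  obtain S where S: "S \<in> \<F>" using assms(1) by blast
  have "S \<inter> \<Inter>\<F> \<noteq> {}"
  proof (rule compact_imp_fip)
    show "compact S" using assms(2)[OF S] by simp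
    show "closed T" if "T \<in> \<F>" for T using assms(2)[OF that] compact_imp_closed by blast
    show "S \<inter> \<Inter>\<F>' \<noteq> {}" if F': "finite \<F>'" "\<F>' \<subseteq> \<F>" for \<F>'
    proof -
      have "\<Inter>(insert S \<F>') \<in> insert S \<F>'"
        by (rule finite_chain_Inter_mem) (use F' S lin in auto)
      moreover have "insert S \<F>' \<subseteq> \<F>" using S F'(2) by simp
      ultimately have "\<Inter>(insert S \<F>') \<in> \<F>" by (rule rev_subsetD)
      from assms(2)[OF this, THEN conjunct2] show ?thesis unfolding Inter_insert .
    qed
  qed
  thus ?thesis by (metis Int_empty_right)
qed

text \<open>
  If the intersection were separated by open sets \<open>U\<close> and \<open>V\<close>, every member of the chain would
  leave \<open>U \<union> V\<close> by connectedness, and by compactness so would the intersection.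
\<close>

lemma continuum_chain_Inter:
  fixes \<F> :: "'a::metric_space set set"
  assumes "\<F> \<noteq> {}" "\<And>K. K \<in> \<F> \<Longrightarrow> continuum K"
    and lin: "\<And>S T. S \<in> \<F> \<Longrightarrow> T \<in> \<F> \<Longrightarrow> S \<subseteq> T \<or> T \<subseteq> S"
  shows "continuum (\<Inter>\<F>)"
proof -
  let ?L = "\<Inter>\<F>"
  have cl: "closed K" if "K \<in> \<F>" for K
    using assms(2)[OF that] compact_imp_closed by (auto simp: continuum_def)
  obtain K0 where K0: "K0 \<in> \<F>" using assms(1) by blast
  have clL: "closed ?L" using cl by (intro closed_Inter) auto
  have "K0 \<inter> ?L = ?L" using K0 by blast
  hence cL: "compact ?L" using compact_Int_closed[OF _ clL, of K0] assms(2)[OF K0]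
    by (simp add: continuum_def)
  have ne: "?L \<noteq> {}"
    using assms(1) by (rule compact_chain_Inter_nonempty) (use assms(2) lin in \<open>auto simp: continuum_def\<close>)
  have "connected ?L"
    unfolding connected_closed
  proof (rule notI, elim exE conjE)
    fix A B assume AB: "closed A" "closed B" "?L \<subseteq> A \<union> B" "A \<inter> B \<inter> ?L = {}" "A \<inter> ?L \<noteq> {}" "B \<inter> ?L \<noteq> {}"
    have "closed (A \<inter> ?L)" "closed (B \<inter> ?L)" "(A \<inter> ?L) \<inter> (B \<inter> ?L) = {}" using AB clL by auto
    then obtain U V where UV: "open U" "open V" "A \<inter> ?L \<subseteq> U" "B \<inter> ?L \<subseteq> V" "U \<inter> V = {}"
      using t4_space[of "A \<inter> ?L" "B \<inter> ?L"] by auto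
    define R where "R = (\<lambda>K. K - (U \<union> V)) ` \<F>"
    have "\<Inter>R \<noteq> {}"
    proof (rule compact_chain_Inter_nonempty)
      show "R \<noteq> {}" using K0 by (auto simp: R_def)
      show "S \<subseteq> T \<or> T \<subseteq> S" if ST: "S \<in> R" "T \<in> R" for S T
      proof -
        obtain K K' where "K \<in> \<F>" "K' \<in> \<F>" "S = K - (U \<union> V)" "T = K' - (U \<union> V)"
          using ST unfolding R_def by blast
        thus ?thesis using lin[of K K'] by blast
      qed
      fix S assume "S \<in> R"
      then obtain K where K: "K \<in> \<F>" "S = K - (U \<union> V)" by (auto simp: R_def)
      have "compact S" unfolding K(2) using assms(2)[OF K(1)] UV by (intro compact_diff) (auto simp: continuum_def)
      moreover have "S \<noteq> {}"
      proof
        assume "S = {}"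
        hence "K \<subseteq> U \<union> V" using K(2) by blast
        moreover have "U \<inter> K \<noteq> {}" "V \<inter> K \<noteq> {}" using AB(5,6) UV(3,4) K(1) by blast+
        moreover have "connected K" using assms(2)[OF K(1)] by (simp add: continuum_def)
        ultimately show False using UV(1,2,5) unfolding connected_def by blast
      qed
      ultimately show "compact S \<and> S \<noteq> {}" ..
    qed
    then obtain x where x: "x \<in> \<Inter>R" by blast
    hence "x \<in> ?L" "x \<notin> U \<union> V" using K0 unfolding R_def by blast+
    thus False using AB(3) UV(3,4) by blast
  qed
  with cL ne show ?thesis by (simp add: continuum_def)
qed

lemma exists_irreducible_continuum:
  fixes X :: "'a::metric_space set"
  assumes "continuum X" "Z \<subseteq> X"
  shows "\<exists>H. subcontinuum H X \<and> Z \<subseteq> H \<and> (\<forall>K. subcontinuum K H \<and> Z \<subseteq> K \<longrightarrow> K = H)"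
proof -
  define \<C> where "\<C> = {K. subcontinuum K X \<and> Z \<subseteq> K}"
  define \<A> where "\<A> = (\<lambda>K. X - K) ` \<C>"
  have inX: "K \<subseteq> X" if "K \<in> \<C>" for K using that by (simp add: \<C>_def subcontinuum_def)
  have "X \<in> \<C>" using assms by (simp add: \<C>_def subcontinuum_def)
  hence ne: "\<A> \<noteq> {}" by (auto simp: \<A>_def)
  have "\<exists>M\<in>\<A>. \<forall>Y\<in>\<A>. M \<subseteq> Y \<longrightarrow> Y = M"
  proof (rule subset_Zorn_nonempty[OF ne])
    fix \<D> assume \<D>: "\<D> \<noteq> {}" "subset.chain \<A> \<D>"
    define \<F> where "\<F> = {K\<in>\<C>. X - K \<in> \<D>}"
    have sub: "\<D> \<subseteq> \<A>" and lin: "\<And>S T. S \<in> \<D> \<Longrightarrow> T \<in> \<D> \<Longrightarrow> S \<subseteq> T \<or> T \<subseteq> S"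
      using \<D>(2) by (auto simp: subset_chain_def)
    have D: "\<D> = (\<lambda>K. X - K) ` \<F>" using sub by (auto simp: \<F>_def \<A>_def)
    have F0: "\<F> \<noteq> {}" using \<D>(1) D by blast
    have "continuum (\<Inter>\<F>)"
    proof (rule continuum_chain_Inter[OF F0])
      show "continuum K" if "K \<in> \<F>" for K using that by (simp add: \<F>_def \<C>_def subcontinuum_def)
      show "S \<subseteq> T \<or> T \<subseteq> S" if ST: "S \<in> \<F>" "T \<in> \<F>" for S T
      proof -
        have "X - S \<in> \<D>" "X - T \<in> \<D>" "S \<subseteq> X" "T \<subseteq> X" using ST inX by (auto simp: \<F>_def)
        thus ?thesis using lin[of "X - S" "X - T"] by blast
      qed
    qed
    moreover have "\<Inter>\<F> \<subseteq> X" using F0 inX by (auto simp: \<F>_def)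
    moreover have "Z \<subseteq> \<Inter>\<F>" by (auto simp: \<F>_def \<C>_def)
    ultimately have "\<Inter>\<F> \<in> \<C>" by (simp add: \<C>_def subcontinuum_def)
    moreover have "\<Union>\<D> = X - \<Inter>\<F>" unfolding D using F0 by auto
    ultimately show "\<Union>\<D> \<in> \<A>" by (simp add: \<A>_def)
  qed
  then obtain H where H: "H \<in> \<C>" "\<And>K. K \<in> \<C> \<Longrightarrow> X - H \<subseteq> X - K \<Longrightarrow> X - K = X - H"
    unfolding \<A>_def by blast
  have "K = H" if K: "subcontinuum K H" "Z \<subseteq> K" for K
  proof -
    have "K \<in> \<C>" using K inX[OF H(1)] by (auto simp: \<C>_def subcontinuum_def)
    moreover have "K \<subseteq> H" using K(1) by (simp add: subcontinuum_def)
    ultimately have "X - K = X - H" using H(2)[of K] by blast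
    thus ?thesis using inX[OF H(1)] inX[OF \<open>K \<in> \<C>\<close>] by blast
  qed
  thus ?thesis using H(1) by (auto simp: \<C>_def)
qed

section \<open>Continua and freely traced sets\<close>

text \<open>
  After removal of two links \<open>C p\<close> and \<open>C r\<close> of a free chain, the links strictly between them
  form a clopen part of the remaining union.
\<close>

lemma connected_meets_free_chain_links:
  fixes X :: "'a::topological_space set"
  assumes fc: "free_chain_in \<U> n C" and cover: "open_cover X \<U>" and K: "connected K" "K \<subseteq> X"
    and idx: "1 \<le> p" "p < q" "q < r" "r \<le> n" "s \<in> {1..n}" "s < p \<or> r < s"
    and x: "x \<in> K" "x \<in> C q" and y: "y \<in> K" "y \<in> C s"
  shows "K \<inter> C p \<noteq> {} \<or> K \<inter> C r \<noteq> {}"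
proof (rule ccontr)
  assume neg: "\<not> ?thesis"
  have inj: "inj_on C {1..n}" and CU: "C ` {1..n} \<subseteq> \<U>"
    using fc by (simp_all add: free_chain_in_def chain_in_def)
  define O1 where "O1 = (\<Union>i\<in>{p<..<r}. C i)"
  define O2 where "O2 = \<Union>{U\<in>\<U>. U \<notin> C ` {p..r}}"
  have op: "openin (top_of_set X) U" if "U \<in> \<U>" for U using cover that by (simp add: open_cover_def)
  have "openin (top_of_set X) O1"
    unfolding O1_def using CU idx by (intro openin_Union) (auto intro!: op)
  moreover have "openin (top_of_set X) O2" unfolding O2_def by (intro openin_Union) (auto intro: op)
  ultimately obtain T1 T2 where T: "open T1" "O1 = X \<inter> T1" "open T2" "O2 = X \<inter> T2"
    unfolding openin_open by auto
  have "K \<subseteq> O1 \<union> O2"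
  proof
    fix z assume z: "z \<in> K"
    hence "z \<in> \<Union>\<U>" using K(2) cover by (auto simp: open_cover_def)
    then obtain U where U: "U \<in> \<U>" "z \<in> U" by blast
    show "z \<in> O1 \<union> O2"
    proof (cases "U \<in> C ` {p..r}")
      case True
      then obtain i where i: "i \<in> {p..r}" "U = C i" by blast
      with U z neg have "i \<noteq> p" "i \<noteq> r" by auto
      hence "i \<in> {p<..<r}" using i(1) by auto
      thus ?thesis using U i by (auto simp: O1_def)
    next
      case False
      thus ?thesis using U by (auto simp: O2_def)
    qed
  qed
  hence "K \<subseteq> T1 \<union> T2" using T by blast
  moreover have "O1 \<inter> O2 = {}"
  proof (rule ccontr)
    assume "O1 \<inter> O2 \<noteq> {}"
    then obtain z i U where z: "i \<in> {p<..<r}" "z \<in> C i" "U \<in> \<U>" "U \<notin> C ` {p..r}" "z \<in> U"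
      unfolding O1_def O2_def by blast
    have "closure U \<inter> closure (C i) \<noteq> {}" using z closure_subset by blast
    moreover have "1 < i" "i < n" using z(1) idx by auto
    ultimately have "U \<in> {C (i - 1), C i, C (i + 1)}"
      using fc z(3) unfolding free_chain_in_def by blast
    moreover have "i - 1 \<in> {p..r}" "i \<in> {p..r}" "i + 1 \<in> {p..r}" using z(1) by auto
    ultimately show False using z(4) by blast
  qed
  hence "T1 \<inter> T2 \<inter> K = {}" using T K(2) by blast
  moreover have "x \<in> T1"
  proof -
    have "x \<in> O1" using x(2) idx by (auto simp: O1_def)
    thus ?thesis using T by blast
  qed
  moreover have "y \<in> T2"
  proof -
    have "C s \<notin> C ` {p..r}"
    proof
      assume "C s \<in> C ` {p..r}"
      then obtain i where "i \<in> {p..r}" "C s = C i" by blast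
      hence "s = i" using inj idx by (intro inj_onD[OF inj]) auto
      thus False using \<open>i \<in> {p..r}\<close> idx(6) by auto
    qed
    moreover have "C s \<in> \<U>" using CU idx(5) by blast
    ultimately have "y \<in> O2" using y(2) unfolding O2_def by blast
    thus ?thesis using T by blast
  qed
  ultimately show False using K(1) T(1,3) x(1) y(1) unfolding connected_def by blast
qed

lemma dist_le_mesh:
  fixes \<U> :: "'a::metric_space set set"
  assumes "finite \<U>" "U \<in> \<U>" "bounded U" "x \<in> U" "y \<in> U"
  shows "dist x y \<le> mesh \<U>"
proof -
  have "dist x y \<le> diameter U" using assms(3-5) by (intro diameter_bounded_bound)
  also have "\<dots> \<le> mesh \<U>" unfolding mesh_def using assms(1,2) by (intro Max_ge) auto
  finally show ?thesis .
qed

text \<open>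
  A pattern \<open>z \<rightarrow> x \<rightarrow> y\<close> would not suffice, because in a graph with cycles a connected set can
  run from \<open>x\<close> to \<open>y\<close> without passing \<open>z\<close>. But with a point \<open>z'\<close> of \<open>Z\<close> close to \<open>z\<close> and the
  pattern \<open>z \<rightarrow> x \<rightarrow> z' \<rightarrow> y\<close>, a connected set containing \<open>x\<close> and \<open>y\<close> leaves the part of the
  chain around \<open>x\<close> on one side or the other, and so comes close to \<open>z\<close> in either case.
\<close>

lemma subcontinuum_contains_freely_traced_set:
  fixes X :: "'a::metric_space set"
  assumes ft: "freely_tracing_by_free_chains G X Z" and X: "compact X" and ZX: "Z \<subseteq> X"
    and perfect: "\<And>z e. z \<in> Z \<Longrightarrow> e > 0 \<Longrightarrow> \<exists>z'\<in>Z. z' \<noteq> z \<and> dist z z' < e"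
    and K: "subcontinuum K X" and xy: "x \<in> K \<inter> Z" "y \<in> K \<inter> Z" "x \<noteq> y"
  shows "Z \<subseteq> K"
proof
  fix z assume z: "z \<in> Z"
  show "z \<in> K"
  proof (rule ccontr)
    assume zK: "z \<notin> K"
    have "closed K" using K by (auto simp: subcontinuum_def continuum_def intro: compact_imp_closed)
    hence "open (- K)" "z \<in> - K" using zK by auto
    then obtain e where e: "e > 0" "\<And>k. dist k z < e \<Longrightarrow> k \<notin> K" unfolding open_dist by blast
    have zxy: "z \<noteq> x" "z \<noteq> y" using zK xy by auto
    define d where "d = min (e / 2) (min (dist z x) (dist z y))"
    have "d > 0" using e(1) zxy by (simp add: d_def)
    then obtain z' where z': "z' \<in> Z" "z' \<noteq> z" "dist z z' < d" using perfect[OF z] by blast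
    have ne: "z' \<noteq> x" "z' \<noteq> y" using z'(3) by (auto simp: d_def)
    define w where "w i = (if i = 1 then z else if i = 2 then x else if i = 3 then z' else y)" for i :: nat
    have I: "{1..4} = {1, 2, 3, 4 :: nat}" by auto
    have "w ` {1..4} \<subseteq> Z" "inj_on w {1..4}"
      unfolding I using z z' xy zxy ne by (auto simp: w_def inj_on_def)
    moreover have "e / 2 > 0" "(4::nat) \<ge> 1" using e(1) by auto
    ultimately obtain \<U> n C where U: "finite \<U>" "open_cover X \<U>" "mesh \<U> < e / 2"
      and C: "free_chain_in \<U> n C" "follows_from_pattern n C 4 w"
      using ft unfolding freely_tracing_by_free_chains_def by meson
    obtain j where j: "j ` {1..4} \<subseteq> {1..n}" "strict_mono_on {1..4} j \<or> strict_antimono_on {1..4} j"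
      "\<And>i. i \<in> {1..4} \<Longrightarrow> w i \<in> C (j i)"
      using C(2) unfolding follows_from_pattern_def by blast
    have jn: "j 1 \<in> {1..n}" "j 2 \<in> {1..n}" "j 3 \<in> {1..n}" "j 4 \<in> {1..n}"
      using j(1) unfolding I by blast+
    have wC: "z \<in> C (j 1)" "x \<in> C (j 2)" "z' \<in> C (j 3)" "y \<in> C (j 4)"
      using j(3)[of 1] j(3)[of 2] j(3)[of 3] j(3)[of 4] by (simp_all add: w_def)
    have cK: "connected K" "K \<subseteq> X" using K by (auto simp: subcontinuum_def continuum_def)
    have "K \<inter> C (j 1) \<noteq> {} \<or> K \<inter> C (j 3) \<noteq> {}"
      using j(2)
    proof
      assume "strict_mono_on {1..4} j"
      hence "j 1 < j 2" "j 2 < j 3" "j 3 < j 4" by (auto simp: strict_mono_on_def)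
      thus ?thesis using xy jn wC
        by (intro connected_meets_free_chain_links[OF C(1) U(2) cK, of "j 1" "j 2" "j 3" "j 4" x y]) auto
    next
      assume "strict_antimono_on {1..4} j"
      hence "j 2 < j 1" "j 3 < j 2" "j 4 < j 3" by (auto simp: monotone_on_def)
      hence "K \<inter> C (j 3) \<noteq> {} \<or> K \<inter> C (j 1) \<noteq> {}" using xy jn wC
        by (intro connected_meets_free_chain_links[OF C(1) U(2) cK, of "j 3" "j 2" "j 1" "j 4" x y]) auto
      thus ?thesis by blast
    qed
    then obtain k i where k: "k \<in> K" "k \<in> C i" "i \<in> {1..n}" "z \<in> C i \<or> z' \<in> C i" using jn wC by blast
    have CU: "C i \<in> \<U>" using C(1) k(3) by (auto simp: free_chain_in_def chain_in_def)
    hence "C i \<subseteq> X" using U(2) by (auto simp: open_cover_def)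
    hence bd: "bounded (C i)" using compact_imp_bounded[OF X] bounded_subset by blast
    have near: "dist k v < e / 2" if "v \<in> C i" for v
      using dist_le_mesh[OF U(1) CU bd k(2) that] U(3) by simp
    have "dist k z < e"
    proof (cases "z \<in> C i")
      case True
      thus ?thesis using near[OF True] e(1) by simp
    next
      case False
      hence "dist k z' < e / 2" using k(4) near by blast
      moreover have "dist z' z < e / 2" using z'(3) by (simp add: d_def dist_commute)
      ultimately show ?thesis using dist_triangle[of k z z'] by linarith
    qed
    thus False using e(2) k(1) by blast
  qed
qed

text \<open>
  Take a subcontinuum that is minimal among those containing \<open>Z\<close>. Any of its subcontinua with two
  points of \<open>Z\<close> contains \<open>Z\<close> and is therefore everything. If it were the union of two proper
  subcontinua, one of them would contain two of three given points of \<open>Z\<close>.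
\<close>

lemma exists_indecomposable_hull:
  fixes X :: "'a::metric_space set"
  assumes "freely_tracing_by_free_chains G X Z" and X: "continuum X" and ZX: "Z \<subseteq> X" and "z0 \<in> Z"
    and perfect: "\<And>z e. z \<in> Z \<Longrightarrow> e > 0 \<Longrightarrow> \<exists>z'\<in>Z. z' \<noteq> z \<and> dist z z' < e"
  shows "\<exists>H. subcontinuum H X \<and> indecomposable H \<and> vertically_embedded Z H"
proof -
  have cX: "compact X" using X by (simp add: continuum_def)
  obtain H where H: "subcontinuum H X" "Z \<subseteq> H" "\<And>K. subcontinuum K H \<Longrightarrow> Z \<subseteq> K \<Longrightarrow> K = H"
    using exists_irreducible_continuum[OF X ZX] by blast
  have full: "K = H" if K: "subcontinuum K H" "x \<in> K \<inter> Z" "y \<in> K \<inter> Z" "x \<noteq> y" for K x y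
  proof (rule H(3)[OF K(1)])
    have "subcontinuum K X" using K(1) H(1) by (auto simp: subcontinuum_def)
    from subcontinuum_contains_freely_traced_set[OF assms(1) cX ZX perfect this K(2-4)]
    show "Z \<subseteq> K" .
  qed
  obtain z1 where z1: "z1 \<in> Z" "z1 \<noteq> z0" using perfect[OF \<open>z0 \<in> Z\<close>, of 1] by auto
  have "dist z0 z1 > 0" using z1 by auto
  from perfect[OF \<open>z0 \<in> Z\<close> this] obtain z2 where z2: "z2 \<in> Z" "z2 \<noteq> z0" "dist z0 z2 < dist z0 z1" by blast
  hence "z2 \<noteq> z1" by auto
  have "indecomposable H"
    unfolding indecomposable_def
  proof (intro conjI notI)
    show "nondegenerate H" using z1 \<open>z0 \<in> Z\<close> H(2) by (auto simp: nondegenerate_def)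
    assume "\<exists>A B. subcontinuum A H \<and> A \<noteq> H \<and> subcontinuum B H \<and> B \<noteq> H \<and> H = A \<union> B"
    then obtain A B where AB: "subcontinuum A H" "A \<noteq> H" "subcontinuum B H" "B \<noteq> H" "H = A \<union> B" by blast
    have "z0 \<in> A \<union> B" "z1 \<in> A \<union> B" "z2 \<in> A \<union> B" using AB(5) H(2) \<open>z0 \<in> Z\<close> z1 z2 by auto
    moreover note full[OF AB(1), of z0 z1] full[OF AB(1), of z0 z2] full[OF AB(1), of z1 z2]
      full[OF AB(3), of z0 z1] full[OF AB(3), of z0 z2] full[OF AB(3), of z1 z2]
    ultimately show False using AB(2,4) \<open>z0 \<in> Z\<close> z1 z2 \<open>z2 \<noteq> z1\<close> by blast
  qed
  moreover have "vertically_embedded Z H" unfolding vertically_embedded_def using H(2) full by blast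
  ultimately show ?thesis using H(1) by blast
qed

section \<open>Cantor sets\<close>

lemma compact_cantor_space: "compact (UNIV :: (nat \<Rightarrow> bool) set)"
proof -
  have "compact (UNIV :: bool set)" by (simp add: finite_imp_compact)
  hence "compact_space (euclidean :: bool topology)" by (simp add: compact_space_def)
  hence "compact_space (product_topology (\<lambda>_. euclidean :: bool topology) (UNIV :: nat set))"
    by (simp add: compact_space_product_topology)
  thus ?thesis by (simp add: euclidean_product_topology compact_space_def)
qed

lemma open_coordinate: "open {\<beta> :: nat \<Rightarrow> bool. \<beta> k = b}"
proof -
  have "continuous_on UNIV (\<lambda>\<beta> :: nat \<Rightarrow> bool. \<beta> k)"
    by (rule continuous_on_product_then_coordinatewise[OF continuous_on_id])
  hence "open ((\<lambda>\<beta> :: nat \<Rightarrow> bool. \<beta> k) -` {b})" by (intro open_vimage open_discrete)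
  thus ?thesis by (simp add: vimage_def)
qed

lemma cantor_set_image:
  fixes h :: "(nat \<Rightarrow> bool) \<Rightarrow> 'a::t2_space"
  assumes "continuous_on UNIV h" "inj h"
  shows "cantor_set (range h)"
  unfolding cantor_set_def
  using homeomorphic_compact[OF compact_cantor_space assms(1) refl assms(2)] homeomorphic_sym by blast

lemma cantor_set_parametrization:
  assumes "cantor_set C"
  obtains h :: "(nat \<Rightarrow> bool) \<Rightarrow> 'a::topological_space" where "continuous_on UNIV h" "inj h" "range h = C"
proof -
  from assms obtain h k where "homeomorphism (UNIV :: (nat \<Rightarrow> bool) set) C h k"
    unfolding cantor_set_def using homeomorphic_sym[of C] unfolding homeomorphic_def by blast
  hence "continuous_on UNIV h" "range h = C" "\<And>b. k (h b) = b" by (auto simp: homeomorphism_def)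
  thus thesis using that[of h] by (metis injI)
qed

text \<open>
  The first coordinate decides between the two sets, and the remaining ones are the parameter in
  the chosen one.
\<close>

lemma cantor_set_Un:
  fixes C D :: "'a::t2_space set"
  assumes "cantor_set C" "cantor_set D" "C \<inter> D = {}"
  shows "cantor_set (C \<union> D)"
proof -
  obtain h :: "(nat \<Rightarrow> bool) \<Rightarrow> 'a" where h: "continuous_on UNIV h" "inj h" "range h = C"
    using cantor_set_parametrization[OF assms(1)] .
  obtain k :: "(nat \<Rightarrow> bool) \<Rightarrow> 'a" where k: "continuous_on UNIV k" "inj k" "range k = D"
    using cantor_set_parametrization[OF assms(2)] .
  define F where "F \<beta> = (if \<beta> 0 then h (\<lambda>n. \<beta> (Suc n)) else k (\<lambda>n. \<beta> (Suc n)))" for \<beta> :: "nat \<Rightarrow> bool"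
  have shift: "continuous_on UNIV (\<lambda>\<beta> :: nat \<Rightarrow> bool. \<lambda>n. \<beta> (Suc n))"
    by (intro continuous_on_coordinatewise_then_product continuous_on_product_then_coordinatewise[OF continuous_on_id])
  have "continuous_on ({\<beta>. \<beta> 0} \<union> {\<beta>. \<not> \<beta> 0}) F"
    unfolding F_def
  proof (rule continuous_on_open_Un)
    show "open {\<beta> :: nat \<Rightarrow> bool. \<beta> 0}" "open {\<beta> :: nat \<Rightarrow> bool. \<not> \<beta> 0}"
      using open_coordinate[of 0 True] open_coordinate[of 0 False] by auto
    have "continuous_on {\<beta> :: nat \<Rightarrow> bool. \<beta> 0} (\<lambda>\<beta>. h (\<lambda>n. \<beta> (Suc n)))"
      by (rule continuous_on_compose2[OF h(1) continuous_on_subset[OF shift]]) auto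
    thus "continuous_on {\<beta> :: nat \<Rightarrow> bool. \<beta> 0} (\<lambda>\<beta>. if \<beta> 0 then h (\<lambda>n. \<beta> (Suc n)) else k (\<lambda>n. \<beta> (Suc n)))"
      by (rule continuous_on_eq) simp
    have "continuous_on {\<beta> :: nat \<Rightarrow> bool. \<not> \<beta> 0} (\<lambda>\<beta>. k (\<lambda>n. \<beta> (Suc n)))"
      by (rule continuous_on_compose2[OF k(1) continuous_on_subset[OF shift]]) auto
    thus "continuous_on {\<beta> :: nat \<Rightarrow> bool. \<not> \<beta> 0} (\<lambda>\<beta>. if \<beta> 0 then h (\<lambda>n. \<beta> (Suc n)) else k (\<lambda>n. \<beta> (Suc n)))"
      by (rule continuous_on_eq) simp
  qed
  moreover have "{\<beta> :: nat \<Rightarrow> bool. \<beta> 0} \<union> {\<beta>. \<not> \<beta> 0} = UNIV" by auto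
  ultimately have cF: "continuous_on UNIV F" by simp
  have "inj F"
  proof (rule injI)
    fix \<beta> \<gamma> assume eq: "F \<beta> = F \<gamma>"
    have hC: "h b \<in> C" "k b \<in> D" for b using h(3) k(3) by auto
    have 0: "\<beta> 0 = \<gamma> 0" using eq assms(3) hC unfolding F_def by (metis disjoint_iff)
    hence "(\<lambda>n. \<beta> (Suc n)) = (\<lambda>n. \<gamma> (Suc n))"
      using eq h(2) k(2) unfolding F_def inj_def by metis
    hence "\<beta> n = \<gamma> n" for n using 0 by (cases n) (auto dest: fun_cong)
    thus "\<beta> = \<gamma>" by blast
  qed
  moreover have "range F = C \<union> D"
  proof
    show "range F \<subseteq> C \<union> D" using h(3) k(3) by (auto simp: F_def)
    have "h b = F (case_nat True b)" "k b = F (case_nat False b)" for b by (simp_all add: F_def)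
    thus "C \<union> D \<subseteq> range F" unfolding h(3)[symmetric] k(3)[symmetric] by auto
  qed
  ultimately show ?thesis using cantor_set_image[OF cF] by metis
qed

lemma cantor_set_UN:
  fixes C :: "nat \<Rightarrow> 'a::t2_space set"
  assumes "m \<ge> 1" "\<And>i. i \<in> {1..m} \<Longrightarrow> cantor_set (C i)"
    and "\<And>i j. i \<in> {1..m} \<Longrightarrow> j \<in> {1..m} \<Longrightarrow> i \<noteq> j \<Longrightarrow> C i \<inter> C j = {}"
  shows "cantor_set (\<Union>i\<in>{1..m}. C i)"
  using assms
proof (induction m rule: dec_induct)
  case base
  thus ?case by simp
next
  case (step n)
  have "{1..Suc n} = insert (Suc n) {1..n}" using step.hyps by auto
  hence "(\<Union>i\<in>{1..Suc n}. C i) = C (Suc n) \<union> (\<Union>i\<in>{1..n}. C i)" by simp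
  moreover have "cantor_set \<dots>"
  proof (rule cantor_set_Un)
    show "cantor_set (C (Suc n))" using step.prems by simp
    show "cantor_set (\<Union>i\<in>{1..n}. C i)" using step.prems by (intro step.IH) auto
    show "C (Suc n) \<inter> (\<Union>i\<in>{1..n}. C i) = {}" using step.prems(2)[of "Suc n"] by fastforce
  qed
  ultimately show ?case by simp
qed

section \<open>Branching schemes and their limit sets\<close>

text \<open>
  The nodes of depth \<open>n\<close> of \<open>m\<close> disjoint binary trees.
\<close>

definition level :: "nat \<Rightarrow> nat \<Rightarrow> (nat \<times> bool list) set" where
  "level m n = {1..m} \<times> {l. length l = n}"

definition parent :: "nat \<times> bool list \<Rightarrow> nat \<times> bool list" where
  "parent c = (fst c, tl (snd c))"

text \<open>
  The latest digit is the head of the list, so that the parent of a node is the tail of its list.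
\<close>

primrec code :: "(nat \<Rightarrow> bool) \<Rightarrow> nat \<Rightarrow> bool list" where
  "code \<beta> 0 = []"
| "code \<beta> (Suc n) = \<beta> n # code \<beta> n"

lemma length_code: "length (code \<beta> n) = n"
  by (induction n) auto

lemma code_cong: "(\<And>k. k < n \<Longrightarrow> \<beta> k = \<gamma> k) \<Longrightarrow> code \<beta> n = code \<gamma> n"
  by (induction n) auto

lemma finite_level: "finite (level m n)"
proof -
  have "{l :: bool list. length l = n} = {l. set l \<subseteq> UNIV \<and> length l = n}" by simp
  thus ?thesis unfolding level_def using finite_lists_length_eq[of "UNIV :: bool set" n] by simp
qed

lemma parent_in_level: "c \<in> level m (Suc n) \<Longrightarrow> parent c \<in> level m n"
  by (auto simp: level_def parent_def)

text \<open>
  The sets of a scheme satisfy the conclusions of the theorem approximately, with precision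
  \<open>1/(n + 1)\<close> at level \<open>n + 1\<close>. All conditions persist under the passage to the limit points of the
  branches.
\<close>

locale branching_scheme =
  fixes G :: "'b::metric_space set" and X :: "'a::metric_space set" and f :: "'a \<Rightarrow> 'a"
    and m :: nat and B :: "nat \<Rightarrow> nat \<times> bool list \<Rightarrow> 'a set"
  assumes compact_X: "compact X" and maps: "f ` X \<subseteq> X" and two: "2 \<le> m"
    and compact_B: "c \<in> level m n \<Longrightarrow> compact (B n c)"
    and B_subset: "c \<in> level m n \<Longrightarrow> B n c \<subseteq> X"
    and disjoint: "c \<in> level m n \<Longrightarrow> c' \<in> level m n \<Longrightarrow> c \<noteq> c' \<Longrightarrow> B n c \<inter> B n c' = {}"
    and dense: "densely_indep X f (B n) (level m n)"
    and nested: "c \<in> level m (Suc n) \<Longrightarrow> B (Suc n) c \<subseteq> B n (parent c)"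
    and visit: "\<phi> ` level m (Suc n) \<subseteq> level m n \<Longrightarrow>
      \<exists>h\<ge>n. \<forall>c\<in>level m (Suc n). (f ^^ h) ` B (Suc n) c \<subseteq> B n (\<phi> c)"
    and tracing: "distinct xs \<Longrightarrow> set xs = level m (Suc n) \<Longrightarrow> traced G X (1 / real (Suc n)) (B (Suc n)) xs"
begin

text \<open>
  Each set is contained in one link of a cover that traces some enumeration of the level.
\<close>

lemma B_small:
  assumes "c \<in> level m (Suc n)" "x \<in> B (Suc n) c" "y \<in> B (Suc n) c"
  shows "dist x y < 1 / real (Suc n)"
proof -
  obtain xs where xs: "set xs = level m (Suc n)" "distinct xs"
    using finite_distinct_list[OF finite_level] by blast
  from tracing[OF xs(2,1)] obtain \<U> N C j where U: "finite \<U>" "open_cover X \<U>" "mesh \<U> < 1 / real (Suc n)"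
    "free_chain_in \<U> N C" "\<forall>i<length xs. j i \<in> {1..N} \<and> B (Suc n) (xs ! i) \<subseteq> C (j i)"
    unfolding traced_def by blast
  obtain i where i: "i < length xs" "xs ! i = c" using assms(1) xs(1) by (metis in_set_conv_nth)
  have CU: "C (j i) \<in> \<U>" using U(4,5) i(1) by (auto simp: free_chain_in_def chain_in_def)
  hence "C (j i) \<subseteq> X" using U(2) by (auto simp: open_cover_def)
  hence "bounded (C (j i))" using compact_imp_bounded[OF compact_X] bounded_subset by blast
  moreover have "x \<in> C (j i)" "y \<in> C (j i)" using U(5) i assms(2,3) by auto
  ultimately show ?thesis using dist_le_mesh[OF U(1) CU] U(3) by fastforce
qed

lemma eventually_B_small:
  assumes "e > 0"
  shows "\<forall>\<^sub>F n in sequentially. \<forall>c\<in>level m n. \<forall>x\<in>B n c. \<forall>y\<in>B n c. dist x y < e"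
proof (subst eventually_sequentially_Suc[symmetric])
  have "(\<lambda>n. 1 / real (Suc n)) \<longlonglongrightarrow> 0" using LIMSEQ_inverse_real_of_nat by (simp add: inverse_eq_divide)
  hence "\<forall>\<^sub>F n in sequentially. 1 / real (Suc n) < e" using assms by (rule order_tendstoD)
  thus "\<forall>\<^sub>F n in sequentially. \<forall>c\<in>level m (Suc n). \<forall>x\<in>B (Suc n) c. \<forall>y\<in>B (Suc n) c. dist x y < e"
    by eventually_elim (use B_small less_trans in blast)
qed

lemma code_in_level: "i \<in> {1..m} \<Longrightarrow> (i, code \<beta> n) \<in> level m n"
  by (simp add: level_def length_code)

lemma B_nonempty: "c \<in> level m n \<Longrightarrow> B n c \<noteq> {}"
  using densely_indep_nonempty[OF dense finite_level _ maps] by blast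

definition point :: "nat \<Rightarrow> (nat \<Rightarrow> bool) \<Rightarrow> 'a" where
  "point i \<beta> = (SOME x. \<forall>n. x \<in> B n (i, code \<beta> n))"

lemma point_in:
  assumes i: "i \<in> {1..m}"
  shows "point i \<beta> \<in> B n (i, code \<beta> n)"
proof -
  define D where "D n = B n (i, code \<beta> n)" for n
  have D: "compact (D n)" "D n \<noteq> {}" for n
    using compact_B B_nonempty code_in_level[OF i] by (auto simp: D_def)
  have "D (Suc n) \<subseteq> D n" for n
    using nested[OF code_in_level[OF i, of \<beta> "Suc n"]] by (simp add: D_def parent_def)
  hence dec: "D n \<subseteq> D k" if "k \<le> n" for k n using that by (rule lift_Suc_antimono_le)
  have "\<Inter>(range D) \<noteq> {}"
  proof (rule compact_chain_Inter_nonempty)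
    show "S \<subseteq> T \<or> T \<subseteq> S" if "S \<in> range D" "T \<in> range D" for S T
      using that dec by (metis imageE nle_le)
  qed (use D in auto)
  then obtain x where "\<forall>n. x \<in> B n (i, code \<beta> n)" by (auto simp: D_def)
  hence "\<forall>n. point i \<beta> \<in> B n (i, code \<beta> n)" unfolding point_def by (rule someI)
  thus ?thesis by blast
qed

lemma point_inject:
  assumes "i \<in> {1..m}" "i' \<in> {1..m}" "point i \<beta> = point i' \<beta>'"
  shows "i = i' \<and> \<beta> = \<beta>'"
proof -
  have eq: "(i, code \<beta> n) = (i', code \<beta>' n)" for n
    using disjoint[of "(i, code \<beta> n)" n "(i', code \<beta>' n)"] point_in[OF assms(1), of \<beta> n]
      point_in[OF assms(2), of \<beta>' n] code_in_level assms by auto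
  have "\<beta> n = \<beta>' n" for n using eq[of "Suc n"] by simp
  thus ?thesis using eq[of 0] by auto
qed

lemma continuous_point:
  assumes i: "i \<in> {1..m}"
  shows "continuous_on UNIV (point i)"
  unfolding continuous_on_def
proof (intro ballI tendstoI)
  fix \<beta> :: "nat \<Rightarrow> bool" and e :: real assume "e > 0"
  from eventually_happens'[OF sequentially_bot eventually_B_small[OF this]]
  obtain n where n: "\<And>c x y. c \<in> level m n \<Longrightarrow> x \<in> B n c \<Longrightarrow> y \<in> B n c \<Longrightarrow> dist x y < e" by blast
  have "\<forall>\<^sub>F \<gamma> in at \<beta>. \<forall>k\<in>{..<n}. \<gamma> k = \<beta> k"
  proof (rule eventually_ball_finite[OF finite_lessThan], rule ballI)
    fix k
    have "\<beta> \<in> {\<gamma>. \<gamma> k = \<beta> k}" by simp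
    from eventually_nhds_in_open[OF open_coordinate this]
    show "\<forall>\<^sub>F \<gamma> in at \<beta>. \<gamma> k = \<beta> k" by (simp add: eventually_at_filter eventually_mono)
  qed
  thus "\<forall>\<^sub>F \<gamma> in at \<beta>. dist (point i \<gamma>) (point i \<beta>) < e"
  proof eventually_elim
    case (elim \<gamma>)
    hence "code \<gamma> n = code \<beta> n" by (intro code_cong) auto
    thus ?case using n[OF code_in_level[OF i, of \<beta>]] point_in[OF i, of \<gamma> n] point_in[OF i, of \<beta> n] by simp
  qed
qed

definition piece :: "nat \<Rightarrow> 'a set" where
  "piece i = range (point i)"

definition limit_set :: "'a set" where
  "limit_set = (\<Union>i\<in>{1..m}. piece i)"

lemma cantor_piece:
  assumes "i \<in> {1..m}"
  shows "cantor_set (piece i)"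
  unfolding piece_def using continuous_point[OF assms] point_inject[OF assms assms]
  by (intro cantor_set_image) (auto intro: injI)

lemma cantor_limit_set: "cantor_set limit_set"
  unfolding limit_set_def
proof (rule cantor_set_UN)
  show "1 \<le> m" using two by simp
  show "piece i \<inter> piece j = {}" if "i \<in> {1..m}" "j \<in> {1..m}" "i \<noteq> j" for i j
    using point_inject that by (auto simp: piece_def)
qed (rule cantor_piece)

lemma limit_setE:
  assumes "z \<in> limit_set"
  obtains i \<beta> where "i \<in> {1..m}" "z = point i \<beta>"
  using assms by (auto simp: limit_set_def piece_def)

lemma point_in_limit_set: "i \<in> {1..m} \<Longrightarrow> point i \<beta> \<in> limit_set"
  unfolding limit_set_def piece_def by blast

lemma piece_subset: "i \<in> {1..m} \<Longrightarrow> piece i \<subseteq> B 0 (i, [])"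
  using point_in[of i _ 0] by (auto simp: piece_def)

lemma limit_set_subset: "limit_set \<subseteq> X"
proof
  fix z assume "z \<in> limit_set"
  then obtain i \<beta> where "i \<in> {1..m}" "z = point i \<beta>" by (rule limit_setE)
  thus "z \<in> X" using point_in[of i \<beta> 0] B_subset[OF code_in_level] by blast
qed

text \<open>
  Change a late digit of the code.
\<close>

lemma limit_set_perfect:
  assumes "z \<in> limit_set" "e > 0"
  shows "\<exists>z'\<in>limit_set. z' \<noteq> z \<and> dist z z' < e"
proof -
  obtain i \<beta> where z: "i \<in> {1..m}" "z = point i \<beta>" using assms(1) by (rule limit_setE)
  from eventually_happens'[OF sequentially_bot eventually_B_small[OF assms(2)]]
  obtain n where n: "\<And>c x y. c \<in> level m n \<Longrightarrow> x \<in> B n c \<Longrightarrow> y \<in> B n c \<Longrightarrow> dist x y < e" by blast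
  define \<gamma> where "\<gamma> = \<beta>(n := \<not> \<beta> n)"
  have "code \<gamma> n = code \<beta> n" by (rule code_cong) (simp add: \<gamma>_def)
  hence "dist z (point i \<gamma>) < e"
    unfolding z(2) using n[OF code_in_level[OF z(1), of \<beta>]] point_in[OF z(1), of \<gamma> n] point_in[OF z(1), of \<beta> n] by simp
  moreover have "\<gamma> \<noteq> \<beta>" by (auto simp: \<gamma>_def fun_eq_iff)
  hence "point i \<gamma> \<noteq> z" using point_inject[OF z(1) z(1), of \<gamma> \<beta>] z(2) by blast
  ultimately show ?thesis using point_in_limit_set[OF z(1)] by blast
qed

definition addr :: "nat \<Rightarrow> 'a \<Rightarrow> nat \<times> bool list" where
  "addr n z = (SOME c. c \<in> level m n \<and> z \<in> B n c)"

lemma addr: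
  assumes "z \<in> limit_set"
  shows "addr n z \<in> level m n" "z \<in> B n (addr n z)"
proof -
  obtain i \<beta> where z: "i \<in> {1..m}" "z = point i \<beta>" using assms by (rule limit_setE)
  hence "(i, code \<beta> n) \<in> level m n \<and> z \<in> B n (i, code \<beta> n)" using code_in_level point_in by blast
  hence "addr n z \<in> level m n \<and> z \<in> B n (addr n z)" unfolding addr_def by (rule someI)
  thus "addr n z \<in> level m n" "z \<in> B n (addr n z)" by auto
qed

lemma eventually_addr_subset:
  assumes "z \<in> limit_set" "openin (top_of_set X) U" "z \<in> U"
  shows "\<forall>\<^sub>F n in sequentially. B n (addr n z) \<subseteq> U"
proof -
  obtain e where e: "e > 0" "\<And>x. x \<in> X \<Longrightarrow> dist x z < e \<Longrightarrow> x \<in> U"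
    using assms(2,3) unfolding openin_euclidean_subtopology_iff by blast
  from eventually_B_small[OF e(1)] show ?thesis
  proof eventually_elim
    case (elim n)
    show ?case
    proof
      fix x assume x: "x \<in> B n (addr n z)"
      thus "x \<in> U" using e(2)[of x] elim addr[OF assms(1), of n] B_subset by blast
    qed
  qed
qed

lemma eventually_inj_addr:
  assumes "y ` {1..k::nat} \<subseteq> limit_set" "inj_on y {1..k}"
  shows "\<forall>\<^sub>F n in sequentially. inj_on (\<lambda>i. addr n (y i)) {1..k}"
proof -
  have "\<forall>\<^sub>F n in sequentially. \<forall>i\<in>{1..k}. \<forall>j\<in>{1..k}. i \<noteq> j \<longrightarrow> addr n (y i) \<noteq> addr n (y j)"
  proof (intro eventually_ball_finite ballI finite_atLeastAtMost)
    fix i j assume ij: "i \<in> {1..k}" "j \<in> {1..k}"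
    show "\<forall>\<^sub>F n in sequentially. i \<noteq> j \<longrightarrow> addr n (y i) \<noteq> addr n (y j)"
    proof (cases "i = j")
      case False
      hence "y i \<noteq> y j" using inj_onD[OF assms(2)] ij by blast
      hence "dist (y i) (y j) > 0" by simp
      from eventually_B_small[OF this] show ?thesis
      proof eventually_elim
        case (elim n)
        have "y i \<in> limit_set" "y j \<in> limit_set" using assms(1) ij by auto
        thus ?case using elim addr[of "y i" n] addr[of "y j" n] by (metis less_irrefl)
      qed
    qed simp
  qed
  thus ?thesis by eventually_elim (auto simp: inj_on_def)
qed

text \<open>
  Each neighbourhood of a limit point contains a set of a deep level, and the sets of a level are
  densely independent.
\<close>

lemma IE_tuple_limit_set:
  assumes "z ` {1..k} \<subseteq> limit_set"
  shows "IE_tuple X f k z"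
  unfolding IE_tuple_def
proof (intro conjI allI impI)
  show "z ` {1..k} \<subseteq> X" using assms limit_set_subset by blast
  fix A assume A: "\<forall>i\<in>{1..k}. openin (top_of_set X) (A i) \<and> z i \<in> A i"
  have "\<forall>\<^sub>F n in sequentially. \<forall>i\<in>{1..k}. B n (addr n (z i)) \<subseteq> A i"
    using assms A by (intro eventually_ball_finite ballI eventually_addr_subset) auto
  from eventually_happens'[OF sequentially_bot this]
  obtain n where n: "\<And>i. i \<in> {1..k} \<Longrightarrow> B n (addr n (z i)) \<subseteq> A i" by blast
  show "has_positive_density_independence X f (A ` {1..k})"
  proof (rule densely_indep_imp_positive_density[OF dense _ maps])
    have "(1, code (\<lambda>_. False) n) \<in> level m n" using two by (intro code_in_level) simp
    thus "level m n \<noteq> {}" by blast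
    fix U assume "U \<in> A ` {1..k}"
    then obtain i where i: "i \<in> {1..k}" "U = A i" by blast
    hence "z i \<in> limit_set" using assms by blast
    thus "\<exists>s\<in>level m n. B n s \<subseteq> U" using n[OF i(1)] i(2) addr(1) by blast
  qed
qed

lemma frequently_visits:
  fixes k :: nat
  assumes k: "1 \<le> k" and y: "y ` {1..k} \<subseteq> limit_set" "inj_on y {1..k}" and z: "z ` {1..k} \<subseteq> limit_set"
    and "e > 0"
  shows "\<exists>\<^sub>F n in sequentially. \<forall>i\<in>{1..k}. dist ((f ^^ n) (y i)) (z i) < e"
  unfolding frequently_sequentially
proof
  fix N
  have "\<forall>\<^sub>F n in sequentially. inj_on (\<lambda>i. addr (Suc n) (y i)) {1..k}"
    using eventually_sequentially_Suc[THEN iffD2, OF eventually_inj_addr[OF y]] .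
  with eventually_B_small[OF \<open>e > 0\<close>] eventually_ge_at_top[of N]
  have "\<forall>\<^sub>F n in sequentially. (\<forall>c\<in>level m n. \<forall>x\<in>B n c. \<forall>y\<in>B n c. dist x y < e) \<and> N \<le> n \<and>
    inj_on (\<lambda>i. addr (Suc n) (y i)) {1..k}" by eventually_elim simp
  from eventually_happens'[OF sequentially_bot this] obtain n where
    small: "\<And>c x y. c \<in> level m n \<Longrightarrow> x \<in> B n c \<Longrightarrow> y \<in> B n c \<Longrightarrow> dist x y < e" and
    n: "N \<le> n" "inj_on (\<lambda>i. addr (Suc n) (y i)) {1..k}" by blast
  define a where "a = (\<lambda>i. addr (Suc n) (y i))"
  define \<phi> where "\<phi> c = (if c \<in> a ` {1..k} then addr n (z (inv_into {1..k} a c)) else addr n (z 1))" for c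
  have zl: "addr n (z i) \<in> level m n" if "i \<in> {1..k}" for i using z that addr(1) by blast
  have "\<phi> c \<in> level m n" for c
    using zl[OF inv_into_into[of c a "{1..k}"]] zl[of 1] k unfolding \<phi>_def by simp
  hence "\<phi> ` level m (Suc n) \<subseteq> level m n" by blast
  from visit[OF this] obtain h where h: "h \<ge> n" "\<And>c. c \<in> level m (Suc n) \<Longrightarrow> (f ^^ h) ` B (Suc n) c \<subseteq> B n (\<phi> c)"
    by blast
  have "dist ((f ^^ h) (y i)) (z i) < e" if i: "i \<in> {1..k}" for i
  proof -
    have yi: "y i \<in> limit_set" and zi: "z i \<in> limit_set" using y z i by auto
    have "inv_into {1..k} a (a i) = i" using n(2) i by (intro inv_into_f_f) (simp_all add: a_def)
    hence "\<phi> (a i) = addr n (z i)" using i by (simp add: \<phi>_def)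
    hence "(f ^^ h) (y i) \<in> B n (addr n (z i))"
      using h(2)[of "a i"] addr[OF yi, of "Suc n"] by (auto simp: a_def)
    thus ?thesis using small[of "addr n (z i)"] addr[OF zi] by blast
  qed
  thus "\<exists>n\<ge>N. \<forall>i\<in>{1..k}. dist ((f ^^ n) (y i)) (z i) < e" using h(1) n(1) by (meson order.trans)
qed

text \<open>
  Distinct limit points have distinct addresses from some level on. An enumeration of this level
  that begins with the given order of addresses is traced, and its beginning is the pattern.
\<close>

lemma freely_tracing_limit_set: "freely_tracing_by_free_chains G X limit_set"
  unfolding freely_tracing_by_free_chains_def
proof (intro allI impI, elim conjE)
  fix k :: nat and w :: "nat \<Rightarrow> 'a" and \<epsilon> :: real
  assume k: "1 \<le> k" and w: "w ` {1..k} \<subseteq> limit_set" "inj_on w {1..k}" and \<epsilon>: "0 < \<epsilon>"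
  have "(\<lambda>n. 1 / real (Suc n)) \<longlonglongrightarrow> 0" using LIMSEQ_inverse_real_of_nat by (simp add: inverse_eq_divide)
  hence 1: "\<forall>\<^sub>F n in sequentially. 1 / real (Suc n) < \<epsilon>" using \<epsilon> by (rule order_tendstoD)
  have 2: "\<forall>\<^sub>F n in sequentially. inj_on (\<lambda>i. addr (Suc n) (w i)) {1..k}"
    using eventually_sequentially_Suc[THEN iffD2, OF eventually_inj_addr[OF w]] .
  from eventually_happens'[OF sequentially_bot eventually_conj[OF 1 2]] obtain n where
    n: "1 / real (Suc n) < \<epsilon>" "inj_on (\<lambda>i. addr (Suc n) (w i)) {1..k}" by blast
  define a where "a = (\<lambda>i. addr (Suc n) (w i))"
  have wi: "w i \<in> limit_set" if "i \<in> {1..k}" for i using w(1) that by blast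
  have al: "a i \<in> level m (Suc n)" if "i \<in> {1..k}" for i using addr(1)[OF wi[OF that]] by (simp add: a_def)
  obtain ds where ds: "set ds = level m (Suc n) - a ` {1..k}" "distinct ds"
    using finite_distinct_list[of "level m (Suc n) - a ` {1..k}"] finite_level by auto
  define xs where "xs = map a [1..<Suc k] @ ds"
  have set1: "set [1..<Suc k] = {1..k}" by auto
  have "inj_on a {1..k}" using n(2) by (simp add: a_def)
  hence "distinct (map a [1..<Suc k])" by (simp only: distinct_map set1) simp
  moreover have setm: "set (map a [1..<Suc k]) = a ` {1..k}" by (simp only: set_map set1)
  ultimately have "distinct xs" unfolding xs_def distinct_append using ds by auto
  moreover have "set xs = level m (Suc n)" unfolding xs_def set_append setm ds(1) using al by auto
  ultimately have "traced G X (1 / real (Suc n)) (B (Suc n)) xs" by (rule tracing)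
  then obtain \<U> N C j where U: "finite \<U>" "open_cover X \<U>" "mesh \<U> < 1 / real (Suc n)"
    "polyhedron_of (nerve \<U>) homeomorphic G" "free_chain_in \<U> N C"
    and j: "strict_mono_on {..<length xs} j" "\<And>i. i < length xs \<Longrightarrow> j i \<in> {1..N} \<and> B (Suc n) (xs ! i) \<subseteq> C (j i)"
    unfolding traced_def by blast
  have len: "k \<le> length xs" by (simp add: xs_def)
  have nth: "xs ! (i - 1) = a i" if "i \<in> {1..k}" for i
    using that by (auto simp: xs_def nth_append simp del: upt_Suc)
  have "follows_from_pattern N C k w"
    unfolding follows_from_pattern_def
  proof (intro exI[of _ "\<lambda>i. j (i - 1)"] conjI ballI)
    show "(\<lambda>i. j (i - 1)) ` {1..k} \<subseteq> {1..N}" using j(2) len by fastforce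
    have "strict_mono_on {1..k} (\<lambda>i. j (i - 1))"
      using len by (intro strict_mono_onI strict_mono_onD[OF j(1)]) auto
    thus "strict_mono_on {1..k} (\<lambda>i. j (i - 1)) \<or> strict_antimono_on {1..k} (\<lambda>i. j (i - 1))" ..
    fix i assume i: "i \<in> {1..k}"
    have "w i \<in> B (Suc n) (xs ! (i - 1))" unfolding nth[OF i] a_def by (rule addr(2)[OF wi[OF i]])
    moreover have "i - 1 < length xs" using i len by auto
    ultimately show "w i \<in> C (j (i - 1))" using j(2) by blast
  qed
  moreover have "mesh \<U> < \<epsilon>" using U(3) n(1) by linarith
  ultimately show "\<exists>\<U>. finite \<U> \<and> open_cover X \<U> \<and> mesh \<U> < \<epsilon> \<and> polyhedron_of (nerve \<U>) homeomorphic G \<and>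
    (\<exists>n C. free_chain_in \<U> n C \<and> follows_from_pattern n C k w)" using U by blast
qed

end

section \<open>Scrambled sets\<close>

lemma liminf_eq_0:
  fixes g :: "nat \<Rightarrow> real"
  assumes "\<And>n. 0 \<le> g n" "\<And>e. e > 0 \<Longrightarrow> \<exists>\<^sub>F n in sequentially. g n < e"
  shows "liminf (\<lambda>n. ereal (g n)) = 0"
proof (rule antisym)
  show "0 \<le> liminf (\<lambda>n. ereal (g n))" using assms(1) by (intro Liminf_bounded) simp
  show "liminf (\<lambda>n. ereal (g n)) \<le> 0"
  proof (rule ccontr)
    assume "\<not> ?thesis"
    hence "0 < liminf (\<lambda>n. ereal (g n))" by (simp add: not_le)
    from ereal_dense2[OF this] obtain d where d: "0 < ereal d" "ereal d < liminf (\<lambda>n. ereal (g n))" by blast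
    from less_LiminfD[OF d(2)] have "\<forall>\<^sub>F n in sequentially. \<not> g n < d" by eventually_elim simp
    moreover have "\<exists>\<^sub>F n in sequentially. g n < d" using assms(2)[of d] d(1) by simp
    ultimately show False by (simp add: frequently_def)
  qed
qed

lemma limsup_ge:
  fixes g :: "nat \<Rightarrow> real"
  assumes "\<And>e. e > 0 \<Longrightarrow> \<exists>\<^sub>F n in sequentially. \<delta> - e < g n"
  shows "ereal \<delta> \<le> limsup (\<lambda>n. ereal (g n))"
proof (rule ccontr)
  assume "\<not> ?thesis"
  hence "limsup (\<lambda>n. ereal (g n)) < ereal \<delta>" by (simp add: not_le)
  from ereal_dense2[OF this] obtain d where d: "limsup (\<lambda>n. ereal (g n)) < ereal d" "ereal d < ereal \<delta>" by blast
  from Limsup_lessD[OF d(1)] have "\<forall>\<^sub>F n in sequentially. \<not> \<delta> - (\<delta> - d) < g n" by eventually_elim simp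
  moreover have "\<exists>\<^sub>F n in sequentially. \<delta> - (\<delta> - d) < g n" using assms[of "\<delta> - d"] d(2) by simp
  ultimately show False by (simp add: frequently_def)
qed

text \<open>
  Two points of \<open>Z\<close> simultaneously return near \<open>a\<close> and \<open>a\<close>, and also near \<open>a\<close> and \<open>b\<close>.
\<close>

lemma delta_scrambled_if_frequent_visits:
  fixes X :: "'a::metric_space set"
  assumes Z: "Z \<subseteq> X" "a \<in> Z" "b \<in> Z" "a \<noteq> b"
    and visits: "\<And>(y :: nat \<Rightarrow> 'a) z e. y ` {1..2} \<subseteq> Z \<Longrightarrow> inj_on y {1..2} \<Longrightarrow> z ` {1..2} \<subseteq> Z \<Longrightarrow> e > 0 \<Longrightarrow>
      \<exists>\<^sub>F n in sequentially. \<forall>i\<in>{1..2}. dist ((f ^^ n) (y i)) (z i) < e"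
  shows "delta_scrambled (dist a b) X f Z"
  unfolding delta_scrambled_def
proof (intro conjI ballI impI)
  show "Z \<subseteq> X" by (rule Z(1))
  show "nondegenerate Z" using Z by (auto simp: nondegenerate_def)
  fix u v assume uv: "u \<in> Z" "v \<in> Z" "u \<noteq> v"
  have I: "{1..2} = {1, 2 :: nat}" by auto
  have near: "\<exists>\<^sub>F n in sequentially. dist ((f ^^ n) u) c < e \<and> dist ((f ^^ n) v) d < e"
    if "c \<in> Z" "d \<in> Z" "e > 0" for c d e
    using visits[of "\<lambda>i. if i = 1 then u else v" "\<lambda>i. if i = 1 then c else d" e] uv that
    unfolding I by (simp add: inj_on_def)
  show "liminf (\<lambda>n. ereal (dist ((f ^^ n) u) ((f ^^ n) v))) = 0"
  proof (rule liminf_eq_0)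
    fix e :: real assume "e > 0"
    hence "e / 2 > 0" by simp
    from near[OF Z(2,2) this] show "\<exists>\<^sub>F n in sequentially. dist ((f ^^ n) u) ((f ^^ n) v) < e"
    proof (rule frequently_mono[rotated], intro allI impI)
      fix n assume "dist ((f ^^ n) u) a < e / 2 \<and> dist ((f ^^ n) v) a < e / 2"
      thus "dist ((f ^^ n) u) ((f ^^ n) v) < e" using dist_triangle2[of "(f ^^ n) u" "(f ^^ n) v" a] by linarith
    qed
  qed simp
  show "ereal (dist a b) \<le> limsup (\<lambda>n. ereal (dist ((f ^^ n) u) ((f ^^ n) v)))"
  proof (rule limsup_ge)
    fix e :: real assume "e > 0"
    hence "e / 2 > 0" by simp
    from near[OF Z(2,3) this] show "\<exists>\<^sub>F n in sequentially. dist a b - e < dist ((f ^^ n) u) ((f ^^ n) v)"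
    proof (rule frequently_mono[rotated], intro allI impI)
      fix n assume "dist ((f ^^ n) u) a < e / 2 \<and> dist ((f ^^ n) v) b < e / 2"
      moreover have "dist a b \<le> dist ((f ^^ n) u) a + dist ((f ^^ n) u) ((f ^^ n) v) + dist ((f ^^ n) v) b"
        using dist_triangle[of a b "(f ^^ n) u"] dist_triangle[of "(f ^^ n) u" b "(f ^^ n) v"]
        by (simp add: dist_commute)
      ultimately show "dist a b - e < dist ((f ^^ n) u) ((f ^^ n) v)" by linarith
    qed
  qed
qed

section \<open>Construction of a branching scheme\<close>

text \<open>
  Dependent choice; one step consists of branching, which takes care of the visits and of
  disjointness, and of tracing all enumerations of the new level.
\<close>

lemma exists_branching_scheme:
  fixes G :: "'b::metric_space set" and X :: "'a::metric_space set"
  assumes G: "is_graph G" "G_like G X" and X: "compact X" "X \<noteq> {}" and f: "homeomorphism X X f f'"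
    and m: "2 \<le> m" and A: "densely_indep X f A {1..m}" "\<And>i. i \<in> {1..m} \<Longrightarrow> compact (A i)"
      "\<And>i. i \<in> {1..m} \<Longrightarrow> A i \<subseteq> X"
      "\<And>i j. i \<in> {1..m} \<Longrightarrow> j \<in> {1..m} \<Longrightarrow> i \<noteq> j \<Longrightarrow> A i \<inter> A j = {}"
  shows "\<exists>B. branching_scheme G X f m B \<and> (\<forall>i\<in>{1..m}. B 0 (i, []) = A i)"
proof -
  have maps: "f ` X \<subseteq> X" using f by (simp add: homeomorphism_def)
  define P where "P n D \<longleftrightarrow> (\<forall>c\<in>level m n. compact (D c) \<and> D c \<subseteq> X) \<and>
    (\<forall>c\<in>level m n. \<forall>c'\<in>level m n. c \<noteq> c' \<longrightarrow> D c \<inter> D c' = {}) \<and>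
    densely_indep X f D (level m n) \<and> (n = 0 \<longrightarrow> (\<forall>i\<in>{1..m}. D (i, []) = A i))"
    for n and D :: "nat \<times> bool list \<Rightarrow> 'a set"
  define Q where "Q n D D' \<longleftrightarrow> (\<forall>c\<in>level m (Suc n). D' c \<subseteq> D (parent c)) \<and>
    (\<forall>\<phi>. \<phi> ` level m (Suc n) \<subseteq> level m n \<longrightarrow> (\<exists>h\<ge>n. \<forall>c\<in>level m (Suc n). (f ^^ h) ` D' c \<subseteq> D (\<phi> c))) \<and>
    (\<forall>xs. distinct xs \<and> set xs = level m (Suc n) \<longrightarrow> traced G X (1 / real (Suc n)) D' xs)"
    for n and D D' :: "nat \<times> bool list \<Rightarrow> 'a set"
  have "\<exists>B. \<forall>n. P n (B n) \<and> Q n (B n) (B (Suc n))"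
  proof (rule dependent_nat_choice)
    define D where "D = (\<lambda>c :: nat \<times> bool list. A (fst c))"
    have "densely_indep X f D (level m 0)"
      by (rule densely_indep_transfer[OF A(1) maps, of _ 0]) (auto simp: D_def level_def)
    hence "P 0 D" unfolding P_def using A(2-4) by (auto simp: D_def level_def)
    thus "\<exists>D. P 0 D" by (rule exI[of _ D])
  next
    fix D n assume D: "P n D"
    define s where "s i = (i :: nat, replicate n False)" for i
    have s: "s 1 \<in> level m n" "s 2 \<in> level m n" "s 1 \<noteq> s 2" using m by (auto simp: s_def level_def)
    have cD: "compact (D c)" "D c \<subseteq> X" if "c \<in> level m n" for c using D that by (auto simp: P_def)
    have dD: "D c \<inter> D c' = {}" if "c \<in> level m n" "c' \<in> level m n" "c \<noteq> c'" for c c'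
      using D that by (auto simp: P_def)
    have iD: "densely_indep X f D (level m n)" using D by (simp add: P_def)
    have "\<exists>D1. (\<forall>c\<in>level m (Suc n). D1 c \<subseteq> D (parent c) \<and> compact (D1 c)) \<and>
      (\<forall>c\<in>level m (Suc n). \<forall>c'\<in>level m (Suc n). c \<noteq> c' \<longrightarrow> D1 c \<inter> D1 c' = {}) \<and>
      densely_indep X f D1 (level m (Suc n)) \<and>
      (\<forall>\<phi>. \<phi> ` level m (Suc n) \<subseteq> level m n \<longrightarrow> (\<exists>h\<ge>n. \<forall>c\<in>level m (Suc n). (f ^^ h) ` D1 c \<subseteq> D (\<phi> c)))"
    proof (rule exists_branching_subfamily[where ?s1.0 = "s 1" and ?s2.0 = "s 2"])
      show "compact X" "homeomorphism X X f f'" "densely_indep X f D (level m n)" by (rule X(1) f iD)+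
    qed (use cD(1) dD finite_level s parent_in_level in auto)
    then obtain D1 where all: "(\<forall>c\<in>level m (Suc n). D1 c \<subseteq> D (parent c) \<and> compact (D1 c)) \<and>
      (\<forall>c\<in>level m (Suc n). \<forall>c'\<in>level m (Suc n). c \<noteq> c' \<longrightarrow> D1 c \<inter> D1 c' = {}) \<and>
      densely_indep X f D1 (level m (Suc n)) \<and>
      (\<forall>\<phi>. \<phi> ` level m (Suc n) \<subseteq> level m n \<longrightarrow> (\<exists>h\<ge>n. \<forall>c\<in>level m (Suc n). (f ^^ h) ` D1 c \<subseteq> D (\<phi> c)))"
      by (elim exE)
    have D1: "\<And>c. c \<in> level m (Suc n) \<Longrightarrow> D1 c \<subseteq> D (parent c)"
      "\<And>c. c \<in> level m (Suc n) \<Longrightarrow> compact (D1 c)"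
      "\<And>c c'. c \<in> level m (Suc n) \<Longrightarrow> c' \<in> level m (Suc n) \<Longrightarrow> c \<noteq> c' \<Longrightarrow> D1 c \<inter> D1 c' = {}"
      "densely_indep X f D1 (level m (Suc n))"
      "\<And>\<phi>. \<phi> ` level m (Suc n) \<subseteq> level m n \<Longrightarrow> \<exists>h\<ge>n. \<forall>c\<in>level m (Suc n). (f ^^ h) ` D1 c \<subseteq> D (\<phi> c)"
      using all by simp_all
    have "level m (Suc n) \<noteq> {}"
    proof -
      have "(1, replicate (Suc n) False) \<in> level m (Suc n)" using m by (simp add: level_def)
      thus ?thesis by blast
    qed
    moreover have pos: "1 / real (Suc n) > 0" by simp
    ultimately have "\<exists>D2. (\<forall>c\<in>level m (Suc n). D2 c \<subseteq> D1 c \<and> compact (D2 c)) \<and>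
      densely_indep X f D2 (level m (Suc n)) \<and>
      (\<forall>xs. distinct xs \<and> set xs = level m (Suc n) \<longrightarrow> traced G X (1 / real (Suc n)) D2 xs)"
      by (intro exists_all_traced_subfamily[OF G X f D1(4,2,3) pos finite_level])
    then obtain D2 where D2: "\<And>c. c \<in> level m (Suc n) \<Longrightarrow> D2 c \<subseteq> D1 c"
      "\<And>c. c \<in> level m (Suc n) \<Longrightarrow> compact (D2 c)" "densely_indep X f D2 (level m (Suc n))"
      "\<And>xs. distinct xs \<Longrightarrow> set xs = level m (Suc n) \<Longrightarrow> traced G X (1 / real (Suc n)) D2 xs"
      by blast
    have "P (Suc n) D2"
      unfolding P_def
    proof (intro conjI ballI impI)
      show "compact (D2 c)" if "c \<in> level m (Suc n)" for c by (rule D2(2)[OF that])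
      show "D2 c \<subseteq> X" if "c \<in> level m (Suc n)" for c
        using D2(1)[OF that] D1(1)[OF that] cD(2)[OF parent_in_level[OF that]] by blast
      show "D2 c \<inter> D2 c' = {}" if "c \<in> level m (Suc n)" "c' \<in> level m (Suc n)" "c \<noteq> c'" for c c'
        using D2(1)[OF that(1)] D2(1)[OF that(2)] D1(3)[OF that] by blast
    qed (use D2(3) in auto)
    moreover have "Q n D D2"
      unfolding Q_def
    proof (intro conjI ballI allI impI)
      show "D2 c \<subseteq> D (parent c)" if "c \<in> level m (Suc n)" for c
        using D2(1)[OF that] D1(1)[OF that] by blast
      show "\<exists>h\<ge>n. \<forall>c\<in>level m (Suc n). (f ^^ h) ` D2 c \<subseteq> D (\<phi> c)" if \<phi>: "\<phi> ` level m (Suc n) \<subseteq> level m n" for \<phi>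
      proof -
        obtain h where h: "h \<ge> n" "\<And>c. c \<in> level m (Suc n) \<Longrightarrow> (f ^^ h) ` D1 c \<subseteq> D (\<phi> c)"
          using D1(5)[OF \<phi>] by blast
        have "(f ^^ h) ` D2 c \<subseteq> D (\<phi> c)" if "c \<in> level m (Suc n)" for c
          using h(2)[OF that] D2(1)[OF that] by blast
        thus ?thesis using h(1) by blast
      qed
    qed (use D2(4) in auto)
    ultimately show "\<exists>D'. P (Suc n) D' \<and> Q n D D'" by blast
  qed
  then obtain B where B: "\<And>n. P n (B n)" "\<And>n. Q n (B n) (B (Suc n))" by blast
  have "branching_scheme G X f m B"
  proof
    show "compact X" "f ` X \<subseteq> X" "2 \<le> m" using X(1) maps m by auto
    show "compact (B n c)" "B n c \<subseteq> X" if "c \<in> level m n" for c n using B(1)[of n] that by (auto simp: P_def)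
    show "B n c \<inter> B n c' = {}" if "c \<in> level m n" "c' \<in> level m n" "c \<noteq> c'" for c c' n
      using B(1)[of n] that by (auto simp: P_def)
    show "densely_indep X f (B n) (level m n)" for n using B(1)[of n] by (simp add: P_def)
    show "B (Suc n) c \<subseteq> B n (parent c)" if "c \<in> level m (Suc n)" for c n using B(2)[of n] that by (simp add: Q_def)
    show "\<exists>h\<ge>n. \<forall>c\<in>level m (Suc n). (f ^^ h) ` B (Suc n) c \<subseteq> B n (\<phi> c)"
      if "\<phi> ` level m (Suc n) \<subseteq> level m n" for \<phi> n using B(2)[of n] that by (simp add: Q_def)
    show "traced G X (1 / real (Suc n)) (B (Suc n)) xs" if "distinct xs" "set xs = level m (Suc n)" for xs n
      using B(2)[of n] that by (simp add: Q_def)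
  qed
  moreover have "\<forall>i\<in>{1..m}. B 0 (i, []) = A i" using B(1)[of 0] by (simp add: P_def)
  ultimately show ?thesis by blast
qed

lemma exists_small_disjoint_neighborhoods:
  fixes X :: "'a::metric_space set" and x :: "nat \<Rightarrow> 'a"
  assumes "inj_on x {1..m}" "\<And>i. i \<in> {1..m} \<Longrightarrow> x i \<in> (top_of_set X) interior_of (A i)"
  shows "\<exists>r>0. \<forall>i\<in>{1..m}. X \<inter> cball (x i) r \<subseteq> A i \<and>
    (\<forall>j\<in>{1..m}. i \<noteq> j \<longrightarrow> cball (x i) r \<inter> cball (x j) r = {})"
proof -
  have "\<forall>\<^sub>F r in at_right 0. \<forall>i\<in>{1..m}. X \<inter> cball (x i) r \<subseteq> A i"
  proof (intro eventually_ball_finite ballI finite_atLeastAtMost)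
    fix i assume "i \<in> {1..m}"
    hence xi: "x i \<in> (top_of_set X) interior_of (A i)" by (rule assms(2))
    have op: "openin (top_of_set X) ((top_of_set X) interior_of (A i))" by (rule openin_interior_of)
    have "\<exists>e>0. \<forall>z\<in>X. dist z (x i) < e \<longrightarrow> z \<in> (top_of_set X) interior_of (A i)"
      by (rule op[unfolded openin_euclidean_subtopology_iff, THEN conjunct2, THEN bspec, OF xi])
    then obtain e where e: "e > 0" "\<And>z. z \<in> X \<Longrightarrow> dist z (x i) < e \<Longrightarrow> z \<in> (top_of_set X) interior_of (A i)"
      by blast
    have sub: "(top_of_set X) interior_of (A i) \<subseteq> A i" by (rule interior_of_subset)
    have "\<forall>\<^sub>F r in at_right (0::real). r < e" using e(1) by (rule order_tendstoD[OF tendsto_ident_at])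
    thus "\<forall>\<^sub>F r in at_right 0. X \<inter> cball (x i) r \<subseteq> A i"
    proof eventually_elim
      case (elim r)
      show ?case
      proof
        fix z assume "z \<in> X \<inter> cball (x i) r"
        thus "z \<in> A i" using e(2)[of z] elim sub by (auto simp: dist_commute)
      qed
    qed
  qed
  moreover have "\<forall>\<^sub>F r in at_right 0. \<forall>i\<in>{1..m}. \<forall>j\<in>{1..m}. i \<noteq> j \<longrightarrow> cball (x i) r \<inter> cball (x j) r = {}"
  proof (intro eventually_ball_finite ballI finite_atLeastAtMost)
    fix i j assume ij: "i \<in> {1..m}" "j \<in> {1..m}"
    show "\<forall>\<^sub>F r in at_right 0. i \<noteq> j \<longrightarrow> cball (x i) r \<inter> cball (x j) r = {}"
    proof (cases "i = j")
      case False
      hence "x i \<noteq> x j" using inj_onD[OF assms(1)] ij by blast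
      hence "dist (x i) (x j) / 2 > 0" by simp
      hence "\<forall>\<^sub>F r in at_right (0::real). r < dist (x i) (x j) / 2" by (rule order_tendstoD[OF tendsto_ident_at])
      thus ?thesis
      proof eventually_elim
        case (elim r)
        have False if "z \<in> cball (x i) r" "z \<in> cball (x j) r" for z
          using that elim dist_triangle2[of "x i" "x j" z] by simp
        thus ?case by blast
      qed
    qed simp
  qed
  ultimately have "\<forall>\<^sub>F r in at_right 0. r > 0 \<and> (\<forall>i\<in>{1..m}. X \<inter> cball (x i) r \<subseteq> A i) \<and>
      (\<forall>i\<in>{1..m}. \<forall>j\<in>{1..m}. i \<noteq> j \<longrightarrow> cball (x i) r \<inter> cball (x j) r = {})"
    using eventually_at_right_less by eventually_elim simp
  from eventually_happens'[OF trivial_limit_at_right_real this] show ?thesis by blast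
qed

theorem theorem3p3:
  fixes G :: "'b::metric_space set"
    and X :: "'a::metric_space set"
    and f :: "'a \<Rightarrow> 'a"
    and m :: nat
    and x :: "nat \<Rightarrow> 'a"
    and A :: "nat \<Rightarrow> 'a set"
  assumes "is_graph G"
    and "continuum X"
    and "G_like G X"
    and "\<exists>g. homeomorphism X X f g"
    and "topological_entropy X f > 0"
    and "m \<ge> 2"
    and "inj_on x {1..m}"
    and "IE_tuple X f m x"
    and "\<And>i. i \<in> {1..m} \<Longrightarrow> x i \<in> (top_of_set X) interior_of (A i)"
  shows "\<exists>(Zs :: nat \<Rightarrow> 'a set) H Z.
    (\<forall>i\<in>{1..m}. cantor_set (Zs i) \<and> Zs i \<subseteq> A i) \<and>
    subcontinuum H X \<and> indecomposable H \<and>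
    Z = (\<Union>i\<in>{1..m}. Zs i) \<and>
    cantor_set Z \<and> vertically_embedded Z H \<and>
    freely_tracing_by_free_chains G X Z \<and>
    (\<forall>(n::nat) (z :: nat \<Rightarrow> 'a). z ` {1..n} \<subseteq> Z \<longrightarrow> IE_tuple X f n z) \<and>
    (\<forall>k::nat. k \<ge> 1 \<longrightarrow> (\<forall>(y :: nat \<Rightarrow> 'a) (z :: nat \<Rightarrow> 'a). y ` {1..k} \<subseteq> Z \<and> inj_on y {1..k} \<and> z ` {1..k} \<subseteq> Z \<longrightarrow>
       liminf (\<lambda>n. ereal (Max ((\<lambda>i. dist ((f ^^ n) (y i)) (z i)) ` {1..k}))) = 0)) \<and>
    (\<exists>\<delta>>0. delta_scrambled \<delta> X f Z)"
proof -
  have X: "compact X" "X \<noteq> {}" using assms(2) by (auto simp: continuum_def)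
  obtain f' where f: "homeomorphism X X f f'" using assms(4) by blast
  have maps: "f ` X \<subseteq> X" using f by (simp add: homeomorphism_def)
  have "\<exists>r>0. \<forall>i\<in>{1..m}. X \<inter> cball (x i) r \<subseteq> A i \<and>
      (\<forall>j\<in>{1..m}. i \<noteq> j \<longrightarrow> cball (x i) r \<inter> cball (x j) r = {})"
    using assms(7) by (rule exists_small_disjoint_neighborhoods) (rule assms(9))
  then obtain r where r: "r > 0" "\<And>i. i \<in> {1..m} \<Longrightarrow> X \<inter> cball (x i) r \<subseteq> A i"
    "\<And>i j. i \<in> {1..m} \<Longrightarrow> j \<in> {1..m} \<Longrightarrow> i \<noteq> j \<Longrightarrow> cball (x i) r \<inter> cball (x j) r = {}"
    by (elim exE conjE) simp
  define D where "D i = X \<inter> cball (x i) r" for i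
  have "densely_indep X f D {1..m}"
  proof (rule densely_indep_mono[OF positive_density_imp_densely_indep maps])
    have "x i \<in> X" if "i \<in> {1..m}" for i using assms(8) that by (auto simp: IE_tuple_def)
    hence "\<forall>i\<in>{1..m}. openin (top_of_set X) (X \<inter> ball (x i) r) \<and> x i \<in> X \<inter> ball (x i) r"
      using r(1) by (auto intro: openin_open_Int)
    thus "has_positive_density_independence X f ((\<lambda>i. X \<inter> ball (x i) r) ` {1..m})"
      by (rule assms(8)[unfolded IE_tuple_def, THEN conjunct2, THEN spec, THEN mp])
  qed (auto simp: D_def)
  moreover have "compact (D i)" "D i \<subseteq> X" for i using X(1) by (auto simp: D_def compact_Int_closed)
  moreover have "D i \<inter> D j = {}" if "i \<in> {1..m}" "j \<in> {1..m}" "i \<noteq> j" for i j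
    using r(3)[OF that] by (auto simp: D_def)
  ultimately have "\<exists>B. branching_scheme G X f m B \<and> (\<forall>i\<in>{1..m}. B 0 (i, []) = D i)"
    by (intro exists_branching_scheme[OF assms(1,3) X f assms(6)])
  then obtain B where B: "branching_scheme G X f m B" "\<And>i. i \<in> {1..m} \<Longrightarrow> B 0 (i, []) = D i"
    by (elim exE conjE) simp
  interpret branching_scheme G X f m B by (rule B(1))
  define b where "b i = point i (\<lambda>_. False)" for i
  have m12: "1 \<in> {1..m}" "2 \<in> {1..m}" using assms(6) by auto
  have b: "b 1 \<in> limit_set" "b 2 \<in> limit_set" "b 1 \<noteq> b 2"
    using point_in_limit_set m12 point_inject[OF m12] by (auto simp: b_def)
  obtain H where H: "subcontinuum H X" "indecomposable H" "vertically_embedded limit_set H"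
    using exists_indecomposable_hull[OF freely_tracing_limit_set assms(2) limit_set_subset b(1) limit_set_perfect]
    by blast
  show ?thesis
  proof (rule exI[of _ piece], rule exI[of _ H], rule exI[of _ limit_set], intro conjI ballI allI impI)
    show "cantor_set (piece i)" if "i \<in> {1..m}" for i by (rule cantor_piece[OF that])
    show "piece i \<subseteq> A i" if "i \<in> {1..m}" for i
      using piece_subset[OF that] r(2)[OF that] unfolding B(2)[OF that] D_def by (rule order.trans)
    show "limit_set = (\<Union>i\<in>{1..m}. piece i)" by (rule limit_set_def)
    show "liminf (\<lambda>n. ereal (Max ((\<lambda>i. dist ((f ^^ n) (y i)) (z i)) ` {1..k}))) = 0"
      if k: "1 \<le> k" and yz: "y ` {1..k} \<subseteq> limit_set \<and> inj_on y {1..k} \<and> z ` {1..k} \<subseteq> limit_set"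
      for k :: nat and y z
    proof (rule liminf_eq_0)
      have ne: "{1..k} \<noteq> {}" using k by simp
      show "0 \<le> Max ((\<lambda>i. dist ((f ^^ n) (y i)) (z i)) ` {1..k})" for n
        using k by (subst Max_ge_iff) (auto intro!: bexI[of _ 1])
      fix e :: real assume "e > 0"
      from frequently_visits[OF k _ _ _ this] yz
      have "\<exists>\<^sub>F n in sequentially. \<forall>i\<in>{1..k}. dist ((f ^^ n) (y i)) (z i) < e" by blast
      thus "\<exists>\<^sub>F n in sequentially. Max ((\<lambda>i. dist ((f ^^ n) (y i)) (z i)) ` {1..k}) < e"
        using ne by (simp add: Max_less_iff)
    qed
    have "delta_scrambled (dist (b 1) (b 2)) X f limit_set"
      using limit_set_subset b by (rule delta_scrambled_if_frequent_visits) (rule frequently_visits; simp)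
    thus "\<exists>\<delta>>0. delta_scrambled \<delta> X f limit_set" using b(3) by (intro exI[of _ "dist (b 1) (b 2)"]) simp
  qed (use H cantor_limit_set freely_tracing_limit_set IE_tuple_limit_set in auto)
qed

end
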